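(* Let $u\in W^{k+4,\infty}(\Omega)$ be the solution of $u_t=u_{xx}$, $u(x,0)=u_0(x)$, let $q=u_x$, and let $u_h,q_h\in V_h$ be the solution of the LDG scheme with flux choice (I) or (II). Suppose the initial solution is $u_h(\cdot,0)=u_I^2(\cdot,0)$, with $u_I^2$ the interpolation function (with $l=2$) corresponding to the flux choice used. Let $$e_{u,r}=\max_{j,m}\left|(u-u_h)(R^r_{j,m},t)\right|,\quad e_{u,l}=\max_{j,m}\left|(u-u_h)(R^l_{j,m},t)\right|,$$ $$e_{q,r}=\max_{j,m}\left|(q-q_h)(R^r_{j,m},t)\right|,\quad e_{q,l}=\max_{j,m}\left|(q-q_h)(R^l_{j,m},t)\right|,$$ the maxima being over $1\le j\le N$, $1\le m\le k$. Then for both the periodic and mixed boundary conditions, $$e_{u,r}\lesssim(1+t\sqrt h)h^{k+2}\|u\|_{k+4,\infty},\qquad e_{q,l}\lesssim(1+\sqrt{th})h^{k+2}\|u\|_{k+4,\infty}$$ for flux choice (I), and $$e_{u,l}\lesssim(1+t\sqrt h)h^{k+2}\|u\|_{k+4,\infty},\qquad e_{q,r}\lesssim(1+\sqrt{th})h^{k+2}\|u\|_{k+4,\infty}$$ for flux choice (II).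
   Context: Equation: $u_t=u_{xx}$, $(x,t)\in[0,2\pi]\times(0,T]$, $u(x,0)=u_0(x)$, with $u_0$ sufficiently smooth; $\Omega=[0,2\pi]$. Boundary conditions: periodic, $u(0,t)=u(2\pi,t)$; or mixed, $u(0,t)=g_0(t),\,u_x(2\pi,t)=g_1(t)$, or $u_x(0,t)=g_0(t),\,u(2\pi,t)=g_1(t)$. Norms: $\|\cdot\|_{m,\infty}$ is the $W^{m,\infty}(\Omega)$ norm in $x$, with $\|u\|_{m,\infty}$ taken uniformly in time (supremum over $[0,T]$). $A\lesssim B$ means $A\le CB$ with $C$ independent of the mesh size $h$ (and of $t\in[0,T]$). Mesh: $0=x_{\frac12}<\cdots<x_{N+\frac12}=2\pi$, $\tau_j=(x_{j-\frac12},x_{j+\frac12})$, $x_j$ the midpoint, $h_j=x_{j+\frac12}-x_{j-\frac12}$, $\bar h_j=h_j/2$, $h=\max_jh_j$, quasi-uniform ($h\le ch_j$ for all $j$). $V_h=\{v: v|_{\tau_j}\in P_k(\tau_j),\ 1\le j\le N\}$, $P_k$ the polynomials in $x$ of degree at most $k$ with coefficients that may depend on $t$; here $k\ge2$ so that the interpolation function with $l=2\le k$ is defined. $(u,v)_j=\int_{\tau_j}uv\,dx$; $v^\mp|_{j+\frac12}$ are the left/right limits at $x_{j+\frac12}$. LDG scheme: find $u_h,q_h\in V_h$ such that for all $v,w\in V_h$ and all $j$, $(u_{ht},v)_j=-(q_h,v_x)_j+\hat q_hv^-|_{j+\frac12}-\hat q_hv^+|_{j-\frac12}$, $\ (q_h,w)_j=-(u_h,w_x)_j+\hat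 u_hw^-|_{j+\frac12}-\hat u_hw^+|_{j-\frac12}$. Flux choice (I): $\hat u_h=u_h^-$, $\hat q_h=q_h^+$. Flux choice (II): $\hat u_h=u_h^+$, $\hat q_h=q_h^-$. Both are used for the periodic condition (with periodic identification of one-sided limits at $x_{\frac12}$ and $x_{N+\frac12}$); (I) is used for $u(0,t)=g_0,u_x(2\pi,t)=g_1$ (with $u_h^-|_{\frac12}=g_0$, $q_h^+|_{N+\frac12}=g_1$); (II) is used for $u_x(0,t)=g_0,u(2\pi,t)=g_1$ (with $q_h^-|_{\frac12}=g_0$, $u_h^+|_{N+\frac12}=g_1$). Legendre polynomials: $L_{j,m}(x)=L_m((x-x_j)/\bar h_j)$ on $\tau_j$, $L_m$ standard Legendre. Radau points: $R^l_{j,m}$, $m=1,\ldots,k$, are the $k$ zeros of $L_{j,k+1}+L_{j,k}$ other than $x_{j-\frac12}$ (interior left Radau points of $\tau_j$); $R^r_{j,m}$, $m=1,\ldots,k$, are the $k$ zeros of $L_{j,k+1}-L_{j,k}$ other than $x_{j+\frac12}$ (interior right Radau points). Gauss-Radau projections onto $V_h$: $(P_h^\mp v,w)_j=(v,w)_j$ for all $w\in P_{k-1}(\tau_j)$, with $P_h^-v(x_{j+\frac12}^-)=v(x_{j+\frac12}^-)$ and $P_h^+v(x_{j-\frac12}^+)=v(x_{j-\frac12}^+)$. $D_s^{-1}v(x)=\frac1{\bar h_j}\int_{x_{j-\frac12}}^xv(x')\,dx'$, $x\in\tau_j$. On each $\tau_j$: $F_{1,1}=P_h^+D_s^{-1}L_{j,k}$,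 $F_{2,1}=P_h^-D_s^{-1}L_{j,k}$, $\bar F_{1,1}=P_h^-D_s^{-1}F_{1,1}$, $\bar F_{2,1}=P_h^+D_s^{-1}F_{2,1}$. Coefficients: $\bar v_{j,k}(t)=-v(x^-_{j+\frac12},t)+\frac1{h_j}\int_{\tau_j}v\sum_{m=0}^k(2m+1)L_{j,m}\,dx$, $\ \tilde v_{j,k}(t)=(-1)^{k+1}v(x^+_{j-\frac12},t)+\frac1{h_j}\int_{\tau_j}v\sum_{m=0}^k(-1)^{k+m}(2m+1)L_{j,m}\,dx$. Interpolation function $u_I^2$ (case $l=2$). Choice (I): $u_I^2=P_h^-u-W_2^2$ with, on $\tau_j$, $W_2^2=\bar h_j^2\,\frac{d}{dt}\bar u_{j,k}\,\bar F_{1,1}+\bar h_j\,\tilde q_{j,k}\,F_{2,1}$. Choice (II): $u_I^2=P_h^+u-W_2^2$ with, on $\tau_j$, $W_2^2=\bar h_j\,\bar q_{j,k}\,F_{1,1}+\bar h_j^2\,\frac{d}{dt}\tilde u_{j,k}\,\bar F_{2,1}$.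
   Formalization: For the periodic boundary condition, the solution is required to satisfy u_x(0,t)=u_x(2π,t) in addition to u(0,t)=u(2π,t); with the value condition alone the solution is not determined and the estimate fails, e.g. for u=x²−2πx+2t. *)

theory Defs
  imports
    "HOL-Analysis.Analysis"
    "HOL-Computational_Algebra.Polynomial"
    "HOL-Probability.Essential_Supremum"
begin

section \<open>Sobolev norms on the interval from 0 to 2 pi\<close>

abbreviation \<Omega> :: "real set" where
  "\<Omega> \<equiv> {0..2 * pi}"

definition test_function :: "(real \<Rightarrow> real) \<Rightarrow> bool" where
  "test_function \<phi> \<longleftrightarrow>
     (\<forall>n x. (deriv ^^ n) \<phi> field_differentiable at x) \<and>
     (\<exists>a b. 0 < a \<and> b < 2 * pi \<and> (\<forall>x. x \<notin> {a..b} \<longrightarrow> \<phi> x = 0))"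

definition locally_integrable :: "(real \<Rightarrow> real) \<Rightarrow> bool" where
  "locally_integrable f \<longleftrightarrow> (\<forall>a b. 0 < a \<longrightarrow> b < 2 * pi \<longrightarrow> f absolutely_integrable_on {a..b})"

definition weak_deriv :: "nat \<Rightarrow> (real \<Rightarrow> real) \<Rightarrow> (real \<Rightarrow> real) \<Rightarrow> bool" where
  "weak_deriv i f g \<longleftrightarrow>
     locally_integrable f \<and> locally_integrable g \<and>
     (\<forall>\<phi>. test_function \<phi> \<longrightarrow>
        integral \<Omega> (\<lambda>x. f x * (deriv ^^ i) \<phi> x) = (- 1) ^ i * integral \<Omega> (\<lambda>x. g x * \<phi> x))"

definition Linf_norm :: "(real \<Rightarrow> real) \<Rightarrow> ereal" where
  "Linf_norm g = esssup (lebesgue_on \<Omega>) (\<lambda>x. ereal \<bar>g x\<bar>)"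

text \<open>
  The weak derivative of a given order is unique up to null sets, so the infimum below
  is the essential supremum of that derivative; it is \<open>\<infinity>\<close> if the derivative does not exist.
  Thus \<open>f\<close> belongs to \<open>W\<^sup>m\<^sup>,\<^sup>\<infinity>\<close> iff \<open>sobolev_norm m f < \<infinity>\<close>.
\<close>

definition sobolev_norm :: "nat \<Rightarrow> (real \<Rightarrow> real) \<Rightarrow> ereal" where
  "sobolev_norm m f = (SUP i\<in>{..m}. INF g\<in>{g. weak_deriv i f g}. Linf_norm g)"

text \<open>Functions of space and time are written \<open>u x t\<close>.\<close>

definition sobolev_norm_T :: "nat \<Rightarrow> real \<Rightarrow> (real \<Rightarrow> real \<Rightarrow> real) \<Rightarrow> ereal" where
  "sobolev_norm_T m T u = (SUP t\<in>{0..T}. sobolev_norm m (\<lambda>x. u x t))"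


section \<open>The initial boundary value problem\<close>

text \<open>
  Classical solutions; \<open>q\<close> is \<open>u\<^sub>x\<close>. Derivatives at the end points of the space and time
  intervals are one-sided.
\<close>

definition heat_solution ::
    "real \<Rightarrow> (real \<Rightarrow> real) \<Rightarrow> (real \<Rightarrow> real \<Rightarrow> real) \<Rightarrow> (real \<Rightarrow> real \<Rightarrow> real) \<Rightarrow> bool" where
  "heat_solution T u0 u q \<longleftrightarrow>
     continuous_on (\<Omega> \<times> {0..T}) (\<lambda>(x, t). u x t) \<and>
     (\<forall>x\<in>\<Omega>. u x 0 = u0 x) \<and>
     (\<forall>t\<in>{0..T}. \<forall>x\<in>\<Omega>. ((\<lambda>y. u y t) has_real_derivative q x t) (at x within \<Omega>)) \<and>
     (\<forall>t\<in>{0<..T}. \<forall>x\<in>\<Omega>. \<exists>d.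
        ((\<lambda>y. q y t) has_real_derivative d) (at x within \<Omega>) \<and>
        ((\<lambda>s. u x s) has_real_derivative d) (at t within {0..T}))"

datatype flux = FluxI | FluxII

text \<open>
  The meaning of the mixed data \<open>g\<^sub>0\<close> (at 0) and \<open>g\<^sub>1\<close> (at 2 pi) is tied to the flux:
  Dirichlet on the left and Neumann on the right for \<open>FluxI\<close>, the other way round for \<open>FluxII\<close>.
\<close>

datatype boundary_data = Periodic | Mixed "real \<Rightarrow> real" "real \<Rightarrow> real"

text \<open>
  A periodic solution of a second-order equation matches in value and in slope:
  the value condition alone does not determine the solution.
\<close>

fun boundary_condition ::
    "flux \<Rightarrow> boundary_data \<Rightarrow> real \<Rightarrow> (real \<Rightarrow> real \<Rightarrow> real) \<Rightarrow> (real \<Rightarrow> real \<Rightarrow> real) \<Rightarrow> bool" where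
  "boundary_condition fl Periodic T u q \<longleftrightarrow>
     (\<forall>t\<in>{0..T}. u 0 t = u (2 * pi) t \<and> q 0 t = q (2 * pi) t)"
| "boundary_condition FluxI (Mixed g0 g1) T u q \<longleftrightarrow>
     (\<forall>t\<in>{0..T}. u 0 t = g0 t \<and> q (2 * pi) t = g1 t)"
| "boundary_condition FluxII (Mixed g0 g1) T u q \<longleftrightarrow>
     (\<forall>t\<in>{0..T}. q 0 t = g0 t \<and> u (2 * pi) t = g1 t)"


section \<open>Meshes and the discrete space\<close>

text \<open>\<open>X j\<close> is the node with index \<open>j + 1/2\<close>; the cells are numbered from 1 to \<open>N\<close>.\<close>

definition cell :: "(nat \<Rightarrow> real) \<Rightarrow> nat \<Rightarrow> real set" where
  "cell X j = {X (j - 1)..X j}"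

definition midpt :: "(nat \<Rightarrow> real) \<Rightarrow> nat \<Rightarrow> real" where
  "midpt X j = (X (j - 1) + X j) / 2"

definition cell_len :: "(nat \<Rightarrow> real) \<Rightarrow> nat \<Rightarrow> real" where
  "cell_len X j = X j - X (j - 1)"

definition hbar :: "(nat \<Rightarrow> real) \<Rightarrow> nat \<Rightarrow> real" where
  "hbar X j = cell_len X j / 2"

definition mesh_size :: "nat \<Rightarrow> (nat \<Rightarrow> real) \<Rightarrow> real" where
  "mesh_size N X = Max (cell_len X ` {1..N})"

definition quasi_uniform_mesh :: "real \<Rightarrow> nat \<Rightarrow> (nat \<Rightarrow> real) \<Rightarrow> bool" where
  "quasi_uniform_mesh c N X \<longleftrightarrow>
     N \<ge> 1 \<and> X 0 = 0 \<and> X N = 2 * pi \<and> (\<forall>j\<in>{1..N}. X (j - 1) < X j) \<and>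
     (\<forall>j\<in>{1..N}. mesh_size N X \<le> c * cell_len X j)"

text \<open>
  A piecewise polynomial is the family of its restrictions to the cells, so that its
  one-sided limits at the nodes are values of these polynomials.
\<close>

definition Vh :: "nat \<Rightarrow> nat \<Rightarrow> (nat \<Rightarrow> real poly) set" where
  "Vh k N = {v. \<forall>j\<in>{1..N}. degree (v j) \<le> k}"

text \<open>
  Left and right limits at the node \<open>X i\<close>, for \<open>0 \<le> i \<le> N\<close>; the argument \<open>b\<close> supplies the
  limit from outside the domain (left of \<open>X 0\<close>, respectively right of \<open>X N\<close>).
\<close>

definition trace_minus :: "(nat \<Rightarrow> real) \<Rightarrow> real \<Rightarrow> (nat \<Rightarrow> real poly) \<Rightarrow> nat \<Rightarrow> real" where
  "trace_minus X b v i = (if i = 0 then b else poly (v i) (X i))"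

definition trace_plus :: "nat \<Rightarrow> (nat \<Rightarrow> real) \<Rightarrow> real \<Rightarrow> (nat \<Rightarrow> real poly) \<Rightarrow> nat \<Rightarrow> real" where
  "trace_plus N X b v i = (if i = N then b else poly (v (i + 1)) (X i))"


section \<open>The LDG scheme\<close>

fun outer_left :: "boundary_data \<Rightarrow> nat \<Rightarrow> (nat \<Rightarrow> real) \<Rightarrow> real \<Rightarrow> (nat \<Rightarrow> real poly) \<Rightarrow> real" where
  "outer_left Periodic N X t v = poly (v N) (X N)"
| "outer_left (Mixed g0 g1) N X t v = g0 t"

fun outer_right :: "boundary_data \<Rightarrow> nat \<Rightarrow> (nat \<Rightarrow> real) \<Rightarrow> real \<Rightarrow> (nat \<Rightarrow> real poly) \<Rightarrow> real" where
  "outer_right Periodic N X t v = poly (v 1) (X 0)"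
| "outer_right (Mixed g0 g1) N X t v = g1 t"

fun flux_u :: "flux \<Rightarrow> boundary_data \<Rightarrow> nat \<Rightarrow> (nat \<Rightarrow> real) \<Rightarrow> real \<Rightarrow> (nat \<Rightarrow> real poly) \<Rightarrow> nat \<Rightarrow> real" where
  "flux_u FluxI bd N X t v = trace_minus X (outer_left bd N X t v) v"
| "flux_u FluxII bd N X t v = trace_plus N X (outer_right bd N X t v) v"

fun flux_q :: "flux \<Rightarrow> boundary_data \<Rightarrow> nat \<Rightarrow> (nat \<Rightarrow> real) \<Rightarrow> real \<Rightarrow> (nat \<Rightarrow> real poly) \<Rightarrow> nat \<Rightarrow> real" where
  "flux_q FluxI bd N X t v = trace_plus N X (outer_right bd N X t v) v"
| "flux_q FluxII bd N X t v = trace_minus X (outer_left bd N X t v) v"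

definition ip :: "(nat \<Rightarrow> real) \<Rightarrow> nat \<Rightarrow> (real \<Rightarrow> real) \<Rightarrow> (real \<Rightarrow> real) \<Rightarrow> real" where
  "ip X j f g = integral (cell X j) (\<lambda>x. f x * g x)"

text \<open>\<open>uht\<close> is the time derivative of \<open>uh\<close>; \<open>uh t j\<close> is the restriction of \<open>uh\<close> to cell \<open>j\<close> at time \<open>t\<close>.\<close>

definition LDG_solution ::
    "flux \<Rightarrow> boundary_data \<Rightarrow> nat \<Rightarrow> nat \<Rightarrow> (nat \<Rightarrow> real) \<Rightarrow> real \<Rightarrow>
     (real \<Rightarrow> nat \<Rightarrow> real poly) \<Rightarrow> (real \<Rightarrow> nat \<Rightarrow> real poly) \<Rightarrow> bool" where
  "LDG_solution fl bd k N X T uh qh \<longleftrightarrow>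
     (\<exists>uht. \<forall>t\<in>{0..T}.
        uh t \<in> Vh k N \<and> qh t \<in> Vh k N \<and> uht t \<in> Vh k N \<and>
        (\<forall>j\<in>{1..N}. \<forall>x.
           ((\<lambda>s. poly (uh s j) x) has_real_derivative poly (uht t j) x) (at t within {0..T})) \<and>
        (\<forall>v\<in>Vh k N. \<forall>w\<in>Vh k N. \<forall>j\<in>{1..N}.
           ip X j (poly (uht t j)) (poly (v j)) =
             - ip X j (poly (qh t j)) (poly (pderiv (v j)))
             + flux_q fl bd N X t (qh t) j * poly (v j) (X j)
             - flux_q fl bd N X t (qh t) (j - 1) * poly (v j) (X (j - 1)) \<and>
           ip X j (poly (qh t j)) (poly (w j)) =
             - ip X j (poly (uh t j)) (poly (pderiv (w j)))
             + flux_u fl bd N X t (uh t) j * poly (w j) (X j)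
             - flux_u fl bd N X t (uh t) (j - 1) * poly (w j) (X (j - 1))))"


section \<open>Legendre polynomials and Radau points\<close>

text \<open>Rodrigues' formula.\<close>

definition legendre :: "nat \<Rightarrow> real poly" where
  "legendre m = smult (1 / (2 ^ m * fact m)) ((pderiv ^^ m) ([:-1, 0, 1:] ^ m))"

definition cell_legendre :: "(nat \<Rightarrow> real) \<Rightarrow> nat \<Rightarrow> nat \<Rightarrow> real \<Rightarrow> real" where
  "cell_legendre X j m x = poly (legendre m) ((x - midpt X j) / hbar X j)"

definition left_radau :: "nat \<Rightarrow> (nat \<Rightarrow> real) \<Rightarrow> nat \<Rightarrow> real set" where
  "left_radau k X j =
     {x \<in> cell X j. cell_legendre X j (k + 1) x + cell_legendre X j k x = 0} - {X (j - 1)}"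

definition right_radau :: "nat \<Rightarrow> (nat \<Rightarrow> real) \<Rightarrow> nat \<Rightarrow> real set" where
  "right_radau k X j =
     {x \<in> cell X j. cell_legendre X j (k + 1) x - cell_legendre X j k x = 0} - {X j}"

text \<open>Maximal error at time \<open>t\<close> over a family \<open>R\<close> of point sets, one for each cell.\<close>

definition max_error ::
    "nat \<Rightarrow> (nat \<Rightarrow> real set) \<Rightarrow> (real \<Rightarrow> real \<Rightarrow> real) \<Rightarrow> (real \<Rightarrow> nat \<Rightarrow> real poly) \<Rightarrow> real \<Rightarrow> real" where
  "max_error N R u uh t = Max ((\<lambda>(j, x). \<bar>u x t - poly (uh t j) x\<bar>) ` (SIGMA j:{1..N}. R j))"


section \<open>The interpolation function\<close>

text \<open>Restrictions to cell \<open>j\<close> of the Gauss-Radau projections of a function continuous on that cell.\<close>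

definition P_minus :: "nat \<Rightarrow> (nat \<Rightarrow> real) \<Rightarrow> nat \<Rightarrow> (real \<Rightarrow> real) \<Rightarrow> real poly" where
  "P_minus k X j v =
     (THE p. degree p \<le> k \<and>
        (\<forall>w. degree w \<le> k - 1 \<longrightarrow> ip X j (poly p) (poly w) = ip X j v (poly w)) \<and>
        poly p (X j) = v (X j))"

definition P_plus :: "nat \<Rightarrow> (nat \<Rightarrow> real) \<Rightarrow> nat \<Rightarrow> (real \<Rightarrow> real) \<Rightarrow> real poly" where
  "P_plus k X j v =
     (THE p. degree p \<le> k \<and>
        (\<forall>w. degree w \<le> k - 1 \<longrightarrow> ip X j (poly p) (poly w) = ip X j v (poly w)) \<and>
        poly p (X (j - 1)) = v (X (j - 1)))"

definition Ds_inv :: "(nat \<Rightarrow> real) \<Rightarrow> nat \<Rightarrow> (real \<Rightarrow> real) \<Rightarrow> real \<Rightarrow> real" where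
  "Ds_inv X j v x = 1 / hbar X j * integral {X (j - 1)..x} v"

definition F1 :: "nat \<Rightarrow> (nat \<Rightarrow> real) \<Rightarrow> nat \<Rightarrow> real poly" where
  "F1 k X j = P_plus k X j (Ds_inv X j (cell_legendre X j k))"

definition F2 :: "nat \<Rightarrow> (nat \<Rightarrow> real) \<Rightarrow> nat \<Rightarrow> real poly" where
  "F2 k X j = P_minus k X j (Ds_inv X j (cell_legendre X j k))"

definition F1_bar :: "nat \<Rightarrow> (nat \<Rightarrow> real) \<Rightarrow> nat \<Rightarrow> real poly" where
  "F1_bar k X j = P_minus k X j (Ds_inv X j (poly (F1 k X j)))"

definition F2_bar :: "nat \<Rightarrow> (nat \<Rightarrow> real) \<Rightarrow> nat \<Rightarrow> real poly" where
  "F2_bar k X j = P_plus k X j (Ds_inv X j (poly (F2 k X j)))"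

definition coef_bar :: "nat \<Rightarrow> (nat \<Rightarrow> real) \<Rightarrow> nat \<Rightarrow> (real \<Rightarrow> real \<Rightarrow> real) \<Rightarrow> real \<Rightarrow> real" where
  "coef_bar k X j v t =
     - v (X j) t
     + 1 / cell_len X j *
       integral (cell X j) (\<lambda>x. v x t * (\<Sum>m\<le>k. real (2 * m + 1) * cell_legendre X j m x))"

definition coef_tilde :: "nat \<Rightarrow> (nat \<Rightarrow> real) \<Rightarrow> nat \<Rightarrow> (real \<Rightarrow> real \<Rightarrow> real) \<Rightarrow> real \<Rightarrow> real" where
  "coef_tilde k X j v t =
     (- 1) ^ (k + 1) * v (X (j - 1)) t
     + 1 / cell_len X j *
       integral (cell X j)
         (\<lambda>x. v x t * (\<Sum>m\<le>k. (- 1) ^ (k + m) * real (2 * m + 1) * cell_legendre X j m x))"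

text \<open>Time derivatives are relative to \<open>[0, T]\<close>, hence one-sided at the initial time.\<close>

fun u_interp ::
    "flux \<Rightarrow> nat \<Rightarrow> (nat \<Rightarrow> real) \<Rightarrow> real \<Rightarrow> (real \<Rightarrow> real \<Rightarrow> real) \<Rightarrow> (real \<Rightarrow> real \<Rightarrow> real) \<Rightarrow>
     real \<Rightarrow> nat \<Rightarrow> real poly" where
  "u_interp FluxI k X T u q t j =
     P_minus k X j (\<lambda>x. u x t) -
     (smult ((hbar X j)\<^sup>2 * vector_derivative (coef_bar k X j u) (at t within {0..T})) (F1_bar k X j)
      + smult (hbar X j * coef_tilde k X j q t) (F2 k X j))"
| "u_interp FluxII k X T u q t j =
     P_plus k X j (\<lambda>x. u x t) -
     (smult (hbar X j * coef_bar k X j q t) (F1 k X j)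
      + smult ((hbar X j)\<^sup>2 * vector_derivative (coef_tilde k X j u) (at t within {0..T})) (F2_bar k X j))"

end

(*
  In an orthonormal basis of V_h the discrete gradient is a matrix G, and since the flux for q is
  dual to the flux for u the discrete Laplacian is -G^T G. The correction functions invert the
  discrete gradient cell by cell and thereby turn the projection residuals into exact discrete
  derivatives. For xi = u_I - u_h this leaves (xi + W)' = -G^T G xi, where W is the correction.

  With only k + 4 spatial derivatives, W' is of order h^(k+2), and an energy estimate would miss a
  factor sqrt h. Instead xi(t) is paired with the dual flow z' = -G^T G z, run backwards from t,
  where in time s each factor G costs s^(-1/2). The increments of W are, up to a part that remains
  of order h^(k+3) for all times, of the form G^T kappa with kappa smaller by a factor h; trading
  this gain against the smoothing recovers the factor sqrt h, for xi as well as for G xi. It is lost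
  again in the inverse inequality on a single cell, which leads to pointwise bounds. The projection
  errors of u and q are of order h^(k+2) at the Radau points.
*)
theory Submission
  imports Defs
begin

section \<open>Test functions\<close>

text \<open>The hypotheses bound weak space derivatives at each fixed time and say nothing about
  mixed derivatives. Hence order k + 4 survives only as a Lipschitz bound of the derivative of order
  k + 3, and Lipschitz bounds in time have to be extracted from u_t = u_xx through space differences
  of u. This budget shapes the rest: the increments in time of the correction built from q keep the
  full power of h, whereas those of the correction built from u_t would need order k + 5 for that.
  They lose one power of h and are complemented by a bound that is uniform in time. The correction W
  is never differentiated in time. The unknown of the dual argument is xi + W, whose derivative is
  available, and only increments of W enter, compared with the value at the final time, where the
  dual flow is singular. Norms of G grow as the mesh is refined, so G and its transpose are
  estimated only along the flow or on the corrections themselves. All constants are explicit in k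
  and the quasi-uniformity constant c.\<close>

definition smooth :: "(real \<Rightarrow> real) \<Rightarrow> bool" where
  "smooth \<phi> \<longleftrightarrow> (\<forall>n x. (deriv ^^ n) \<phi> field_differentiable at x)"

lemma smooth_deriv: "smooth \<phi> \<Longrightarrow> smooth (deriv \<phi>)"
  unfolding smooth_def by (metis funpow_Suc_right o_apply)

lemma smooth_DERIV: "smooth \<phi> \<Longrightarrow> DERIV \<phi> x :> deriv \<phi> x"
  unfolding smooth_def by (metis DERIV_deriv_iff_field_differentiable funpow_0)

lemma smooth_continuous: "smooth \<phi> \<Longrightarrow> continuous_on A \<phi>"
  by (meson DERIV_continuous_on DERIV_subset smooth_DERIV subset_UNIV)

lemma smooth_if_DERIV:
  assumes "\<And>x. DERIV \<phi> x :> \<psi> x" "smooth \<psi>"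
  shows "smooth \<phi>"
proof -
  have "deriv \<phi> = \<psi>" using assms(1) by (auto simp: DERIV_imp_deriv)
  then have "(deriv ^^ n) \<phi> field_differentiable at x" for n x
  proof (cases n)
    case 0
    then show ?thesis using assms(1) field_differentiable_def by auto
  next
    case (Suc m)
    then show ?thesis
      using assms(2) \<open>deriv \<phi> = \<psi>\<close> unfolding smooth_def by (simp add: funpow_Suc_right del: funpow.simps)
  qed
  then show ?thesis by (simp add: smooth_def)
qed

text \<open>Membership in a class closed under differentiation is an invariant of all iterated
  derivatives, so no formula for the n-th derivative of a concrete function is required.\<close>

lemma smooth_coinduct:
  assumes "\<phi> \<in> K" "\<And>\<phi>. \<phi> \<in> K \<Longrightarrow> \<exists>\<psi>\<in>K. \<forall>x. DERIV \<phi> x :> \<psi> x"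
  shows "smooth \<phi>"
proof -
  have "(deriv ^^ n) \<phi> \<in> K" for n
  proof (induction n)
    case (Suc n)
    then obtain \<psi> where "\<psi> \<in> K" "\<forall>x. DERIV ((deriv ^^ n) \<phi>) x :> \<psi> x" using assms(2) by blast
    moreover from this have "deriv ((deriv ^^ n) \<phi>) = \<psi>" by (auto simp: DERIV_imp_deriv)
    ultimately show ?case by simp
  qed (use assms in simp)
  then show ?thesis
    unfolding smooth_def using assms(2) field_differentiable_def by blast
qed

text \<open>The classical exp (- 1 / x), extended by zero, with a polynomial in 1 / x as prefactor.
  The prefactor makes the family closed under differentiation: the derivative replaces
  \<open>p\<close> by \<open>flat_deriv p\<close>.\<close>

definition flat :: "real poly \<Rightarrow> real \<Rightarrow> real" where
  "flat p x = (if x \<le> 0 then 0 else poly p (1 / x) * exp (- (1 / x)))"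

definition flat_deriv :: "real poly \<Rightarrow> real poly" where
  "flat_deriv p = [:0, 0, 1:] * (p - pderiv p)"

lemma tendsto_poly_exp: "((\<lambda>y. poly p y * exp (- y)) \<longlongrightarrow> (0::real)) at_top"
proof -
  have "((\<lambda>y. \<Sum>i\<le>degree p. coeff p i * (y ^ i / exp y)) \<longlongrightarrow> (\<Sum>i\<le>degree p. coeff p i * 0)) at_top"
    by (intro tendsto_sum tendsto_mult tendsto_const tendsto_power_div_exp_0)
  then show ?thesis
    by (simp add: poly_altdef sum_distrib_left exp_minus divide_inverse mult_ac)
qed

text \<open>Only the origin is delicate. From the right the difference quotient is y p(y) exp (- y)
  with y tending to infinity, and the exponential beats every polynomial.\<close>

lemma flat_DERIV: "DERIV (flat p) x :> flat (flat_deriv p) x"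
proof -
  consider "x < 0" | "x = 0" | "x > 0" by linarith
  then show ?thesis
  proof cases
    case 1
    have "DERIV (\<lambda>_. 0) x :> (0::real)" by simp
    then have "DERIV (flat p) x :> 0"
      by (rule has_field_derivative_transform_within_open[of _ _ _ "{..<0}"])
         (use 1 in \<open>auto simp: flat_def\<close>)
    then show ?thesis using 1 by (simp add: flat_def)
  next
    case 2
    have "((\<lambda>h. flat p h / h) \<longlongrightarrow> 0) (at_left 0)"
      by (rule tendsto_eventually) (auto simp: eventually_at_filter flat_def)
    moreover have "((\<lambda>h. flat p h / h) \<longlongrightarrow> 0) (at_right 0)"
    proof -
      have "filterlim (\<lambda>h::real. inverse h) at_top (at_right 0)"
        by (rule filterlim_inverse_at_top_right)
      from filterlim_compose[OF tendsto_poly_exp[of "[:0, 1:] * p"] this]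
      have "((\<lambda>h. poly ([:0, 1:] * p) (inverse h) * exp (- inverse h)) \<longlongrightarrow> 0) (at_right 0)" .
      then show ?thesis
        by (rule Lim_transform_eventually)
           (auto simp: eventually_at_filter flat_def field_simps)
    qed
    ultimately have "((\<lambda>h. flat p h / h) \<longlongrightarrow> 0) (at 0)"
      by (rule filterlim_split_at)
    then show ?thesis
      using 2 by (simp add: DERIV_def flat_def)
  next
    case 3
    have "DERIV (\<lambda>x. poly p (1 / x) * exp (- (1 / x))) x :> flat (flat_deriv p) x"
    proof -
      have d: "((\<lambda>x. 1 / x) has_real_derivative - (1 / x\<^sup>2)) (at x)"
        using 3 by (auto intro!: derivative_eq_intros simp: power2_eq_square)
      have "DERIV (\<lambda>x. poly p (1 / x) * exp (- (1 / x))) x :>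
          (poly (pderiv p) (1 / x) * - (1 / x\<^sup>2)) * exp (- (1 / x)) + (exp (- (1 / x)) * - (- (1 / x\<^sup>2))) * poly p (1 / x)"
        by (intro DERIV_mult DERIV_chain2[OF poly_DERIV d] DERIV_chain2[OF DERIV_exp DERIV_minus[OF d]])
      also have "(poly (pderiv p) (1 / x) * - (1 / x\<^sup>2)) * exp (- (1 / x)) + (exp (- (1 / x)) * - (- (1 / x\<^sup>2))) * poly p (1 / x)
          = flat (flat_deriv p) x"
        using 3 by (simp add: flat_def flat_deriv_def algebra_simps power2_eq_square)
      finally show ?thesis .
    qed
    then show ?thesis
      by (rule has_field_derivative_transform_within_open[of _ _ _ "{0<..}"])
         (use 3 in \<open>auto simp: flat_def\<close>)
  qed
qed

text \<open>A product of two flat functions facing each other is the standard bump. The product rule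
  turns a product into a sum of two, so closure under sums is what makes the set stable under
  differentiation.\<close>

inductive_set flat_bumps :: "real \<Rightarrow> real \<Rightarrow> (real \<Rightarrow> real) set" for a b where
  base: "(\<lambda>x. flat p (x - a) * flat r (b - x)) \<in> flat_bumps a b"
| add: "\<phi> \<in> flat_bumps a b \<Longrightarrow> \<psi> \<in> flat_bumps a b \<Longrightarrow> (\<lambda>x. \<phi> x + \<psi> x) \<in> flat_bumps a b"

lemma flat_bumps_DERIV: "\<phi> \<in> flat_bumps a b \<Longrightarrow> \<exists>\<psi>\<in>flat_bumps a b. \<forall>x. DERIV \<phi> x :> \<psi> x"
proof (induction rule: flat_bumps.induct)
  case (base p r)
  have neg: "flat (smult (- 1) q) y = - flat q y" for q y by (simp add: flat_def)
  show ?case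
  proof (intro bexI allI)
    show "(\<lambda>x. flat (flat_deriv p) (x - a) * flat r (b - x)
        + flat p (x - a) * flat (smult (- 1) (flat_deriv r)) (b - x)) \<in> flat_bumps a b"
      by (intro flat_bumps.intros)
    fix x
    have "DERIV (\<lambda>x. flat p (x - a)) x :> flat (flat_deriv p) (x - a)"
    proof -
      have "((\<lambda>x. x - a) has_real_derivative 1) (at x)" by (auto intro!: derivative_eq_intros)
      from DERIV_chain2[OF flat_DERIV this] show ?thesis by simp
    qed
    moreover have "DERIV (\<lambda>x. flat r (b - x)) x :> - flat (flat_deriv r) (b - x)"
    proof -
      have "((\<lambda>x. b - x) has_real_derivative - 1) (at x)" by (auto intro!: derivative_eq_intros)
      from DERIV_chain2[OF flat_DERIV this] show ?thesis by simp
    qed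
    ultimately show "DERIV (\<lambda>x. flat p (x - a) * flat r (b - x)) x :> flat (flat_deriv p) (x - a) * flat r (b - x)
        + flat p (x - a) * flat (smult (- 1) (flat_deriv r)) (b - x)"
      unfolding neg by (rule DERIV_cong[OF DERIV_mult]) simp
  qed
next
  case (add \<phi> \<psi>)
  then obtain \<phi>' \<psi>' where "\<phi>' \<in> flat_bumps a b" "\<forall>x. DERIV \<phi> x :> \<phi>' x"
    "\<psi>' \<in> flat_bumps a b" "\<forall>x. DERIV \<psi> x :> \<psi>' x" by blast
  then show ?case by (intro bexI[of _ "\<lambda>x. \<phi>' x + \<psi>' x"]) (auto intro: flat_bumps.intros DERIV_add)
qed

lemma test_function_iff:
  "test_function \<phi> \<longleftrightarrow> smooth \<phi> \<and> (\<exists>a b. 0 < a \<and> b < 2 * pi \<and> (\<forall>x. x \<notin> {a..b} \<longrightarrow> \<phi> x = 0))"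
  by (simp add: test_function_def smooth_def)

lemma bump_exists:
  assumes "0 < a" "a < b" "b < 2 * pi"
  obtains \<beta> where "test_function \<beta>" "\<And>x. \<beta> x \<ge> 0" "\<And>x. x \<in> {a<..<b} \<Longrightarrow> \<beta> x > 0" "\<And>x. x \<notin> {a<..<b} \<Longrightarrow> \<beta> x = 0"
proof
  define \<beta> where "\<beta> = (\<lambda>x. flat 1 (x - a) * flat 1 (b - x))"
  have "smooth \<beta>"
    by (rule smooth_coinduct[of \<beta> "flat_bumps a b"]) (auto simp: \<beta>_def intro: flat_bumps.intros flat_bumps_DERIV)
  moreover show "\<beta> x = 0" if "x \<notin> {a<..<b}" for x using that by (auto simp: \<beta>_def flat_def)
  moreover have "\<beta> x = 0" if "x \<notin> {a..b}" for x using that by (auto simp: \<beta>_def flat_def)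
  ultimately show "test_function \<beta>"
    unfolding test_function_iff using assms by blast
  show "\<beta> x \<ge> 0" for x by (simp add: \<beta>_def flat_def)
  show "\<beta> x > 0" if "x \<in> {a<..<b}" for x using that by (simp add: \<beta>_def flat_def)
qed

text \<open>The same support interval serves: its complement is open, so the derivative vanishes
  there as well.\<close>

lemma test_function_deriv:
  assumes "test_function \<phi>"
  shows "test_function (deriv \<phi>)"
proof -
  obtain a b where ab: "0 < a" "b < 2 * pi" "\<And>x. x \<notin> {a..b} \<Longrightarrow> \<phi> x = 0" and s: "smooth \<phi>"
    using assms by (auto simp: test_function_iff)
  have "deriv \<phi> x = 0" if x: "x \<notin> {a..b}" for x
  proof -
    have "open (- {a..b})" by (simp add: open_Compl)
    then have "DERIV \<phi> x :> 0"
      using x ab(3) by (intro has_field_derivative_transform_within_open[OF DERIV_const, of "- {a..b}"]) auto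
    then show ?thesis by (rule DERIV_imp_deriv)
  qed
  then show ?thesis
    using ab(1,2) smooth_deriv[OF s] by (auto simp: test_function_iff)
qed

lemma test_function_support:
  "test_function \<phi> \<Longrightarrow> x \<notin> {0<..<2 * pi} \<Longrightarrow> \<phi> x = 0"
  unfolding test_function_iff by force

lemma test_function_linear:
  assumes "test_function \<phi>" "test_function \<psi>"
  shows "test_function (\<lambda>x. \<phi> x - c * \<psi> x)"
proof -
  obtain a b a' b' where *: "0 < a" "b < 2 * pi" "\<And>x. x \<notin> {a..b} \<Longrightarrow> \<phi> x = 0" "smooth \<phi>"
    "0 < a'" "b' < 2 * pi" "\<And>x. x \<notin> {a'..b'} \<Longrightarrow> \<psi> x = 0" "smooth \<psi>"
    using assms unfolding test_function_iff by metis
  have "smooth (\<lambda>x. \<phi> x - c * \<psi> x)"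
  proof (rule smooth_coinduct[of _ "{\<lambda>x. \<phi> x - c * \<psi> x | \<phi> \<psi>. smooth \<phi> \<and> smooth \<psi>}"])
    fix \<theta> assume "\<theta> \<in> {\<lambda>x. \<phi> x - c * \<psi> x | \<phi> \<psi>. smooth \<phi> \<and> smooth \<psi>}"
    then obtain \<phi> \<psi> where \<theta>: "\<theta> = (\<lambda>x. \<phi> x - c * \<psi> x)" "smooth \<phi>" "smooth \<psi>" by blast
    then have "\<forall>x. DERIV \<theta> x :> deriv \<phi> x - c * deriv \<psi> x"
      by (auto intro!: derivative_eq_intros smooth_DERIV)
    moreover have "(\<lambda>x. deriv \<phi> x - c * deriv \<psi> x) \<in> {\<lambda>x. \<phi> x - c * \<psi> x | \<phi> \<psi>. smooth \<phi> \<and> smooth \<psi>}"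
      using \<theta> smooth_deriv by blast
    ultimately show "\<exists>\<psi>\<in>{\<lambda>x. \<phi> x - c * \<psi> x | \<phi> \<psi>. smooth \<phi> \<and> smooth \<psi>}. \<forall>x. DERIV \<theta> x :> \<psi> x"
      by (intro bexI[of _ "\<lambda>x. deriv \<phi> x - c * deriv \<psi> x"])
  qed (use * in blast)
  moreover have "0 < min a a'" "max b b' < 2 * pi" using * by auto
  moreover have "\<phi> x - c * \<psi> x = 0" if "x \<notin> {min a a'..max b b'}" for x
    using that *(3)[of x] *(7)[of x] by (cases "x < min a a'") (auto simp: not_le)
  ultimately show ?thesis unfolding test_function_iff by blast
qed

lemma test_function_higher_deriv_linear:
  assumes "test_function \<phi>" "test_function \<psi>"
  shows "(deriv ^^ n) (\<lambda>x. \<phi> x - c * \<psi> x) = (\<lambda>x. (deriv ^^ n) \<phi> x - c * (deriv ^^ n) \<psi> x)"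
  using assms
proof (induction n arbitrary: \<phi> \<psi>)
  case (Suc n)
  have "deriv (\<lambda>x. \<phi> x - c * \<psi> x) = (\<lambda>x. deriv \<phi> x - c * deriv \<psi> x)"
    using Suc.prems
    by (auto intro!: ext DERIV_imp_deriv derivative_eq_intros smooth_DERIV simp: test_function_iff)
  then show ?case
    using Suc.IH[OF test_function_deriv test_function_deriv, OF Suc.prems]
    by (simp only: funpow_Suc_right o_apply)
qed simp

text \<open>The primitive taken from the left vanishes before the support; beyond the support it
  equals the total integral. Mean zero is therefore exactly what keeps its support compact.\<close>

lemma test_function_antiderivative:
  assumes "test_function \<psi>" "integral \<Omega> \<psi> = 0"
  obtains \<phi> where "test_function \<phi>" "deriv \<phi> = \<psi>"
proof -
  obtain a b where ab: "0 < a" "b < 2 * pi" "\<And>x. x \<notin> {a..b} \<Longrightarrow> \<psi> x = 0" and s: "smooth \<psi>"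
    using assms by (auto simp: test_function_iff)
  have int: "\<psi> integrable_on {c..d}" for c d
    by (intro integrable_continuous_interval smooth_continuous s)
  define \<phi> where "\<phi> x = (if x < 0 then 0 else integral {0..x} \<psi>)" for x
  have zero: "\<phi> x = 0" if "x \<notin> {a..b}" for x
  proof (cases "x < a")
    case True
    have "integral {0..x} \<psi> = integral {0..x} (\<lambda>_. 0)"
      using True ab by (intro integral_cong) auto
    then show ?thesis by (simp add: \<phi>_def)
  next
    case False
    then have x: "x > b" "x > 0" using that ab by auto
    have "integral {0..x} \<psi> = 0"
    proof (cases "x \<le> 2 * pi")
      case True
      have "integral {0..x} \<psi> + integral {x..2 * pi} \<psi> = integral \<Omega> \<psi>"
        using True x by (intro Henstock_Kurzweil_Integration.integral_combine int) auto
      moreover have "integral {x..2 * pi} \<psi> = integral {x..2 * pi} (\<lambda>_. 0)"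
        using x ab by (intro integral_cong) auto
      ultimately show ?thesis using assms(2) by simp
    next
      case False
      have "integral \<Omega> \<psi> + integral {2 * pi..x} \<psi> = integral {0..x} \<psi>"
        using False x by (intro Henstock_Kurzweil_Integration.integral_combine int) auto
      moreover have "integral {2 * pi..x} \<psi> = integral {2 * pi..x} (\<lambda>_. 0)"
        using x ab by (intro integral_cong) auto
      ultimately show ?thesis using assms(2) by simp
    qed
    then show ?thesis by (simp add: \<phi>_def)
  qed
  have D: "DERIV \<phi> x :> \<psi> x" for x
  proof (cases "x < a")
    case True
    have "DERIV \<phi> x :> 0"
      using True zero by (intro has_field_derivative_transform_within_open[OF DERIV_const, of "{..<a}"]) auto
    then show ?thesis using True ab by simp
  next
    case False
    then have x: "x \<in> {0<..<x + 1}" using ab by simp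
    have "((\<lambda>x. integral {0..x} \<psi>) has_real_derivative \<psi> x) (at x within {0..x + 1})"
      using x by (intro integral_has_real_derivative smooth_continuous s) auto
    then have "((\<lambda>x. integral {0..x} \<psi>) has_real_derivative \<psi> x) (at x)"
      using at_within_interior[of x "{0..x + 1}"] x by simp
    then show ?thesis
      by (rule has_field_derivative_transform_within_open[of _ _ _ "{0<..<x + 1}"]) (use x in \<open>auto simp: \<phi>_def\<close>)
  qed
  have "smooth \<phi>" by (rule smooth_if_DERIV[OF D s])
  then have "test_function \<phi>" unfolding test_function_iff using ab zero by blast
  moreover have "deriv \<phi> = \<psi>" using D by (auto simp: DERIV_imp_deriv)
  ultimately show ?thesis by (rule that)
qed


section \<open>From weak to classical derivatives\<close>

lemma antiderivative_by_parts:
  fixes g G \<phi> \<psi> :: "real \<Rightarrow> real"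
  assumes g: "g integrable_on {a..b}" "\<And>x. x \<in> {a..b} \<Longrightarrow> \<bar>g x\<bar> \<le> M"
    and G: "\<And>x. x \<in> {a..b} \<Longrightarrow> G x = c + integral {a..x} g"
    and \<phi>: "\<And>x. DERIV \<phi> x :> \<psi> x" "continuous_on {a..b} \<psi>"
    and ends: "\<phi> a = 0" "\<phi> b = 0" and ab: "a \<le> b" and M: "M \<ge> 0"
  shows "integral {a..b} (\<lambda>x. G x * \<psi> x) = - integral {a..b} (\<lambda>x. g x * \<phi> x)"
    and "(\<lambda>x. g x * \<phi> x) integrable_on {a..b}"
    and "\<And>x y. x \<in> {a..b} \<Longrightarrow> y \<in> {a..b} \<Longrightarrow> \<bar>G y - G x\<bar> \<le> M * \<bar>y - x\<bar>"
proof -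
  obtain K where "\<forall>x\<in>{a..b}. \<bar>\<psi> x\<bar> \<le> K"
    using compact_imp_bounded[OF compact_continuous_image[OF \<phi>(2) compact_Icc]]
    by (auto simp: bounded_iff)
  then have K: "\<And>x. x \<in> {a..b} \<Longrightarrow> \<bar>\<psi> x\<bar> \<le> K" by blast
  have K0: "K \<ge> 0" using K[of a] ab by auto
  have gint: "g integrable_on {x..y}" if "{x..y} \<subseteq> {a..b}" for x y
    using integrable_subinterval_real[OF g(1) that] .
  have ple: "\<bar>\<phi> y - \<phi> x\<bar> \<le> K * \<bar>y - x\<bar>" if "x \<in> {a..b}" "y \<in> {a..b}" for x y
    using field_differentiable_bound[of "{a..b}" \<phi> \<psi> K y x] that K \<phi>(1)
    by (auto intro: DERIV_subset)
  have Gdiff: "G y - G x = integral {x..y} g" if "a \<le> x" "x \<le> y" "y \<le> b" for x y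
    using G[of x] G[of y] that Henstock_Kurzweil_Integration.integral_combine[of a x y g] gint[of a y] by auto
  have Gle': "\<bar>G y - G x\<bar> \<le> M * (y - x)" if "a \<le> x" "x \<le> y" "y \<le> b" for x y
  proof -
    have "norm (integral {x..y} g) \<le> integral {x..y} (\<lambda>_. M)"
      using that g(2) gint[of x y] by (intro integral_norm_bound_integral) auto
    then show ?thesis using that by (simp add: Gdiff mult.commute)
  qed
  show Gle: "\<bar>G y - G x\<bar> \<le> M * \<bar>y - x\<bar>" if "x \<in> {a..b}" "y \<in> {a..b}" for x y
    using Gle'[of x y] Gle'[of y x] that by (cases "x \<le> y") (auto simp: abs_minus_commute)
  have Gcont: "continuous_on {a..b} G"
  proof (rule continuous_on_iff[THEN iffD2], intro ballI allI impI)
    fix x e :: real assume *: "x \<in> {a..b}" "e > 0"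
    show "\<exists>d>0. \<forall>x'\<in>{a..b}. dist x' x < d \<longrightarrow> dist (G x') (G x) < e"
    proof (intro exI[of _ "e / (M + 1)"] conjI ballI impI)
      fix y assume y: "y \<in> {a..b}" "dist y x < e / (M + 1)"
      have "dist (G y) (G x) \<le> M * \<bar>y - x\<bar>" using Gle[OF *(1) y(1)] by (simp add: dist_real_def)
      also have "\<dots> \<le> (M + 1) * \<bar>y - x\<bar>" by (intro mult_right_mono) auto
      also have "\<dots> < e" using y(2) M by (simp add: dist_real_def field_simps)
      finally show "dist (G y) (G x) < e" .
    qed (use * M in auto)
  qed
  have pcont: "continuous_on A \<phi>" for A
    by (meson DERIV_continuous_on DERIV_subset \<phi>(1) subset_UNIV)
  have bou: "(\<lambda>x. g x * \<phi> x) absolutely_integrable_on {a..b}"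
  proof (rule absolutely_integrable_bounded_measurable_product_real)
    show "bounded (g ` {a..b})" unfolding bounded_iff using g(2) by (intro exI[of _ M]) auto
    show "g \<in> borel_measurable (lebesgue_on {a..b})"
      using g(1) integrable_imp_measurable by blast
    show "\<phi> absolutely_integrable_on {a..b}"
      by (intro absolutely_integrable_continuous_real pcont)
  qed auto
  then show gp: "(\<lambda>x. g x * \<phi> x) integrable_on {a..b}"
    by (simp add: absolutely_integrable_on_def)
  have Gp: "(\<lambda>x. G x * \<psi> x) integrable_on {a..b}"
    by (intro integrable_continuous_interval continuous_intros Gcont \<phi>)
  define S where "S x = g x * \<phi> x + G x * \<psi> x" for x
  have Sint: "S integrable_on {a..b}"
    unfolding S_def by (intro integrable_add gp Gp)
  have Sint': "S integrable_on {x..y}" if "{x..y} \<subseteq> {a..b}" for x y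
    using integrable_subinterval_real[OF Sint that] .
  \<comment> \<open>The defect of the product rule, to be shown constant.\<close>
  define H where "H x = G x * \<phi> x - integral {a..x} S" for x
  have H: "\<bar>H y - H x\<bar> \<le> 2 * M * K * (y - x)\<^sup>2" if xy: "a \<le> x" "x \<le> y" "y \<le> b" for x y
  proof -
    have sub: "{x..y} \<subseteq> {a..b}" using xy by auto
    have psi_int: "integral {x..y} \<psi> = \<phi> y - \<phi> x"
      using xy \<phi>(1) by (intro integral_unique fundamental_theorem_of_calculus)
        (auto simp: has_real_derivative_iff_has_vector_derivative[symmetric] intro: DERIV_subset)
    have i1: "(\<lambda>s. g s * \<phi> y) integrable_on {x..y}" using gint[OF sub] by (intro integrable_on_mult_left)
    have i2: "(\<lambda>s. G x * \<psi> s) integrable_on {x..y}"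
      using continuous_on_subset[OF \<phi>(2) sub] by (intro integrable_on_mult_right integrable_continuous_interval)
    have "G y * \<phi> y - G x * \<phi> x = (G y - G x) * \<phi> y + G x * (\<phi> y - \<phi> x)"
      by (simp add: algebra_simps)
    also have "\<dots> = integral {x..y} (\<lambda>s. g s * \<phi> y) + integral {x..y} (\<lambda>s. G x * \<psi> s)"
      using xy by (simp add: Gdiff psi_int)
    also have "\<dots> = integral {x..y} (\<lambda>s. g s * \<phi> y + G x * \<psi> s)"
      by (intro integral_add[symmetric] i1 i2)
    finally have 1: "G y * \<phi> y - G x * \<phi> x = integral {x..y} (\<lambda>s. g s * \<phi> y + G x * \<psi> s)" .
    have "integral {a..y} S - integral {a..x} S = integral {x..y} S"
      using xy Henstock_Kurzweil_Integration.integral_combine[of a x y S] Sint'[of a y] by auto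
    with 1 have "H y - H x = integral {x..y} (\<lambda>s. g s * \<phi> y + G x * \<psi> s) - integral {x..y} S"
      by (simp add: H_def)
    also have "\<dots> = integral {x..y} (\<lambda>s. (g s * \<phi> y + G x * \<psi> s) - S s)"
      by (intro integral_diff[symmetric] integrable_add i1 i2 Sint' sub)
    finally have eq: "H y - H x = integral {x..y} (\<lambda>s. (g s * \<phi> y + G x * \<psi> s) - S s)" .
    \<comment> \<open>The integrand is of first order in y - x, so its integral over an interval of
      that length is of second order.\<close>
    have "norm (integral {x..y} (\<lambda>s. (g s * \<phi> y + G x * \<psi> s) - S s)) \<le> integral {x..y} (\<lambda>_. 2 * M * K * (y - x))"
    proof (rule integral_norm_bound_integral)
      fix s assume s: "s \<in> {x..y}"
      then have sab: "s \<in> {a..b}" and yab: "y \<in> {a..b}" and xab: "x \<in> {a..b}" using xy by auto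
      have "(g s * \<phi> y + G x * \<psi> s) - S s = g s * (\<phi> y - \<phi> s) - (G s - G x) * \<psi> s"
        by (simp add: S_def algebra_simps)
      also have "\<bar>\<dots>\<bar> \<le> \<bar>g s\<bar> * \<bar>\<phi> y - \<phi> s\<bar> + \<bar>G s - G x\<bar> * \<bar>\<psi> s\<bar>"
        by (rule order_trans[OF abs_triangle_ineq4]) (simp add: abs_mult)
      also have "\<dots> \<le> M * (K * (y - x)) + (M * (y - x)) * K"
      proof (intro add_mono mult_mono)
        have "\<bar>\<phi> y - \<phi> s\<bar> \<le> K * \<bar>y - s\<bar>" by (rule ple[OF sab yab])
        also have "\<dots> \<le> K * (y - x)" using s K0 by (intro mult_left_mono) auto
        finally show "\<bar>\<phi> y - \<phi> s\<bar> \<le> K * (y - x)" .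
        have "\<bar>G s - G x\<bar> \<le> M * \<bar>s - x\<bar>" by (rule Gle[OF xab sab])
        also have "\<dots> \<le> M * (y - x)" using s M by (intro mult_left_mono) auto
        finally show "\<bar>G s - G x\<bar> \<le> M * (y - x)" .
      qed (use g(2)[OF sab] K[OF sab] M xy in auto)
      finally show "norm ((g s * \<phi> y + G x * \<psi> s) - S s) \<le> 2 * M * K * (y - x)" by (simp add: mult_ac)
    qed (auto intro!: integrable_diff integrable_add i1 i2 Sint' sub)
    then show ?thesis unfolding eq using xy by (simp add: power2_eq_square mult_ac)
  qed
  have H': "\<bar>H y - H x\<bar> \<le> 2 * M * K * (y - x)\<^sup>2" if "x \<in> {a..b}" "y \<in> {a..b}" for x y
    using H[of x y] H[of y x] that by (cases "x \<le> y") (auto simp: abs_minus_commute power2_commute)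
  have H0: "(H has_real_derivative 0) (at x within {a..b})" if x: "x \<in> {a..b}" for x
    unfolding has_field_derivative_def has_derivative_within_alt
  proof (intro conjI allI impI)
    fix e :: real assume e: "e > 0"
    have MK: "2 * M * K \<ge> 0" using M K0 by simp
    show "\<exists>d>0. \<forall>y\<in>{a..b}. norm (y - x) < d \<longrightarrow> norm (H y - H x - 0 * (y - x)) \<le> e * norm (y - x)"
    proof (intro exI[of _ "e / (2 * M * K + 1)"] conjI ballI impI)
      fix y assume y: "y \<in> {a..b}" "norm (y - x) < e / (2 * M * K + 1)"
      have "2 * M * K * \<bar>y - x\<bar> \<le> (2 * M * K + 1) * \<bar>y - x\<bar>" by (intro mult_right_mono) auto
      also have "\<dots> \<le> e" using y(2) MK by (simp add: field_simps)
      finally have "2 * M * K * \<bar>y - x\<bar> * \<bar>y - x\<bar> \<le> e * \<bar>y - x\<bar>" by (rule mult_right_mono) auto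
      with H'[OF x y(1)] show "norm (H y - H x - 0 * (y - x)) \<le> e * norm (y - x)"
        by (simp add: power2_eq_square mult.assoc)
    next
      show "e / (2 * M * K + 1) > 0" using e MK by (intro divide_pos_pos) linarith+
    qed
  qed (rule bounded_linear_mult_right)
  then have "H b = H a"
  proof -
    have "(*) (0::real) = (\<lambda>h. 0)" by (simp add: fun_eq_iff)
    then have "(H has_derivative (\<lambda>h. 0)) (at x within {a..b})" if "x \<in> {a..b}" for x
      using H0 that
      by (simp add: has_field_derivative_def)
    then show ?thesis using has_derivative_zero_unique[of "{a..b}" H a b] ab by auto
  qed
  then have "integral {a..b} S = 0" using ends by (simp add: H_def)
  moreover have "integral {a..b} S = integral {a..b} (\<lambda>x. g x * \<phi> x) + integral {a..b} (\<lambda>x. G x * \<psi> x)"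
    unfolding S_def by (intro integral_add gp Gp)
  ultimately show "integral {a..b} (\<lambda>x. G x * \<psi> x) = - integral {a..b} (\<lambda>x. g x * \<phi> x)" by simp
qed


text \<open>The identity inside \<open>weak_deriv\<close> without local integrability, a form that
  passes directly to bounded representatives and to primitives.\<close>

definition weak_pairing :: "nat \<Rightarrow> (real \<Rightarrow> real) \<Rightarrow> (real \<Rightarrow> real) \<Rightarrow> bool" where
  "weak_pairing n f g \<longleftrightarrow> (\<forall>\<phi>. test_function \<phi> \<longrightarrow>
     integral \<Omega> (\<lambda>x. f x * (deriv ^^ n) \<phi> x) = (- 1) ^ n * integral \<Omega> (\<lambda>x. g x * \<phi> x))"

lemma test_function_smooth: "test_function \<phi> \<Longrightarrow> smooth \<phi>"
  by (simp add: test_function_iff)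

lemma test_function_higher_deriv: "test_function \<phi> \<Longrightarrow> test_function ((deriv ^^ n) \<phi>)"
  by (induction n) (auto intro: test_function_deriv)

lemma test_function_continuous: "test_function \<phi> \<Longrightarrow> continuous_on A ((deriv ^^ n) \<phi>)"
  by (intro smooth_continuous test_function_smooth test_function_higher_deriv)

lemma test_function_continuous0: "test_function \<phi> \<Longrightarrow> continuous_on A \<phi>"
  using test_function_continuous[of \<phi> A 0] by simp

text \<open>If the bound failed at x it would fail nearby, and a bump supported there would
  contradict the integral estimate.\<close>

lemma abs_le_if_weak_le:
  assumes h: "continuous_on \<Omega> h"
    and le: "\<And>\<phi>. test_function \<phi> \<Longrightarrow> (\<And>x. \<phi> x \<ge> 0) \<Longrightarrow> \<bar>integral \<Omega> (\<lambda>x. h x * \<phi> x)\<bar> \<le> M * integral \<Omega> \<phi>"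
    and x: "x \<in> \<Omega>"
  shows "\<bar>h x\<bar> \<le> M"
proof (rule ccontr)
  assume "\<not> \<bar>h x\<bar> \<le> M"
  define s :: real where "s = (if h x \<ge> 0 then 1 else - 1)"
  have s: "s * h x = \<bar>h x\<bar>" "\<bar>s\<bar> = 1" by (auto simp: s_def)
  define w where "w y = s * h y - M" for y
  have w: "continuous_on \<Omega> w" "w x > 0"
    using h \<open>\<not> \<bar>h x\<bar> \<le> M\<close> s by (auto simp: w_def intro!: continuous_intros)
  obtain d where d: "d > 0" "\<And>y. y \<in> \<Omega> \<Longrightarrow> dist y x < d \<Longrightarrow> dist (w y) (w x) < w x"
    using w x unfolding continuous_on_iff by meson
  have wpos: "w y > 0" if "y \<in> \<Omega>" "\<bar>y - x\<bar> < d" for y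
    using d(2)[of y] that by (auto simp: dist_real_def abs_if split: if_splits)
  define e where "e = min d 1 / 2"
  have e: "e > 0" "e < d" "e < 1" using d(1) by (auto simp: e_def)
  have pi: "2 * pi > 6" using pi_gt3 by simp
  \<comment> \<open>The point x may be an end point of \<Omega>, where no test function can be
    centred. The support is placed beside x, on the side facing the midpoint pi.\<close>
  define a b where "a = (if x \<le> pi then x + e / 2 else x - e)" and "b = (if x \<le> pi then x + e else x - e / 2)"
  have ab: "0 < a" "a < b" "b < 2 * pi"
    using e x pi by (auto simp: a_def b_def)
  have close: "\<bar>y - x\<bar> < d" if "y \<in> {a..b}" for y
    using that e by (auto simp: a_def b_def split: if_splits)
  obtain \<beta> where \<beta>: "test_function \<beta>" "\<And>x. \<beta> x \<ge> 0" "\<And>x. x \<in> {a<..<b} \<Longrightarrow> \<beta> x > 0" "\<And>x. x \<notin> {a<..<b} \<Longrightarrow> \<beta> x = 0"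
    using bump_exists[OF ab] by blast
  have hb: "(\<lambda>y. h y * \<beta> y) integrable_on \<Omega>" "\<beta> integrable_on \<Omega>"
    by (intro integrable_continuous_interval continuous_intros h test_function_continuous0[OF \<beta>(1)])+
  have "integral \<Omega> (\<lambda>y. w y * \<beta> y) = integral \<Omega> (\<lambda>y. s * (h y * \<beta> y) - M * \<beta> y)"
    by (simp add: w_def algebra_simps)
  also have "\<dots> = s * integral \<Omega> (\<lambda>y. h y * \<beta> y) - M * integral \<Omega> \<beta>"
    using integrable_on_mult_right[OF hb(1)] integrable_on_mult_right[OF hb(2)]
    by (subst integral_diff) auto
  also have "\<dots> \<le> 0"
    using le[OF \<beta>(1,2)] s(2) by (auto simp: s_def split: if_splits)
  finally have "integral \<Omega> (\<lambda>y. w y * \<beta> y) \<le> 0" .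
  moreover have nn: "w y * \<beta> y \<ge> 0" if "y \<in> \<Omega>" for y
  proof (cases "y \<in> {a<..<b}")
    case True
    then show ?thesis using wpos[OF that close] \<beta>(3)[OF True] by (auto simp: less_imp_le)
  qed (simp add: \<beta>(4))
  moreover have cont: "continuous_on \<Omega> (\<lambda>y. w y * \<beta> y)"
    by (intro continuous_intros w test_function_continuous0 \<beta>)
  ultimately have "integral \<Omega> (\<lambda>y. w y * \<beta> y) = 0"
    by (meson integral_nonneg integrable_continuous_interval order_antisym)
  then have "\<forall>y\<in>\<Omega>. w y * \<beta> y = 0"
    using integral_eq_0_iff[OF cont] nn pi by auto
  moreover have mid: "(a + b) / 2 \<in> {a<..<b}" "(a + b) / 2 \<in> \<Omega>" using ab by auto
  ultimately have "w ((a + b) / 2) * \<beta> ((a + b) / 2) = 0" by blast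
  moreover have "w ((a + b) / 2) > 0" using mid by (intro wpos close) auto
  moreover have "\<beta> ((a + b) / 2) > 0" by (rule \<beta>(3)[OF mid(1)])
  ultimately show False by simp
qed

text \<open>The fundamental lemma of the calculus of variations, obtained from the preceding bound
  with M = 0.\<close>

lemma weak_pairing_0_eq:
  assumes "continuous_on \<Omega> f" "continuous_on \<Omega> g" "weak_pairing 0 f g" "x \<in> \<Omega>"
  shows "f x = g x"
proof -
  have "\<bar>f x - g x\<bar> \<le> 0"
  proof (rule abs_le_if_weak_le[where h = "\<lambda>x. f x - g x"])
    fix \<phi> assume \<phi>: "test_function \<phi>"
    have "integral \<Omega> (\<lambda>x. (f x - g x) * \<phi> x) = integral \<Omega> (\<lambda>x. f x * \<phi> x - g x * \<phi> x)"
      by (simp add: algebra_simps)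
    also have "\<dots> = integral \<Omega> (\<lambda>x. f x * \<phi> x) - integral \<Omega> (\<lambda>x. g x * \<phi> x)"
      by (intro integral_diff integrable_continuous_interval continuous_intros assms test_function_continuous0 \<phi>)
    also have "\<dots> = 0" using assms(3) \<phi> by (simp add: weak_pairing_def)
    finally show "\<bar>integral \<Omega> (\<lambda>x. (f x - g x) * \<phi> x)\<bar> \<le> 0 * integral \<Omega> \<phi>" by simp
  qed (use assms in \<open>auto intro!: continuous_intros\<close>)
  then show ?thesis by simp
qed

text \<open>
  Only test functions with mean zero are derivatives of test functions; the others differ by a
  multiple of a fixed bump, which accounts for the constant of integration \<open>c\<close>.
\<close>

lemma weak_pairing_integrate:
  assumes f: "continuous_on \<Omega> f" and g: "g integrable_on \<Omega>" "\<And>x. x \<in> \<Omega> \<Longrightarrow> \<bar>g x\<bar> \<le> M" "M \<ge> 0"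
    and fg: "weak_pairing (Suc n) f g"
  obtains c where "weak_pairing n f (\<lambda>x. c + integral {0..x} g)"
    "\<And>x y. x \<in> \<Omega> \<Longrightarrow> y \<in> \<Omega> \<Longrightarrow> \<bar>(c + integral {0..y} g) - (c + integral {0..x} g)\<bar> \<le> M * \<bar>y - x\<bar>"
    "continuous_on \<Omega> (\<lambda>x. c + integral {0..x} g)"
proof -
  obtain \<beta> where \<beta>: "test_function \<beta>" "\<And>x. \<beta> x \<ge> 0" "\<And>x. x \<in> {1<..<2} \<Longrightarrow> \<beta> x > 0"
    by (rule bump_exists[of 1 2]) (use pi_gt3 in auto)
  have "integral \<Omega> \<beta> \<noteq> 0"
  proof
    assume "integral \<Omega> \<beta> = 0"
    then have "\<forall>x\<in>\<Omega>. \<beta> x = 0"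
      using integral_eq_0_iff[of 0 "2 * pi" \<beta>] \<beta> by (auto intro: test_function_continuous0)
    moreover have "3 / 2 \<in> \<Omega>" using pi_gt3 by simp
    ultimately show False using \<beta>(3)[of "3/2"] by force
  qed
  define G where "G x = integral {0..x} g" for x
  define m where "m = integral \<Omega> \<beta>"
  \<comment> \<open>The only value for which the claimed identity holds for the test function
    \<beta>, whose integral is nonzero.\<close>
  define c where "c = ((- 1) ^ n * integral \<Omega> (\<lambda>x. f x * (deriv ^^ n) \<beta> x) - integral \<Omega> (\<lambda>x. G x * \<beta> x)) / m"
  have Gcont: "continuous_on \<Omega> G"
    unfolding G_def by (rule indefinite_integral_continuous_1[OF g(1)])
  have int1: "(\<lambda>x. f x * (deriv ^^ n) \<phi> x) integrable_on \<Omega>" "(\<lambda>x. G x * \<phi> x) integrable_on \<Omega>" "\<phi> integrable_on \<Omega>"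
    if "test_function \<phi>" for \<phi>
    by (intro integrable_continuous_interval continuous_intros f Gcont
        test_function_continuous[OF that] test_function_continuous0[OF that])+
  have zero: "integral \<Omega> (\<lambda>x. f x * (deriv ^^ n) \<theta> x) = (- 1) ^ n * integral \<Omega> (\<lambda>x. G x * \<theta> x)"
    if \<theta>: "test_function \<theta>" "integral \<Omega> \<theta> = 0" for \<theta>
  proof -
    obtain \<phi> where \<phi>: "test_function \<phi>" "deriv \<phi> = \<theta>" by (rule test_function_antiderivative[OF \<theta>])
    have "integral \<Omega> (\<lambda>x. f x * (deriv ^^ n) \<theta> x) = integral \<Omega> (\<lambda>x. f x * (deriv ^^ Suc n) \<phi> x)"
      by (simp add: funpow_Suc_right \<phi>(2) del: funpow.simps)
    also have "\<dots> = (- 1) ^ Suc n * integral \<Omega> (\<lambda>x. g x * \<phi> x)"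
      using fg \<phi>(1) unfolding weak_pairing_def by blast
    also have "integral \<Omega> (\<lambda>x. g x * \<phi> x) = - integral \<Omega> (\<lambda>x. G x * \<theta> x)"
    proof -
      have "DERIV \<phi> x :> \<theta> x" for x
        using smooth_DERIV[OF test_function_smooth[OF \<phi>(1)]] \<phi>(2) by simp
      then show ?thesis
        using antiderivative_by_parts(1)[OF g(1) g(2), of G 0 \<phi> \<theta>] test_function_support[OF \<phi>(1)] g(3)
          test_function_continuous0[OF \<theta>(1)] by (simp add: G_def)
    qed
    finally show ?thesis by simp
  qed
  have "weak_pairing n f (\<lambda>x. c + G x)"
    unfolding weak_pairing_def
  proof (intro allI impI)
    fix \<psi> assume \<psi>: "test_function \<psi>"
    \<comment> \<open>Subtracting this multiple of the bump removes the mean of \<psi>.\<close>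
    define r where "r = integral \<Omega> \<psi> / m"
    define \<theta> where "\<theta> = (\<lambda>x. \<psi> x - r * \<beta> x)"
    have \<theta>: "test_function \<theta>" unfolding \<theta>_def by (intro test_function_linear \<psi> \<beta>)
    have "integral \<Omega> \<theta> = integral \<Omega> \<psi> - r * m"
      unfolding \<theta>_def m_def using int1(3)[OF \<psi>] integrable_on_mult_right[OF int1(3)[OF \<beta>(1)]]
      by (subst integral_diff) auto
    also have "\<dots> = 0" using \<open>integral \<Omega> \<beta> \<noteq> 0\<close> by (simp add: r_def m_def)
    finally have 0: "integral \<Omega> \<theta> = 0" .
    have 1: "integral \<Omega> (\<lambda>x. f x * (deriv ^^ n) \<theta> x) =
        integral \<Omega> (\<lambda>x. f x * (deriv ^^ n) \<psi> x) - r * integral \<Omega> (\<lambda>x. f x * (deriv ^^ n) \<beta> x)"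
    proof -
      have "integral \<Omega> (\<lambda>x. f x * (deriv ^^ n) \<theta> x) =
          integral \<Omega> (\<lambda>x. f x * (deriv ^^ n) \<psi> x - r * (f x * (deriv ^^ n) \<beta> x))"
        unfolding \<theta>_def test_function_higher_deriv_linear[OF \<psi> \<beta>(1)] by (simp add: algebra_simps)
      then show ?thesis using int1(1)[OF \<psi>] integrable_on_mult_right[OF int1(1)[OF \<beta>(1)]]
        by (subst (asm) integral_diff) auto
    qed
    have 2: "integral \<Omega> (\<lambda>x. G x * \<theta> x) = integral \<Omega> (\<lambda>x. G x * \<psi> x) - r * integral \<Omega> (\<lambda>x. G x * \<beta> x)"
    proof -
      have "integral \<Omega> (\<lambda>x. G x * \<theta> x) = integral \<Omega> (\<lambda>x. G x * \<psi> x - r * (G x * \<beta> x))"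
        unfolding \<theta>_def by (simp add: algebra_simps)
      then show ?thesis using int1(2)[OF \<psi>] integrable_on_mult_right[OF int1(2)[OF \<beta>(1)]]
        by (subst (asm) integral_diff) auto
    qed
    have 3: "integral \<Omega> (\<lambda>x. (c + G x) * \<psi> x) = c * integral \<Omega> \<psi> + integral \<Omega> (\<lambda>x. G x * \<psi> x)"
    proof -
      have "integral \<Omega> (\<lambda>x. (c + G x) * \<psi> x) = integral \<Omega> (\<lambda>x. c * \<psi> x + G x * \<psi> x)"
        by (simp add: algebra_simps)
      then show ?thesis using int1(2)[OF \<psi>] integrable_on_mult_right[OF int1(3)[OF \<psi>]]
        by (subst (asm) integral_add) auto
    qed
    have 4: "c * integral \<Omega> \<psi> =
        r * ((- 1) ^ n * integral \<Omega> (\<lambda>x. f x * (deriv ^^ n) \<beta> x) - integral \<Omega> (\<lambda>x. G x * \<beta> x))"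
      by (simp add: c_def r_def)
    have sgn: "(- 1) ^ n * ((- 1) ^ n * z) = z" for z :: real
      by (simp flip: mult.assoc power_mult_distrib)
    show "integral \<Omega> (\<lambda>x. f x * (deriv ^^ n) \<psi> x) = (- 1) ^ n * integral \<Omega> (\<lambda>x. (c + G x) * \<psi> x)"
      using zero[OF \<theta> 0] unfolding 1 2 3 4 by (simp add: algebra_simps sgn)
  qed
  moreover have "\<bar>(c + G y) - (c + G x)\<bar> \<le> M * \<bar>y - x\<bar>" if "x \<in> \<Omega>" "y \<in> \<Omega>" for x y
    using antiderivative_by_parts(3)[OF g(1) g(2), of G 0 "\<lambda>_. 0" "\<lambda>_. 0"] that g(3) by (simp add: G_def)
  moreover have "continuous_on \<Omega> (\<lambda>x. c + G x)" by (intro continuous_intros Gcont)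
  ultimately show ?thesis using that unfolding G_def by blast
qed

text \<open>Integrating \<open>g\<close> lowers the order of the pairing by one, so the chain is
  built from the top downwards. Continuity of \<open>g\<close> makes each of these steps a classical
  derivative.\<close>

lemma weak_pairing_continuous_chain:
  assumes "continuous_on \<Omega> f" "continuous_on \<Omega> g" "weak_pairing n f g"
  shows "\<exists>D. (\<forall>x\<in>\<Omega>. D 0 x = f x) \<and> D n = g \<and>
    (\<forall>i<n. \<forall>x\<in>\<Omega>. (D i has_real_derivative D (Suc i) x) (at x within \<Omega>)) \<and>
    (\<forall>i\<le>n. weak_pairing i f (D i) \<and> continuous_on \<Omega> (D i))"
  using assms(2,3)
proof (induction n arbitrary: g)
  case 0
  then show ?case using weak_pairing_0_eq[OF assms(1), of g] by (intro exI[of _ "\<lambda>_. g"]) auto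
next
  case (Suc n)
  obtain M where M: "\<forall>x\<in>\<Omega>. \<bar>g x\<bar> \<le> M"
    using compact_imp_bounded[OF compact_continuous_image[OF Suc.prems(1) compact_Icc]]
    by (auto simp: bounded_iff)
  have M0: "M \<ge> 0" using M[rule_format, of 0] by simp
  have Mb: "\<bar>g x\<bar> \<le> M" if "x \<in> \<Omega>" for x using M that by blast
  obtain c where c: "weak_pairing n f (\<lambda>x. c + integral {0..x} g)" "continuous_on \<Omega> (\<lambda>x. c + integral {0..x} g)"
    by (rule weak_pairing_integrate[OF assms(1) integrable_continuous_interval[OF Suc.prems(1)] Mb M0 Suc.prems(2)])
  define G where "G x = c + integral {0..x} g" for x
  obtain D where D: "\<forall>x\<in>\<Omega>. D 0 x = f x" "D n = G"
    "\<forall>i<n. \<forall>x\<in>\<Omega>. (D i has_real_derivative D (Suc i) x) (at x within \<Omega>)"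
    "\<forall>i\<le>n. weak_pairing i f (D i) \<and> continuous_on \<Omega> (D i)"
    using Suc.IH[OF c(2,1)] unfolding G_def by blast
  have "(G has_real_derivative g x) (at x within \<Omega>)" if "x \<in> \<Omega>" for x
    unfolding G_def
    using integral_has_real_derivative[OF Suc.prems(1) that] by (auto intro!: derivative_eq_intros)
  then show ?case
    using D Suc.prems
    by (intro exI[of _ "D(Suc n := g)"]) (auto simp: less_Suc_eq le_Suc_eq)
qed

text \<open>An essential supremum ignores null sets, while integration by parts above asks for a
  bound at every point. So \<open>g\<close> is replaced by zero where the bound fails and at the
  ends of the interval, which no pairing integral notices.\<close>

lemma Linf_norm_less_representative:
  assumes "Linf_norm g < ereal M" "locally_integrable g"
  obtains g' where "g' integrable_on \<Omega>" "\<And>x. \<bar>g' x\<bar> \<le> M" "M \<ge> 0"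
    "\<And>\<phi>. integral \<Omega> (\<lambda>x. g x * \<phi> x) = integral \<Omega> (\<lambda>x. g' x * \<phi> x)"
proof -
  let ?L = "lebesgue_on \<Omega>"
  have meas_abs: "(\<lambda>x. ereal \<bar>g x\<bar>) \<in> borel_measurable ?L"
  proof (rule ccontr)
    assume "(\<lambda>x. ereal \<bar>g x\<bar>) \<notin> borel_measurable ?L"
    then have "Linf_norm g = top" unfolding Linf_norm_def by (rule esssup_non_measurable)
    then show False using assms(1) by simp
  qed
  have "AE x in ?L. \<bar>g x\<bar> \<le> M"
    using esssup_AE[of "\<lambda>x. ereal \<bar>g x\<bar>" ?L]
  proof eventually_elim
    case (elim x)
    then have "ereal \<bar>g x\<bar> < ereal M" using assms(1) unfolding Linf_norm_def by (rule le_less_trans)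
    then show ?case by simp
  qed
  then obtain N where N: "\<And>x. x \<in> \<Omega> - N \<Longrightarrow> \<bar>g x\<bar> \<le> M" "N \<in> null_sets ?L"
    by (rule AE_E3) (auto simp: space_restrict_space)
  have negl: "negligible N"
    using N(2) by (simp add: null_sets_restrict_space negligible_iff_null_sets)
  have M: "M \<ge> 0"
  proof (rule ccontr)
    assume "\<not> M \<ge> 0"
    then have "\<Omega> \<subseteq> N" using N(1) by force
    then have "negligible \<Omega>" using negl negligible_subset by blast
    then show False using negligible_interval(1)[of 0 "2 * pi"] pi_gt_zero by (simp add: box_real)
  qed
  define h where "h = (\<lambda>x. if x \<in> {0<..<2 * pi} then g x else 0)"
  \<comment> \<open>Local integrability yields measurability on compact subintervals of the open
    interval only; these exhaust it as n grows.\<close>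
  have h: "h \<in> borel_measurable lebesgue"
  proof (rule borel_measurable_LIMSEQ_real[where
        u = "\<lambda>n x. if x \<in> {1 / real (Suc n)..2 * pi - 1 / real (Suc n)} then g x else 0"])
    let ?S = "\<lambda>n. {1 / real (Suc n)..2 * pi - 1 / real (Suc n)}"
    show "(\<lambda>x. if x \<in> ?S n then g x else 0) \<in> borel_measurable lebesgue" for n
    proof -
      have "g absolutely_integrable_on ?S n"
      proof -
        have "0 < 1 / real (Suc n)" "2 * pi - 1 / real (Suc n) < 2 * pi" by simp_all
        then show ?thesis using assms(2) unfolding locally_integrable_def by blast
      qed
      then have "g \<in> borel_measurable (lebesgue_on (?S n))"
        by (rule absolutely_integrable_imp_borel_measurable) simp
      then show ?thesis by (subst borel_measurable_if) auto
    qed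
    show "(\<lambda>n. if x \<in> ?S n then g x else 0) \<longlonglongrightarrow> h x" for x
    proof (cases "x \<in> {0<..<2 * pi}")
      case True
      then have e: "min x (2 * pi - x) > 0" by simp
      have "eventually (\<lambda>n. 1 / real (Suc n) < min x (2 * pi - x)) sequentially"
        using order_tendstoD(2)[OF LIMSEQ_inverse_real_of_nat e] by (simp add: inverse_eq_divide)
      then have "eventually (\<lambda>n. (if x \<in> ?S n then g x else 0) = h x) sequentially"
        by eventually_elim (use True in \<open>auto simp: h_def\<close>)
      then show ?thesis by (rule tendsto_eventually)
    next
      case False
      have notin: "x \<notin> ?S n" for n
      proof
        assume "x \<in> ?S n"
        then have "1 / real (Suc n) \<le> x" "x \<le> 2 * pi - 1 / real (Suc n)" by auto
        moreover have "1 / real (Suc n) > 0" by simp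
        ultimately have "0 < x" "x < 2 * pi" by linarith+
        then show False using False by simp
      qed
      have "(if x \<in> ?S n then g x else 0) = h x" for n
        unfolding if_not_P[OF notin[of n]] h_def if_not_P[OF False] ..
      then have "(\<lambda>n. if x \<in> ?S n then g x else 0) = (\<lambda>n. h x)" by (rule ext)
      then show ?thesis by (simp only: tendsto_const)
    qed
  qed
  define g' where "g' = (\<lambda>x. if \<bar>h x\<bar> \<le> M then h x else 0)"
  have [measurable]: "h \<in> borel_measurable lebesgue" by (rule h)
  have "g' \<in> borel_measurable lebesgue"
    unfolding g'_def by measurable
  then have "g' \<in> borel_measurable (lebesgue_on \<Omega>)"
    by (rule measurable_restrict_space1)
  then have "g' integrable_on \<Omega>"
    by (rule measurable_bounded_by_integrable_imp_integrable_real[where g = "\<lambda>_. M"])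
      (use M in \<open>auto simp: g'_def\<close>)
  moreover have "\<bar>g' x\<bar> \<le> M" for x using M by (simp add: g'_def)
  moreover have "integral \<Omega> (\<lambda>x. g x * \<phi> x) = integral \<Omega> (\<lambda>x. g' x * \<phi> x)" for \<phi>
  proof (rule integral_spike)
    show "negligible (N \<union> {0, 2 * pi})" using negl by (intro negligible_Un) auto
    show "g' x * \<phi> x = g x * \<phi> x" if "x \<in> \<Omega> - (N \<union> {0, 2 * pi})" for x
    proof -
      have "h x = g x" using that by (auto simp: h_def)
      moreover have "\<bar>g x\<bar> \<le> M" using that by (intro N) auto
      ultimately show ?thesis by (simp add: g'_def)
    qed
  qed
  ultimately show ?thesis using that M by blast
qed

text \<open>One integration of the weak derivative of order n + 1 gives a Lipschitz function, the
  continuous top of the chain. Each lower order is bounded through a representative of its own,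
  because the norm takes a separate infimum for every order.\<close>

lemma sobolev_norm_less_classical:
  assumes f: "continuous_on \<Omega> f" and norm: "sobolev_norm (Suc n) f < ereal M"
  obtains D :: "nat \<Rightarrow> real \<Rightarrow> real" where
    "\<And>x. x \<in> \<Omega> \<Longrightarrow> D 0 x = f x"
    "\<And>i x. i < n \<Longrightarrow> x \<in> \<Omega> \<Longrightarrow> (D i has_real_derivative D (Suc i) x) (at x within \<Omega>)"
    "\<And>i. i \<le> n \<Longrightarrow> continuous_on \<Omega> (D i)"
    "\<And>i x. i \<le> n \<Longrightarrow> x \<in> \<Omega> \<Longrightarrow> \<bar>D i x\<bar> \<le> M"
    "\<And>x y. x \<in> \<Omega> \<Longrightarrow> y \<in> \<Omega> \<Longrightarrow> \<bar>D n y - D n x\<bar> \<le> M * \<bar>y - x\<bar>"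
proof -
  have rep: "\<exists>g. g integrable_on \<Omega> \<and> (\<forall>x. \<bar>g x\<bar> \<le> M) \<and> M \<ge> 0 \<and> weak_pairing i f g" if i: "i \<le> Suc n" for i
  proof -
    have "(INF g\<in>{g. weak_deriv i f g}. Linf_norm g) \<le> sobolev_norm (Suc n) f"
      unfolding sobolev_norm_def using i by (intro SUP_upper) auto
    then have "(INF g\<in>{g. weak_deriv i f g}. Linf_norm g) < ereal M"
      using norm by (rule le_less_trans)
    then obtain g where g: "weak_deriv i f g" "Linf_norm g < ereal M"
      by (auto simp: INF_less_iff)
    obtain g' where g': "g' integrable_on \<Omega>" "\<And>x. \<bar>g' x\<bar> \<le> M" "M \<ge> 0"
      "\<And>\<phi>. integral \<Omega> (\<lambda>x. g x * \<phi> x) = integral \<Omega> (\<lambda>x. g' x * \<phi> x)"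
      using Linf_norm_less_representative[OF g(2)] g(1) unfolding weak_deriv_def by metis
    have "weak_pairing i f g'"
      using g(1) g'(4) unfolding weak_deriv_def weak_pairing_def by simp
    then show ?thesis using g' by blast
  qed
  obtain g where g: "g integrable_on \<Omega>" "\<And>x. \<bar>g x\<bar> \<le> M" "M \<ge> 0" "weak_pairing (Suc n) f g"
    using rep[of "Suc n"] by auto
  obtain c where c: "weak_pairing n f (\<lambda>x. c + integral {0..x} g)"
    "\<And>x y. x \<in> \<Omega> \<Longrightarrow> y \<in> \<Omega> \<Longrightarrow> \<bar>(c + integral {0..y} g) - (c + integral {0..x} g)\<bar> \<le> M * \<bar>y - x\<bar>"
    "continuous_on \<Omega> (\<lambda>x. c + integral {0..x} g)"
    by (rule weak_pairing_integrate[OF f g(1) g(2) g(3) g(4)]) (rule that)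
  obtain D where D: "\<forall>x\<in>\<Omega>. D 0 x = f x" "D n = (\<lambda>x. c + integral {0..x} g)"
    "\<forall>i<n. \<forall>x\<in>\<Omega>. (D i has_real_derivative D (Suc i) x) (at x within \<Omega>)"
    "\<forall>i\<le>n. weak_pairing i f (D i) \<and> continuous_on \<Omega> (D i)"
    using weak_pairing_continuous_chain[OF f c(3,1)] by blast
  have bound: "\<bar>D i x\<bar> \<le> M" if i: "i \<le> n" and x: "x \<in> \<Omega>" for i x
  proof (rule abs_le_if_weak_le[OF _ _ x])
    show "continuous_on \<Omega> (D i)" using D(4) i by blast
    fix \<phi> assume \<phi>: "test_function \<phi>" "\<And>x. \<phi> x \<ge> 0"
    obtain g where g: "g integrable_on \<Omega>" "\<And>x. \<bar>g x\<bar> \<le> M" "M \<ge> 0" "weak_pairing i f g"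
      using rep[of i] i by auto
    \<comment> \<open>The classical derivative and the bounded representative pair equally with test
      functions, since both are paired with the same f; the bound of the latter thus passes to the
      former.\<close>
    have "weak_pairing i f (D i)" using D(4) i by blast
    then have "(- 1) ^ i * integral \<Omega> (\<lambda>x. D i x * \<phi> x) = (- 1) ^ i * integral \<Omega> (\<lambda>x. g x * \<phi> x)"
      using g(4) \<phi>(1) unfolding weak_pairing_def by (auto dest!: spec[of _ \<phi>])
    then have eq: "integral \<Omega> (\<lambda>x. D i x * \<phi> x) = integral \<Omega> (\<lambda>x. g x * \<phi> x)" by simp
    have "(\<lambda>x. g x * \<phi> x) integrable_on \<Omega>"
    proof (rule antiderivative_by_parts(2)[where G = "\<lambda>x. 0 + integral {0..x} g" and c = 0 and M = M and \<psi> = "deriv \<phi>"])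
      show "DERIV \<phi> x :> deriv \<phi> x" for x by (intro smooth_DERIV test_function_smooth \<phi>)
      show "continuous_on \<Omega> (deriv \<phi>)" by (intro test_function_continuous0 test_function_deriv \<phi>)
      show "\<phi> 0 = 0" "\<phi> (2 * pi) = 0" by (intro test_function_support \<phi>, simp)+
    qed (use g in simp_all)
    then have "norm (integral \<Omega> (\<lambda>x. g x * \<phi> x)) \<le> integral \<Omega> (\<lambda>x. M * \<phi> x)"
    proof (rule integral_norm_bound_integral)
      show "(\<lambda>x. M * \<phi> x) integrable_on \<Omega>"
        by (intro integrable_continuous_interval continuous_on_mult_left test_function_continuous0 \<phi>(1))
      show "norm (g x * \<phi> x) \<le> M * \<phi> x" for x
        using mult_right_mono[OF g(2)[of x] \<phi>(2)[of x]] \<phi>(2)[of x] by (simp add: abs_mult)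
    qed
    then show "\<bar>integral \<Omega> (\<lambda>x. D i x * \<phi> x)\<bar> \<le> M * integral \<Omega> \<phi>"
      by (simp add: eq)
  qed
  have lip: "\<bar>D n y - D n x\<bar> \<le> M * \<bar>y - x\<bar>" if "x \<in> \<Omega>" "y \<in> \<Omega>" for x y
    using c(2)[OF that] by (simp add: D(2))
  show ?thesis
  proof (rule that[of D])
    show "D 0 x = f x" if "x \<in> \<Omega>" for x using D(1) that by blast
    show "(D i has_real_derivative D (Suc i) x) (at x within \<Omega>)" if "i < n" "x \<in> \<Omega>" for i x
      using D(3) that by blast
    show "continuous_on \<Omega> (D i)" if "i \<le> n" for i using D(4) that by blast
  qed (fact bound lip)+
qed

section \<open>Finite differences\<close>

text \<open>Space differences commute with the time derivative without any knowledge of mixed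
  derivatives; this is their purpose.\<close>

fun fdiff :: "nat \<Rightarrow> real \<Rightarrow> (real \<Rightarrow> real) \<Rightarrow> real \<Rightarrow> real" where
  "fdiff 0 d f x = f x"
| "fdiff (Suc n) d f x = fdiff n d f (x + d) - fdiff n d f x"

text \<open>The recursion takes the new difference last. Taking it first lets an induction pass to
  the function of increments.\<close>

lemma fdiff_Suc_shift: "fdiff (Suc n) d f x = fdiff n d (\<lambda>y. f (y + d) - f y) x"
proof (induction n arbitrary: x)
  case (Suc n)
  show ?case by (simp only: fdiff.simps(2)[of "Suc n"] Suc.IH) simp
qed simp

lemma fdiff_cong:
  assumes "\<And>y. y \<in> {x..x + real n * d} \<Longrightarrow> f y = g y" "d \<ge> 0"
  shows "fdiff n d f x = fdiff n d g x"
  using assms(1)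
proof (induction n arbitrary: x)
  case (Suc n)
  have "fdiff n d f (x + d) = fdiff n d g (x + d)"
    using assms(2) by (intro Suc.IH Suc.prems) (auto simp: algebra_simps)
  moreover have "fdiff n d f x = fdiff n d g x"
    using assms(2) by (intro Suc.IH Suc.prems) (auto simp: algebra_simps)
  ultimately show ?case by simp
qed simp

lemma fdiff_has_derivative:
  assumes "\<And>y. y \<in> {x..x + real n * d} \<Longrightarrow> ((\<lambda>r. f r y) has_real_derivative f' y) (at t within S)" "d \<ge> 0"
  shows "((\<lambda>r. fdiff n d (f r) x) has_real_derivative fdiff n d f' x) (at t within S)"
  using assms(1)
proof (induction n arbitrary: x)
  case (Suc n)
  have "((\<lambda>r. fdiff n d (f r) (x + d)) has_real_derivative fdiff n d f' (x + d)) (at t within S)"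
    using assms(2) by (intro Suc.IH Suc.prems) (auto simp: algebra_simps)
  moreover have "((\<lambda>r. fdiff n d (f r) x) has_real_derivative fdiff n d f' x) (at t within S)"
    using assms(2) by (intro Suc.IH Suc.prems) (auto simp: algebra_simps)
  ultimately show ?case by (auto intro: DERIV_diff)
qed simp

lemma fdiff_continuous:
  assumes "\<And>y. y \<in> {x..x + real n * d} \<Longrightarrow> continuous_on S (\<lambda>r. f r y)" "d \<ge> 0"
  shows "continuous_on S (\<lambda>r. fdiff n d (f r) x)"
  using assms(1)
proof (induction n arbitrary: x)
  case (Suc n)
  have "continuous_on S (\<lambda>r. fdiff n d (f r) (x + d))"
    using assms(2) by (intro Suc.IH Suc.prems) (auto simp: algebra_simps)
  moreover have "continuous_on S (\<lambda>r. fdiff n d (f r) x)"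
    using assms(2) by (intro Suc.IH Suc.prems) (auto simp: algebra_simps)
  ultimately show ?case by (auto intro: continuous_on_diff)
qed simp

lemma mvt_within:
  fixes f :: "real \<Rightarrow> real"
  assumes "a < b" "{a..b} \<subseteq> S"
    and f: "\<And>x. x \<in> {a..b} \<Longrightarrow> (f has_real_derivative f' x) (at x within S)"
  shows "\<exists>z\<in>{a<..<b}. f b - f a = (b - a) * f' z"
proof -
  have f': "(f has_real_derivative f' x) (at x within {a..b})" if "x \<in> {a..b}" for x
    using f[OF that] assms(2) by (rule DERIV_subset)
  have "\<exists>z\<in>{a<..<b}. f b - f a = (*) (f' z) (b - a)"
  proof (rule mvt[OF assms(1)])
    show "continuous_on {a..b} f" using f' by (rule DERIV_continuous_on)
    fix x assume "a < x" "x < b"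
    then have "(f has_real_derivative f' x) (at x)"
      using f'[of x] at_within_interior[of x "{a..b}"] by simp
    then show "(f has_derivative (*) (f' x)) (at x)" by (simp add: has_field_derivative_def)
  next
    fix z assume "a < z" "z < b" "f b - f a = (*) (f' z) (b - a)"
    then show "\<exists>z\<in>{a<..<b}. f b - f a = (*) (f' z) (b - a)" by (intro bexI[of _ z]) auto
  qed
  then show ?thesis by (metis mult.commute)
qed

text \<open>The increments \<open>D i (y + d) - D i y\<close> form a chain of derivatives that is
  one shorter; the ordinary mean value theorem resolves the last difference.\<close>

lemma fdiff_mean_value:
  fixes D :: "nat \<Rightarrow> real \<Rightarrow> real"
  assumes "d > 0"
    and "\<And>i y. i < n \<Longrightarrow> y \<in> {x..x + real n * d} \<Longrightarrow>
      (D i has_real_derivative D (Suc i) y) (at y within {x..x + real n * d})"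
  shows "\<exists>\<xi>\<in>{x..x + real n * d}. fdiff n d (D 0) x = d ^ n * D n \<xi>"
  using assms(2)
proof (induction n arbitrary: D)
  case (Suc n)
  define g where "g i y = D i (y + d) - D i y" for i y
  let ?S = "{x..x + real (Suc n) * d}" and ?S' = "{x..x + real n * d}"
  have sub: "?S' \<subseteq> ?S" "(\<lambda>y. y + d) ` ?S' \<subseteq> ?S" using assms(1) by (auto simp: algebra_simps)
  have "(g i has_real_derivative g (Suc i) y) (at y within ?S')" if "i < n" "y \<in> ?S'" for i y
  proof -
    have "(D i has_real_derivative D (Suc i) (y + d)) (at (y + d) within (\<lambda>y. y + d) ` ?S')"
      using Suc.prems[of i "y + d"] that sub by (blast intro: DERIV_subset less_SucI)
    moreover have "((\<lambda>y. y + d) has_real_derivative 1) (at y within ?S')"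
      by (auto intro!: derivative_eq_intros)
    ultimately have "((\<lambda>y. D i (y + d)) has_real_derivative D (Suc i) (y + d)) (at y within ?S')"
      using DERIV_image_chain[of "D i" "D (Suc i) (y + d)" "\<lambda>y. y + d" y ?S' 1] by (simp add: o_def)
    moreover have "(D i has_real_derivative D (Suc i) y) (at y within ?S')"
      using Suc.prems[of i y] that sub by (blast intro: DERIV_subset less_SucI)
    ultimately show ?thesis unfolding g_def by (rule DERIV_diff)
  qed
  then obtain \<xi> where \<xi>: "\<xi> \<in> ?S'" "fdiff n d (g 0) x = d ^ n * g n \<xi>"
    using Suc.IH[of g] by blast
  have "{\<xi>..\<xi> + d} \<subseteq> ?S" using \<xi>(1) assms(1) by (auto simp: algebra_simps)
  then obtain z where z: "z \<in> {\<xi><..<\<xi> + d}" "D n (\<xi> + d) - D n \<xi> = (\<xi> + d - \<xi>) * D (Suc n) z"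
    using mvt_within[of \<xi> "\<xi> + d" ?S "D n" "D (Suc n)"] Suc.prems[of n] assms(1) by auto
  have "fdiff (Suc n) d (D 0) x = d ^ n * (D n (\<xi> + d) - D n \<xi>)"
    using \<xi>(2) unfolding fdiff_Suc_shift g_def .
  also have "\<dots> = d ^ Suc n * D (Suc n) z" using z(2) by simp
  finally show ?case using z(1) \<open>{\<xi>..\<xi> + d} \<subseteq> ?S\<close> by (intro bexI[of _ z]) auto
qed simp

text \<open>At the top order no classical derivative exists, so a Lipschitz bound of the derivative
  of order n - 1 takes the place of a bound of order n.\<close>

lemma abs_fdiff_le:
  fixes D :: "nat \<Rightarrow> real \<Rightarrow> real"
  assumes "d > 0" and S: "S = {x..x + real n * d}"
    and D: "\<And>i y. Suc i < n \<Longrightarrow> y \<in> S \<Longrightarrow> (D i has_real_derivative D (Suc i) y) (at y within S)"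
    and le: "\<And>y. y \<in> S \<Longrightarrow> \<bar>D 0 y\<bar> \<le> M"
    and lip: "\<And>y z. n > 0 \<Longrightarrow> y \<in> S \<Longrightarrow> z \<in> S \<Longrightarrow> \<bar>D (n - 1) z - D (n - 1) y\<bar> \<le> M * \<bar>z - y\<bar>"
  shows "\<bar>fdiff n d (D 0) x\<bar> \<le> d ^ n * M"
proof (cases n)
  case 0
  then show ?thesis using le[of x] S by simp
next
  case (Suc m)
  define g where "g i y = D i (y + d) - D i y" for i y
  let ?S' = "{x..x + real m * d}"
  have sub: "?S' \<subseteq> S" "(\<lambda>y. y + d) ` ?S' \<subseteq> S" using assms(1) by (auto simp: algebra_simps S Suc)
  have "(g i has_real_derivative g (Suc i) y) (at y within ?S')" if "i < m" "y \<in> ?S'" for i y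
  proof -
    have "(D i has_real_derivative D (Suc i) (y + d)) (at (y + d) within (\<lambda>y. y + d) ` ?S')"
      using D[of i "y + d"] that sub Suc by (blast intro: DERIV_subset Suc_mono)
    moreover have "((\<lambda>y. y + d) has_real_derivative 1) (at y within ?S')"
      by (auto intro!: derivative_eq_intros)
    ultimately have "((\<lambda>y. D i (y + d)) has_real_derivative D (Suc i) (y + d)) (at y within ?S')"
      using DERIV_image_chain[of "D i" "D (Suc i) (y + d)" "\<lambda>y. y + d" y ?S' 1] by (simp add: o_def)
    moreover have "(D i has_real_derivative D (Suc i) y) (at y within ?S')"
      using D[of i y] that sub Suc by (blast intro: DERIV_subset Suc_mono)
    ultimately show ?thesis unfolding g_def by (rule DERIV_diff)
  qed
  then obtain \<xi> where \<xi>: "\<xi> \<in> ?S'" "fdiff m d (g 0) x = d ^ m * g m \<xi>"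
    using fdiff_mean_value[of d m x g] assms(1) by blast
  have "\<bar>D m (\<xi> + d) - D m \<xi>\<bar> \<le> M * d"
  proof -
    have "\<xi> \<in> S" "\<xi> + d \<in> S" using sub \<xi>(1) by blast+
    then show ?thesis using lip[of \<xi> "\<xi> + d"] Suc assms(1) by simp
  qed
  then have "d ^ m * \<bar>D m (\<xi> + d) - D m \<xi>\<bar> \<le> d ^ m * (M * d)"
    using assms(1) by (intro mult_left_mono) auto
  moreover have "fdiff n d (D 0) x = d ^ m * (D m (\<xi> + d) - D m \<xi>)"
    using \<xi>(2) unfolding Suc fdiff_Suc_shift g_def .
  ultimately show ?thesis using assms(1) by (simp add: abs_mult Suc mult_ac)
qed

section \<open>Regularity in time\<close>

lemma DERIV_unique_within_Icc:
  assumes "a < b" "x \<in> {a..b}" "(f has_real_derivative d) (at x within {a..b})"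
    "(f has_real_derivative d') (at x within {a..b})"
  shows "d = d'"
  using vector_derivative_unique_within_closed_interval[of a b x f d d'] assms
  by (simp add: has_real_derivative_iff_has_vector_derivative)

text \<open>Formally \<open>D t i\<close> has time derivative \<open>D t (i + 2)\<close>, but this
  mixed derivative is not known to exist. The i-th space difference of u is differentiable in time,
  with the difference of \<open>D t 2\<close> as derivative, and that is at most d^i M. By the mean
  value theorem the difference of u is d^i times \<open>D t i\<close> at a nearby point, so dividing
  by d^i and shrinking the stencil gives the Lipschitz bound in time.\<close>

lemma heat_solution_regularity:
  assumes heat: "heat_solution T u0 u q" and T: "T > 0" and n: "n \<ge> 3"
    and norm: "sobolev_norm_T (Suc n) T u < ereal M"
  obtains D :: "real \<Rightarrow> nat \<Rightarrow> real \<Rightarrow> real" where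
    "\<And>t x. t \<in> {0..T} \<Longrightarrow> x \<in> \<Omega> \<Longrightarrow> D t 0 x = u x t"
    "\<And>t x. t \<in> {0..T} \<Longrightarrow> x \<in> \<Omega> \<Longrightarrow> D t 1 x = q x t"
    "\<And>t i x. t \<in> {0..T} \<Longrightarrow> i < n \<Longrightarrow> x \<in> \<Omega> \<Longrightarrow>
      (D t i has_real_derivative D t (Suc i) x) (at x within \<Omega>)"
    "\<And>t i. t \<in> {0..T} \<Longrightarrow> i \<le> n \<Longrightarrow> continuous_on \<Omega> (D t i)"
    "\<And>t i x. t \<in> {0..T} \<Longrightarrow> i \<le> n \<Longrightarrow> x \<in> \<Omega> \<Longrightarrow> \<bar>D t i x\<bar> \<le> M"
    "\<And>s t i x. s \<in> {0..T} \<Longrightarrow> t \<in> {0..T} \<Longrightarrow> i < n \<Longrightarrow> x \<in> \<Omega> \<Longrightarrow> \<bar>D t i x - D s i x\<bar> \<le> M * \<bar>t - s\<bar>"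
    "\<And>t x. t \<in> {0..T} \<Longrightarrow> x \<in> \<Omega> \<Longrightarrow> (u x has_real_derivative D t 2 x) (at t within {0..T})"
proof -
  have ucont: "continuous_on (\<Omega> \<times> {0..T}) (\<lambda>(x, t). u x t)"
    and ux: "\<And>t x. t \<in> {0..T} \<Longrightarrow> x \<in> \<Omega> \<Longrightarrow> ((\<lambda>y. u y t) has_real_derivative q x t) (at x within \<Omega>)"
    and ut: "\<And>t x. t \<in> {0<..T} \<Longrightarrow> x \<in> \<Omega> \<Longrightarrow> \<exists>d.
        ((\<lambda>y. q y t) has_real_derivative d) (at x within \<Omega>) \<and>
        ((\<lambda>s. u x s) has_real_derivative d) (at t within {0..T})"
    using heat unfolding heat_solution_def by blast+
  have ucx: "continuous_on \<Omega> (\<lambda>y. u y t)" if "t \<in> {0..T}" for t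
    using ux[OF that] by (rule DERIV_continuous_on)
  have uct: "continuous_on {0..T} (\<lambda>t. u x t)" if "x \<in> \<Omega>" for x
  proof -
    have "continuous_on {0..T} ((\<lambda>(x, t). u x t) \<circ> (\<lambda>t. (x, t)))"
      by (intro continuous_on_compose continuous_intros continuous_on_subset[OF ucont]) (use that in auto)
    then show ?thesis by (simp add: o_def)
  qed
  have nm: "sobolev_norm (Suc n) (\<lambda>y. u y t) < ereal M" if "t \<in> {0..T}" for t
  proof -
    have "sobolev_norm (Suc n) (\<lambda>y. u y t) \<le> sobolev_norm_T (Suc n) T u"
      unfolding sobolev_norm_T_def using that by (rule SUP_upper)
    then show ?thesis using norm by (rule le_less_trans)
  qed
  have ex: "\<forall>t\<in>{0..T}. \<exists>D. (\<forall>x\<in>\<Omega>. D 0 x = u x t) \<and>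
      (\<forall>i<n. \<forall>x\<in>\<Omega>. (D i has_real_derivative D (Suc i) x) (at x within \<Omega>)) \<and>
      (\<forall>i\<le>n. continuous_on \<Omega> (D i)) \<and> (\<forall>i\<le>n. \<forall>x\<in>\<Omega>. \<bar>D i x\<bar> \<le> M) \<and>
      (\<forall>x\<in>\<Omega>. \<forall>y\<in>\<Omega>. \<bar>D n y - D n x\<bar> \<le> M * \<bar>y - x\<bar>)"
  proof
    fix t assume t: "t \<in> {0..T}"
    obtain D where "\<And>x. x \<in> \<Omega> \<Longrightarrow> D 0 x = u x t"
      "\<And>i x. i < n \<Longrightarrow> x \<in> \<Omega> \<Longrightarrow> (D i has_real_derivative D (Suc i) x) (at x within \<Omega>)"
      "\<And>i. i \<le> n \<Longrightarrow> continuous_on \<Omega> (D i)" "\<And>i x. i \<le> n \<Longrightarrow> x \<in> \<Omega> \<Longrightarrow> \<bar>D i x\<bar> \<le> M"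
      "\<And>x y. x \<in> \<Omega> \<Longrightarrow> y \<in> \<Omega> \<Longrightarrow> \<bar>D n y - D n x\<bar> \<le> M * \<bar>y - x\<bar>"
      by (rule sobolev_norm_less_classical[OF ucx[OF t] nm[OF t]]) (rule that)
    then show "\<exists>D. (\<forall>x\<in>\<Omega>. D 0 x = u x t) \<and>
      (\<forall>i<n. \<forall>x\<in>\<Omega>. (D i has_real_derivative D (Suc i) x) (at x within \<Omega>)) \<and>
      (\<forall>i\<le>n. continuous_on \<Omega> (D i)) \<and> (\<forall>i\<le>n. \<forall>x\<in>\<Omega>. \<bar>D i x\<bar> \<le> M) \<and>
      (\<forall>x\<in>\<Omega>. \<forall>y\<in>\<Omega>. \<bar>D n y - D n x\<bar> \<le> M * \<bar>y - x\<bar>)" by (intro exI[of _ D] conjI ballI allI impI)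
  qed
  from bchoice[OF ex] obtain D where D: "\<forall>t\<in>{0..T}. (\<forall>x\<in>\<Omega>. D t 0 x = u x t) \<and>
      (\<forall>i<n. \<forall>x\<in>\<Omega>. (D t i has_real_derivative D t (Suc i) x) (at x within \<Omega>)) \<and>
      (\<forall>i\<le>n. continuous_on \<Omega> (D t i)) \<and> (\<forall>i\<le>n. \<forall>x\<in>\<Omega>. \<bar>D t i x\<bar> \<le> M) \<and>
      (\<forall>x\<in>\<Omega>. \<forall>y\<in>\<Omega>. \<bar>D t n y - D t n x\<bar> \<le> M * \<bar>y - x\<bar>)"
    by (elim exE) (rule that)
  have D0: "D t 0 x = u x t" if "t \<in> {0..T}" "x \<in> \<Omega>" for t x using D that by blast
  have DD: "(D t i has_real_derivative D t (Suc i) x) (at x within \<Omega>)" if "t \<in> {0..T}" "i < n" "x \<in> \<Omega>" for t i x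
    using D that by blast
  have Dc: "continuous_on \<Omega> (D t i)" if "t \<in> {0..T}" "i \<le> n" for t i using D that by blast
  have Db: "\<bar>D t i x\<bar> \<le> M" if "t \<in> {0..T}" "i \<le> n" "x \<in> \<Omega>" for t i x using D that by blast
  have Dlip: "\<bar>D t i y - D t i x\<bar> \<le> M * \<bar>y - x\<bar>" if "t \<in> {0..T}" "i \<le> n" "x \<in> \<Omega>" "y \<in> \<Omega>" for t i x y
  proof (cases "i = n")
    case True
    then show ?thesis using D that by blast
  next
    case False
    then have "i < n" using that by simp
    then have "norm (D t i y - D t i x) \<le> M * norm (y - x)"
      using that DD[of t i] Db[of t "Suc i"]
      by (intro field_differentiable_bound[of \<Omega> _ "D t (Suc i)"]) auto
    then show ?thesis by simp
  qed
  have M0: "M \<ge> 0" using Db[of 0 0 0] T by simp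
  have pi: "2 * pi > 6" using pi_gt3 by simp
  have D1: "D t 1 x = q x t" if t: "t \<in> {0..T}" and x: "x \<in> \<Omega>" for t x
  proof (rule DERIV_unique_within_Icc[of 0 "2 * pi" x])
    show "(D t 0 has_real_derivative D t 1 x) (at x within \<Omega>)" using DD[of t 0 x] t x n by simp
    show "(D t 0 has_real_derivative q x t) (at x within \<Omega>)"
      using ux[OF t x] D0[OF t] x by (subst has_field_derivative_cong_eventually[where g = "\<lambda>y. u y t"])
        (auto simp: eventually_at_filter)
  qed (use x pi in auto)
  have Dt: "(u x has_real_derivative D t 2 x) (at t within {0..T})" if t: "t \<in> {0<..T}" and x: "x \<in> \<Omega>" for t x
  proof -
    obtain d where d: "((\<lambda>y. q y t) has_real_derivative d) (at x within \<Omega>)"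
      "((\<lambda>s. u x s) has_real_derivative d) (at t within {0..T})"
      using ut[OF t x] by blast
    have t': "t \<in> {0..T}" using t by auto
    have "(D t 1 has_real_derivative d) (at x within \<Omega>)"
      using d(1) D1[OF t'] x by (subst has_field_derivative_cong_eventually[where g = "\<lambda>y. q y t"])
        (auto simp: eventually_at_filter)
    moreover have "(D t 1 has_real_derivative D t 2 x) (at x within \<Omega>)"
      using DD[of t 1 x] t' x n by (simp add: numeral_2_eq_2)
    ultimately have "d = D t 2 x" using x pi by (intro DERIV_unique_within_Icc[of 0 "2 * pi" x]) auto
    then show ?thesis using d(2) by simp
  qed
  \<comment> \<open>The restriction i < n makes order i + 2 at most n + 1, where the last order is
    present as a Lipschitz bound.\<close>
  have time: "\<bar>D t i x - D s i x\<bar> \<le> M * (t - s)"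
    if st: "0 \<le> s" "s < t" "t \<le> T" and i: "i < n" and x: "x \<in> \<Omega>" for s t i x
  proof (rule field_le_epsilon)
    fix e :: real assume e: "e > 0"
    \<comment> \<open>Moving from the point of the mean value theorem back to x costs at most M
      \<delta> at each of the two times; \<delta> makes the total at most e.\<close>
    define \<delta> where "\<delta> = min 1 (e / (2 * M + 1))"
    have \<delta>: "\<delta> > 0" "\<delta> \<le> 1" "2 * M * \<delta> \<le> e"
    proof -
      show "\<delta> > 0" using e M0 by (auto simp: \<delta>_def)
      show "\<delta> \<le> 1" by (simp add: \<delta>_def)
      have "2 * M * \<delta> \<le> (2 * M + 1) * (e / (2 * M + 1))"
        using M0 e by (intro mult_mono) (auto simp: \<delta>_def)
      then show "2 * M * \<delta> \<le> e" using M0 by simp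
    qed
    define d where "d = \<delta> / (real i + 1)"
    have d: "d > 0" "real i * d \<le> \<delta>" using \<delta> by (auto simp: d_def field_simps)
    \<comment> \<open>Near the right end the stencil is moved to the left so that it stays inside
      \<Omega>.\<close>
    define x' where "x' = min x (2 * pi - \<delta>)"
    define S where "S = {x'..x' + real i * d}"
    have x': "0 \<le> x'" "x' + real i * d \<le> 2 * pi" using x \<delta> d pi by (auto simp: x'_def)
    have near: "\<bar>\<xi> - x\<bar> \<le> \<delta>" if "\<xi> \<in> S" for \<xi>
      using that d(2) \<delta> x by (auto simp: S_def x'_def min_def split: if_splits)
    have S: "S \<subseteq> \<Omega>" using x' by (auto simp: S_def)
    define F where "F r = fdiff i d (\<lambda>y. u y r) x'" for r
    have FD: "\<exists>\<xi>\<in>S. F r = d ^ i * D r i \<xi>" if r: "r \<in> {0..T}" for r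
    proof -
      have "F r = fdiff i d (D r 0) x'"
        unfolding F_def using S d(1) by (intro fdiff_cong) (auto simp: D0[OF r] S_def)
      moreover have "\<exists>\<xi>\<in>S. fdiff i d (D r 0) x' = d ^ i * D r i \<xi>"
        unfolding S_def using d(1) S i
        by (intro fdiff_mean_value) (auto simp: S_def intro!: DERIV_subset[OF DD[OF r]])
      ultimately show ?thesis by simp
    qed
    have "norm (F t - F s) \<le> d ^ i * M * t - d ^ i * M * s"
    proof (rule differentiable_bound_general[where f' = "\<lambda>r. fdiff i d (D r 2) x'" and
          \<phi> = "\<lambda>r. d ^ i * M * r" and \<phi>' = "\<lambda>_. d ^ i * M"])
      show "continuous_on {s..t} F"
        unfolding F_def using S d(1) st
        by (intro fdiff_continuous) (auto simp: S_def intro: continuous_on_subset[OF uct])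
      fix r assume r: "s < r" "r < t"
      then have r': "r \<in> {0<..T}" "r \<in> {0..T}" "r \<in> {0<..<T}" using st by auto
      have "(F has_real_derivative fdiff i d (D r 2) x') (at r within {0..T})"
        unfolding F_def using S d(1)
        by (intro fdiff_has_derivative Dt r') (auto simp: S_def)
      then have "(F has_real_derivative fdiff i d (D r 2) x') (at r)"
        using at_within_interior[of r "{0..T}"] r'(3) by simp
      then show "(F has_vector_derivative fdiff i d (D r 2) x') (at r)"
        by (simp add: has_real_derivative_iff_has_vector_derivative)
      have "\<bar>fdiff i d ((\<lambda>j. D r (2 + j)) 0) x'\<bar> \<le> d ^ i * M"
      proof (rule abs_fdiff_le[OF d(1) S_def])
        show "(D r (2 + j) has_real_derivative D r (2 + Suc j) y) (at y within S)" if "Suc j < i" "y \<in> S" for j y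
          using DERIV_subset[OF DD[OF r'(2), of "2 + j" y] S] that S i by auto
        show "\<bar>D r (2 + 0) y\<bar> \<le> M" if "y \<in> S" for y
          using Db[OF r'(2), of 2 y] that S n by auto
        show "\<bar>D r (2 + (i - 1)) z - D r (2 + (i - 1)) y\<bar> \<le> M * \<bar>z - y\<bar>" if "0 < i" "y \<in> S" "z \<in> S" for y z
        proof -
          have "y \<in> \<Omega>" "z \<in> \<Omega>" using that S by blast+
          then show ?thesis using Dlip[OF r'(2), of "2 + (i - 1)" y z] that i by simp
        qed
      qed
      then show "norm (fdiff i d (D r 2) x') \<le> d ^ i * M" by simp
      show "((\<lambda>r. d ^ i * M * r) has_vector_derivative d ^ i * M) (at r)"
        by (auto intro!: derivative_eq_intros simp: has_real_derivative_iff_has_vector_derivative[symmetric])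
    qed (use st in \<open>auto intro!: continuous_intros\<close>)
    then have Fle: "\<bar>F t - F s\<bar> \<le> d ^ i * (M * (t - s))" by (simp add: algebra_simps)
    obtain \<xi> where \<xi>: "\<xi> \<in> S" "F t = d ^ i * D t i \<xi>" using FD[of t] st by auto
    obtain \<eta> where \<eta>: "\<eta> \<in> S" "F s = d ^ i * D s i \<eta>" using FD[of s] st by auto
    have "d ^ i * \<bar>D t i \<xi> - D s i \<eta>\<bar> = \<bar>F t - F s\<bar>"
      using d(1) by (simp add: \<xi>(2) \<eta>(2) right_diff_distrib[symmetric] abs_mult)
    with Fle have "d ^ i * \<bar>D t i \<xi> - D s i \<eta>\<bar> \<le> d ^ i * (M * (t - s))" by linarith
    then have 1: "\<bar>D t i \<xi> - D s i \<eta>\<bar> \<le> M * (t - s)"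
      by (rule mult_left_le_imp_le) (use d(1) in simp)
    have "\<bar>D t i \<xi> - D t i x\<bar> \<le> M * \<bar>\<xi> - x\<bar>"
      using Dlip[of t i x \<xi>] st i x \<xi>(1) S by auto
    also have "\<dots> \<le> M * \<delta>" using near[OF \<xi>(1)] M0 by (intro mult_left_mono)
    finally have 2: "\<bar>D t i \<xi> - D t i x\<bar> \<le> M * \<delta>" .
    have "\<bar>D s i \<eta> - D s i x\<bar> \<le> M * \<bar>\<eta> - x\<bar>"
      using Dlip[of s i x \<eta>] st i x \<eta>(1) S by auto
    also have "\<dots> \<le> M * \<delta>" using near[OF \<eta>(1)] M0 by (intro mult_left_mono)
    finally have 3: "\<bar>D s i \<eta> - D s i x\<bar> \<le> M * \<delta>" .
    show "\<bar>D t i x - D s i x\<bar> \<le> M * (t - s) + e"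
      using 1 2 3 \<delta>(3) by linarith
  qed
  have time': "\<bar>D t i x - D s i x\<bar> \<le> M * \<bar>t - s\<bar>"
    if "s \<in> {0..T}" "t \<in> {0..T}" "i < n" "x \<in> \<Omega>" for s t i x
    using time[of s t i x] time[of t s i x] that
    by (cases s t rule: linorder_cases) (auto simp: abs_minus_commute)
  \<comment> \<open>The equation is assumed for positive times. At time 0 it follows from the mean
    value theorem in time and the Lipschitz bound of \<open>D t 2\<close>.\<close>
  have "(u x has_real_derivative D t 2 x) (at t within {0..T})" if t: "t \<in> {0..T}" and x: "x \<in> \<Omega>" for t x
  proof (cases "t = 0")
    case False
    then show ?thesis using Dt t x by auto
  next
    case True
    have le: "\<bar>u x s - u x 0 - D 0 2 x * s\<bar> \<le> M * s * s" if s: "s \<in> {0<..T}" for s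
    proof -
      obtain c where "0 < c" "c < s" "u x s - u x 0 = (*) (D c 2 x) (s - 0)"
      proof (rule mvt[of 0 s "u x" "\<lambda>c. (*) (D c 2 x)"])
        show "continuous_on {0..s} (u x)" using s by (intro continuous_on_subset[OF uct[OF x]]) auto
        show "(u x has_derivative (*) (D c 2 x)) (at c)" if "0 < c" "c < s" for c
          using Dt[of c x] that x s at_within_interior[of c "{0..T}"]
          by (simp add: has_field_derivative_def)
      qed (use s in auto)
      then have c: "c \<in> {0<..<s}" "u x s - u x 0 = D c 2 x * s" by auto
      have "\<bar>D c 2 x - D 0 2 x\<bar> \<le> M * c" using time'[of 0 c 2 x] c s x n by auto
      also have "\<dots> \<le> M * s" using c M0 by (intro mult_left_mono) auto
      finally have "\<bar>D c 2 x - D 0 2 x\<bar> * s \<le> M * s * s" using s by (intro mult_right_mono) auto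
      moreover have "u x s - u x 0 - D 0 2 x * s = (D c 2 x - D 0 2 x) * s"
        using c(2) by (simp add: algebra_simps)
      ultimately show ?thesis using s by (simp add: abs_mult)
    qed
    show ?thesis
      unfolding has_field_derivative_def has_derivative_within_alt True
    proof (intro conjI allI impI)
      fix e :: real assume e: "e > 0"
      show "\<exists>d>0. \<forall>y\<in>{0..T}. norm (y - 0) < d \<longrightarrow> norm (u x y - u x 0 - D 0 2 x * (y - 0)) \<le> e * norm (y - 0)"
      proof (rule exI[of _ "e / (M + 1)"], intro conjI ballI impI)
        show "e / (M + 1) > 0" using e M0 by auto
      next
        fix y assume y: "y \<in> {0..T}" "norm (y - 0) < e / (M + 1)"
        show "norm (u x y - u x 0 - D 0 2 x * (y - 0)) \<le> e * norm (y - 0)"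
        proof (cases "y = 0")
          case False
          then have y0: "y \<in> {0<..T}" using y by auto
          have "M * y \<le> (M + 1) * y" using y0 by (intro mult_right_mono) auto
          also have "\<dots> \<le> e" using y(2) M0 y0 by (simp add: field_simps)
          finally have "M * y * y \<le> e * y" using y0 by (intro mult_right_mono) auto
          then have "\<bar>u x y - u x 0 - D 0 2 x * y\<bar> \<le> e * y" using le[OF y0] by linarith
          then show ?thesis using y0 by simp
        qed simp
      qed
    qed (rule bounded_linear_mult_right)
  qed
  then show ?thesis by (intro that[of D] D0 D1 DD Dc Db time')
qed

section \<open>Gradient flows in finite dimension and their smoothing\<close>

definition mat_app :: "'i set \<Rightarrow> ('i \<Rightarrow> 'i \<Rightarrow> real) \<Rightarrow> ('i \<Rightarrow> real) \<Rightarrow> 'i \<Rightarrow> real" where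
  "mat_app I g x i = (\<Sum>i'\<in>I. g i i' * x i')"

definition flip :: "('i \<Rightarrow> 'i \<Rightarrow> real) \<Rightarrow> 'i \<Rightarrow> 'i \<Rightarrow> real" where
  "flip g i i' = g i' i"

lemma flip_flip [simp]: "flip (flip g) = g"
  by (simp add: flip_def fun_eq_iff)

definition dot :: "'i set \<Rightarrow> ('i \<Rightarrow> real) \<Rightarrow> ('i \<Rightarrow> real) \<Rightarrow> real" where
  "dot I x y = (\<Sum>i\<in>I. x i * y i)"

lemma dot_mat_app: "dot I (mat_app I g x) y = dot I x (mat_app I (flip g) y)"
  unfolding dot_def mat_app_def flip_def sum_distrib_left sum_distrib_right
  by (subst sum.swap) (simp add: mult_ac)

lemma dot_self: "dot I x x = (L2_set x I)\<^sup>2"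
  by (simp add: dot_def L2_set_def sum_nonneg power2_eq_square)

lemma dot_le: "\<bar>dot I x y\<bar> \<le> L2_set x I * L2_set y I"
proof -
  have "\<bar>dot I x y\<bar> \<le> (\<Sum>i\<in>I. \<bar>x i\<bar> * \<bar>y i\<bar>)"
    unfolding dot_def by (rule order_trans[OF sum_abs]) (simp add: abs_mult)
  also have "\<dots> \<le> L2_set x I * L2_set y I"
    by (rule L2_set_mult_ineq)
  finally show ?thesis .
qed

lemma mat_app_minus: "mat_app I g (\<lambda>i. - x i) = (\<lambda>i. - mat_app I g x i)"
  by (simp add: mat_app_def sum_negf fun_eq_iff)

lemma mat_app_has_derivative:
  assumes "\<And>i. i \<in> I \<Longrightarrow> ((\<lambda>s. x s i) has_real_derivative x' i) (at s)"
  shows "((\<lambda>s. mat_app I g (x s) i) has_real_derivative mat_app I g x' i) (at s)"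
  unfolding mat_app_def by (auto intro!: derivative_eq_intros assms simp: mult.commute)

text \<open>The exponential series of the matrix applied to \<phi>. The sum K of all absolute
  entries bounds one application of the matrix in the maximum norm, so the terms are dominated by
  those of B exp (K |s|).\<close>

lemma linear_flow_exists:
  fixes a :: "'i \<Rightarrow> 'i \<Rightarrow> real" and \<phi> :: "'i \<Rightarrow> real"
  assumes "finite I"
  obtains z :: "real \<Rightarrow> 'i \<Rightarrow> real" where
    "\<And>i. i \<in> I \<Longrightarrow> z 0 i = \<phi> i"
    "\<And>s i. i \<in> I \<Longrightarrow> ((\<lambda>s. z s i) has_real_derivative - mat_app I a (z s) i) (at s)"
proof -
  define K where "K = (\<Sum>i\<in>I. \<Sum>i'\<in>I. \<bar>a i i'\<bar>)"
  define B where "B = (\<Sum>i\<in>I. \<bar>\<phi> i\<bar>)"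
  have K0: "K \<ge> 0" unfolding K_def by (intro sum_nonneg) auto
  define p where "p n = ((\<lambda>x i. - mat_app I a x i) ^^ n) \<phi>" for n
  have p0: "p 0 = \<phi>" and pS: "p (Suc n) i = - mat_app I a (p n) i" for n i
    by (simp_all add: p_def)
  have bound: "\<bar>p n i\<bar> \<le> K ^ n * B" if "i \<in> I" for n i
    using that
  proof (induction n arbitrary: i)
    case 0
    have "\<bar>\<phi> i\<bar> \<le> B" unfolding B_def using 0 assms by (intro member_le_sum) auto
    then show ?case by (simp add: p0)
  next
    case (Suc n)
    have "\<bar>p (Suc n) i\<bar> \<le> (\<Sum>i'\<in>I. \<bar>a i i'\<bar> * \<bar>p n i'\<bar>)"
      unfolding pS mat_app_def using sum_abs[of "\<lambda>i'. a i i' * p n i'" I] by (simp add: abs_mult)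
    also have "\<dots> \<le> (\<Sum>i'\<in>I. \<bar>a i i'\<bar> * (K ^ n * B))"
      by (intro sum_mono mult_left_mono Suc.IH) auto
    also have "\<dots> = (\<Sum>i'\<in>I. \<bar>a i i'\<bar>) * (K ^ n * B)"
      by (simp add: sum_distrib_right)
    also have "\<dots> \<le> K * (K ^ n * B)"
    proof (rule mult_right_mono)
      show "(\<Sum>i'\<in>I. \<bar>a i i'\<bar>) \<le> K"
        unfolding K_def using Suc.prems assms
        by (intro member_le_sum[where f = "\<lambda>i. \<Sum>i'\<in>I. \<bar>a i i'\<bar>"]) (auto intro: sum_nonneg)
      show "0 \<le> K ^ n * B" using K0 by (auto simp: B_def intro!: mult_nonneg_nonneg sum_nonneg)
    qed
    finally show ?case by (simp add: mult_ac)
  qed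
  define c where "c i n = p n i / fact n" for i n
  have summ: "summable (\<lambda>n. c i n * s ^ n)" if "i \<in> I" for i and s :: real
  proof (rule summable_comparison_test')
    show "summable (\<lambda>n. B * (inverse (fact n) * (K * \<bar>s\<bar>) ^ n))"
      by (intro summable_mult summable_exp)
    show "norm (c i n * s ^ n) \<le> B * (inverse (fact n) * (K * \<bar>s\<bar>) ^ n)" if "n \<ge> 0" for n
    proof -
      have "norm (c i n * s ^ n) = \<bar>p n i\<bar> * (\<bar>s\<bar> ^ n / fact n)"
        by (simp add: c_def abs_mult power_abs)
      also have "\<dots> \<le> (K ^ n * B) * (\<bar>s\<bar> ^ n / fact n)"
        by (intro mult_right_mono bound \<open>i \<in> I\<close>) auto
      finally show ?thesis by (simp add: power_mult_distrib field_simps)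
    qed
  qed
  define z where "z s i = (\<Sum>n. c i n * s ^ n)" for s i
  have diffs: "diffs (c i) n = - mat_app I a (\<lambda>i. c i n) i" for i n
  proof -
    have "diffs (c i) n = p (Suc n) i / fact n"
      by (simp add: diffs_def c_def del: of_nat_Suc)
    also have "\<dots> = - mat_app I a (\<lambda>i. c i n) i"
      by (simp add: pS mat_app_def c_def sum_divide_distrib)
    finally show ?thesis .
  qed
  have "((\<lambda>s. z s i) has_real_derivative - mat_app I a (z s) i) (at s)" if "i \<in> I" for s i
  proof -
    have "((\<lambda>s. z s i) has_real_derivative (\<Sum>n. diffs (c i) n * s ^ n)) (at s)"
      unfolding z_def by (rule termdiffs_strong_converges_everywhere) (rule summ[OF that])
    also have "(\<Sum>n. diffs (c i) n * s ^ n) = (\<Sum>n. \<Sum>i'\<in>I. - a i i' * (c i' n * s ^ n))"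
      by (simp add: diffs mat_app_def sum_distrib_left sum_negf mult_ac)
    also have "\<dots> = (\<Sum>i'\<in>I. \<Sum>n. - a i i' * (c i' n * s ^ n))"
      by (intro suminf_sum summable_mult summ)
    also have "\<dots> = - mat_app I a (z s) i"
      unfolding mat_app_def z_def sum_negf[symmetric]
      by (intro sum.cong refl) (simp add: suminf_mult[OF summ] suminf_minus summable_mult summ)
    finally show ?thesis .
  qed
  moreover have "z 0 i = \<phi> i" if "i \<in> I" for i
    using powser_zero[of "c i"] by (simp add: z_def c_def p0)
  ultimately show ?thesis using that by blast
qed

text \<open>Over time r the quantity \<open>E\<close> loses 2 r f(c) for some intermediate c and
  stays nonnegative, while \<open>f\<close> is smallest at the right end. So dissipation over a time
  interval turns into smallness of \<open>f\<close> at its end.\<close>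

lemma decay_step:
  fixes E f :: "real \<Rightarrow> real"
  assumes E: "\<And>s. (E has_real_derivative - 2 * f s) (at s)"
    and f: "\<And>s. (f has_real_derivative f' s) (at s)" "\<And>s. f' s \<le> 0"
    and "\<And>s. E s \<ge> 0" "r > 0"
  shows "f (s + r) \<le> E s / (2 * r)"
proof -
  have "\<exists>c>s. c < s + r \<and> E (s + r) - E s = (s + r - s) * (- 2 * f c)"
    by (rule MVT2) (use \<open>r > 0\<close> E in auto)
  then obtain c where c: "c < s + r" "E (s + r) - E s = r * (- 2 * f c)"
    by auto
  have "f (s + r) \<le> f c"
    by (rule DERIV_nonpos_imp_nonincreasing[of c "s + r" f]) (use c f in \<open>auto intro!: exI\<close>)
  then have "2 * r * f (s + r) \<le> 2 * r * f c"
    using \<open>r > 0\<close> by simp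
  also have "\<dots> \<le> E s" using c(2) assms(4)[of "s + r"] by (simp add: algebra_simps)
  finally show ?thesis using \<open>r > 0\<close> by (simp add: field_simps)
qed

text \<open>Each application of \<open>g\<close> costs a factor \<open>s powr (-1/2)\<close>.\<close>

lemma flow_smoothing:
  fixes g :: "'i \<Rightarrow> 'i \<Rightarrow> real" and z :: "real \<Rightarrow> 'i \<Rightarrow> real"
  assumes z: "\<And>s i. i \<in> I \<Longrightarrow>
      ((\<lambda>s. z s i) has_real_derivative - mat_app I (flip g) (mat_app I g (z s)) i) (at s)"
    and s: "s > 0"
  defines "G \<equiv> mat_app I g" and "Gt \<equiv> mat_app I (flip g)"
  shows "L2_set (z s) I \<le> L2_set (z 0) I"
    and "L2_set (G (z s)) I \<le> s powr (-1/2) * L2_set (z 0) I"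
    and "L2_set (Gt (G (z s))) I \<le> s powr (-1) * L2_set (z 0) I"
    and "L2_set (G (Gt (G (z s)))) I \<le> 2 * s powr (-3/2) * L2_set (z 0) I"
    and "L2_set (Gt (G (Gt (G (z s))))) I \<le> 6 * s powr (-2) * L2_set (z 0) I"
proof -
  have deriv_G: "((\<lambda>s. G (x s) i) has_real_derivative G x' i) (at s)"
    if "\<And>i. i \<in> I \<Longrightarrow> ((\<lambda>s. x s i) has_real_derivative x' i) (at s)" for x x' s i
    unfolding G_def by (rule mat_app_has_derivative) (rule that)
  have deriv_Gt: "((\<lambda>s. Gt (x s) i) has_real_derivative Gt x' i) (at s)"
    if "\<And>i. i \<in> I \<Longrightarrow> ((\<lambda>s. x s i) has_real_derivative x' i) (at s)" for x x' s i
    unfolding Gt_def by (rule mat_app_has_derivative) (rule that)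
  have deriv_sq: "((\<lambda>s. (L2_set (x s) I)\<^sup>2) has_real_derivative 2 * dot I (x s) x') (at s)"
    if "\<And>i. i \<in> I \<Longrightarrow> ((\<lambda>s. x s i) has_real_derivative x' i) (at s)" for x x' s
    unfolding dot_self[symmetric] dot_def
    by (auto intro!: derivative_eq_intros that simp: sum_distrib_left mult_ac sum.distrib[symmetric])
  have neg: "G (\<lambda>i. - x i) = (\<lambda>i. - G x i)" "Gt (\<lambda>i. - x i) = (\<lambda>i. - Gt x i)" for x
    by (simp_all add: G_def Gt_def mat_app_minus)
  have dneg: "dot I x (\<lambda>i. - y i) = - dot I x y" for x y
    by (simp add: dot_def sum_negf)
  have adj: "dot I x (Gt y) = (dot I (G x) y)" "dot I x (G y) = dot I (Gt x) y" for x y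
    by (simp_all add: G_def Gt_def dot_mat_app)
  have z': "i \<in> I \<Longrightarrow> ((\<lambda>s. z s i) has_real_derivative - Gt (G (z s)) i) (at s)" for s i
    using z by (simp add: G_def Gt_def)
  \<comment> \<open>G and its transpose applied in turn. The squared norms e0, e1, ... satisfy e_i'
    = - 2 e_(i+1), which is the input of \<open>decay_step\<close>.\<close>
  define z1 where "z1 s = G (z s)" for s
  define z2 where "z2 s = Gt (z1 s)" for s
  define z3 where "z3 s = G (z2 s)" for s
  define z4 where "z4 s = Gt (z3 s)" for s
  define z5 where "z5 s = G (z4 s)" for s
  have d0: "i \<in> I \<Longrightarrow> ((\<lambda>s. z s i) has_real_derivative - z2 s i) (at s)" for s i
    using z' by (simp add: z2_def z1_def)
  have d1: "((\<lambda>s. z1 s i) has_real_derivative - z3 s i) (at s)" for s i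
    using deriv_G[OF d0] by (simp add: z1_def z3_def neg)
  have d2: "((\<lambda>s. z2 s i) has_real_derivative - z4 s i) (at s)" for s i
    using deriv_Gt[OF d1] by (simp add: z2_def z4_def neg)
  have d3: "((\<lambda>s. z3 s i) has_real_derivative - z5 s i) (at s)" for s i
    using deriv_G[OF d2] by (simp add: z3_def z5_def neg)
  have d4: "((\<lambda>s. z4 s i) has_real_derivative - Gt (z5 s) i) (at s)" for s i
    using deriv_Gt[OF d3] by (simp add: z4_def neg)
  define e0 where "e0 s = (L2_set (z s) I)\<^sup>2" for s
  define e1 where "e1 s = (L2_set (z1 s) I)\<^sup>2" for s
  define e2 where "e2 s = (L2_set (z2 s) I)\<^sup>2" for s
  define e3 where "e3 s = (L2_set (z3 s) I)\<^sup>2" for s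
  define e4 where "e4 s = (L2_set (z4 s) I)\<^sup>2" for s
  define e5 where "e5 s = (L2_set (z5 s) I)\<^sup>2" for s
  have E0: "(e0 has_real_derivative - 2 * e1 s) (at s)" for s
    unfolding e0_def using deriv_sq[of z "\<lambda>i. - z2 s i" s] d0
    by (simp add: e1_def dneg z2_def adj z1_def dot_self)
  have E1: "(e1 has_real_derivative - 2 * e2 s) (at s)" for s
    unfolding e1_def using deriv_sq[of z1 "\<lambda>i. - z3 s i" s] d1
    by (simp add: e2_def dneg z3_def adj z2_def dot_self)
  have E2: "(e2 has_real_derivative - 2 * e3 s) (at s)" for s
    unfolding e2_def using deriv_sq[of z2 "\<lambda>i. - z4 s i" s] d2
    by (simp add: e3_def dneg z4_def adj z3_def dot_self)
  have E3: "(e3 has_real_derivative - 2 * e4 s) (at s)" for s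
    unfolding e3_def using deriv_sq[of z3 "\<lambda>i. - z5 s i" s] d3
    by (simp add: e4_def dneg z5_def adj z4_def dot_self)
  have E4: "(e4 has_real_derivative - 2 * e5 s) (at s)" for s
    unfolding e4_def using deriv_sq[of z4 "\<lambda>i. - Gt (z5 s) i" s] d4
    by (simp add: e5_def dneg adj z5_def dot_self)
  have nn: "e0 s \<ge> 0" "e1 s \<ge> 0" "e2 s \<ge> 0" "e3 s \<ge> 0" "e4 s \<ge> 0" "e5 s \<ge> 0" for s
    by (simp_all add: e0_def e1_def e2_def e3_def e4_def e5_def)
  have b1: "e1 (s + r) \<le> e0 s / (2 * r)" if "r > 0" for s r
    by (rule decay_step[OF E0 E1]) (use nn that in auto)
  have b2: "e2 (s + r) \<le> e1 s / (2 * r)" if "r > 0" for s r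
    by (rule decay_step[OF E1 E2]) (use nn that in auto)
  have b3: "e3 (s + r) \<le> e2 s / (2 * r)" if "r > 0" for s r
    by (rule decay_step[OF E2 E3]) (use nn that in auto)
  have b4: "e4 (s + r) \<le> e3 s / (2 * r)" if "r > 0" for s r
    by (rule decay_step[OF E3 E4]) (use nn that in auto)
  have c1: "e1 s \<le> e0 0 / s" if "s > 0" for s
    using b1[OF that, of 0] nn(1)[of 0] that by (simp add: field_simps)
  \<comment> \<open>Each further factor is gained on the second half of the time interval, starting
    from the previous bound at s / 2.\<close>
  have c2: "e2 s \<le> e0 0 / s\<^sup>2" if "s > 0" for s
  proof -
    have "e2 s \<le> e1 (s/2) / s" using b2[of "s/2" "s/2"] that by simp
    also have "\<dots> \<le> (e0 0 / s) / s"
      using b1[of "s/2" 0] that by (intro divide_right_mono) auto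
    finally show ?thesis by (simp add: power2_eq_square)
  qed
  have c3: "e3 s \<le> 4 * e0 0 / s^3" if "s > 0" for s
  proof -
    have "e3 s \<le> e2 (s/2) / s" using b3[of "s/2" "s/2"] that by simp
    also have "\<dots> \<le> (e0 0 / (s/2)\<^sup>2) / s"
      by (intro divide_right_mono c2) (use that in auto)
    also have "\<dots> = 4 * e0 0 / s^3" using that by (simp add: field_simps eval_nat_numeral)
    finally show ?thesis .
  qed
  have c4: "e4 s \<le> 36 * e0 0 / s^4" if "s > 0" for s
  proof -
    have "e4 s \<le> e3 (s/2) / s" using b4[of "s/2" "s/2"] that by simp
    also have "\<dots> \<le> (4 * e0 0 / (s/2)^3) / s"
      by (intro divide_right_mono c3) (use that in auto)
    also have "\<dots> = 32 * e0 0 / s^4" using that by (simp add: field_simps eval_nat_numeral)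
    \<comment> \<open>Rounded up to a square, so that the norm itself gets the constant 6.\<close>
    also have "\<dots> \<le> 36 * e0 0 / s^4"
      by (intro divide_right_mono) (use nn(1)[of 0] in auto)
    finally show ?thesis .
  qed
  have conv: "L2_set x I \<le> c * s powr p * L2_set (z 0) I"
    if "(L2_set x I)\<^sup>2 \<le> c\<^sup>2 * e0 0 / s ^ n" "p = - real n / 2" "c \<ge> 0" for x c p n
  proof (rule power2_le_imp_le)
    have "(s powr p)\<^sup>2 = s powr (- real n)"
      using s by (simp add: that(2) power2_eq_square powr_add[symmetric])
    also have "\<dots> = 1 / s ^ n" using s by (simp add: powr_minus powr_realpow divide_simps)
    finally show "(L2_set x I)\<^sup>2 \<le> (c * s powr p * L2_set (z 0) I)\<^sup>2"
      using that(1) by (simp add: power_mult_distrib e0_def field_simps)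
  qed (use that in auto)
  have "e0 s \<le> e0 0"
  proof (rule DERIV_nonpos_imp_nonincreasing[of 0 s e0])
    show "\<exists>d. (e0 has_real_derivative d) (at x) \<and> d \<le> 0" for x
      using E0[of x] nn(2)[of x] by (intro exI[of _ "- 2 * e1 x"]) auto
  qed (use s in auto)
  then show "L2_set (z s) I \<le> L2_set (z 0) I"
    unfolding e0_def by (rule power2_le_imp_le) auto
  show "L2_set (G (z s)) I \<le> s powr (-1/2) * L2_set (z 0) I"
    using conv[of "z1 s" 1 1 "-1/2"] c1[OF s] by (simp add: e1_def z1_def)
  show "L2_set (Gt (G (z s))) I \<le> s powr (-1) * L2_set (z 0) I"
    using conv[of "z2 s" 1 2 "-1"] c2[OF s] by (simp add: e2_def z2_def z1_def)
  show "L2_set (G (Gt (G (z s)))) I \<le> 2 * s powr (-3/2) * L2_set (z 0) I"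
    using conv[of "z3 s" 2 3 "-3/2"] c3[OF s] by (simp add: e3_def z3_def z2_def z1_def)
  show "L2_set (Gt (G (Gt (G (z s))))) I \<le> 6 * s powr (-2) * L2_set (z 0) I"
    using conv[of "z4 s" 6 4 "-2"] c4[OF s] by (simp add: e4_def z4_def z3_def z2_def z1_def)
qed


text \<open>In the pairing of y s - W t with z (t - s) the two flows cancel, and the derivative in s
  is the pairing of W s - W t with A z (t - s). Freezing W at the final time avoids its derivative
  and makes the increment small where A z (t - s) is large. The majorant \<open>b\<close> may blow
  up at s = t; only its primitive \<open>B\<close> has to be continuous there.\<close>

lemma duality_estimate:
  fixes I :: "'i set" and g :: "'i \<Rightarrow> 'i \<Rightarrow> real" and y W z :: "real \<Rightarrow> 'i \<Rightarrow> real"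
  defines "A \<equiv> (\<lambda>x. mat_app I (flip g) (mat_app I g x))"
  assumes t: "t > 0"
    and y_cont: "\<And>i. i \<in> I \<Longrightarrow> continuous_on {0..t} (\<lambda>s. y s i)"
    and y_deriv: "\<And>s i. s \<in> {0<..<t} \<Longrightarrow> i \<in> I \<Longrightarrow>
      ((\<lambda>s. y s i) has_real_derivative - A (\<lambda>i. y s i - W s i) i) (at s)"
    and init: "\<And>i. i \<in> I \<Longrightarrow> y 0 i = W 0 i"
    and z: "\<And>s i. i \<in> I \<Longrightarrow> ((\<lambda>s. z s i) has_real_derivative - A (z s) i) (at s)"
    and B_cont: "continuous_on {0..t} B"
    and B_deriv: "\<And>s. s \<in> {0<..<t} \<Longrightarrow> (B has_real_derivative b s) (at s)"
    and b: "\<And>s. s \<in> {0<..<t} \<Longrightarrow> \<bar>dot I (\<lambda>i. W s i - W t i) (A (z (t - s)))\<bar> \<le> b s"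
  shows "\<bar>dot I (\<lambda>i. y t i - W t i) (z 0)\<bar> \<le>
    \<bar>dot I (\<lambda>i. W 0 i - W t i) (z t)\<bar> + (B t - B 0)"
proof -
  define \<Phi> where "\<Phi> s = dot I (\<lambda>i. y s i - W t i) (z (t - s))" for s
  have zd: "((\<lambda>s. z (t - s) i) has_real_derivative A (z (t - s)) i) (at s)" if "i \<in> I" for s i
  proof -
    have "((\<lambda>s. t - s) has_real_derivative - 1) (at s)"
      by (auto intro!: derivative_eq_intros)
    from DERIV_chain'[OF this z[OF that]] show ?thesis by simp
  qed
  have A_adj: "dot I (A x) v = dot I x (A v)" for x v
    unfolding A_def dot_mat_app by (simp add: dot_mat_app)
  have "(\<Phi> has_real_derivative dot I (\<lambda>i. W s i - W t i) (A (z (t - s)))) (at s)"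
    if s: "s \<in> {0<..<t}" for s
  proof -
    have "(\<Phi> has_real_derivative
        (\<Sum>i\<in>I. - A (\<lambda>i. y s i - W s i) i * z (t - s) i
          + A (z (t - s)) i * (y s i - W t i))) (at s)"
      unfolding \<Phi>_def dot_def
      by (intro DERIV_sum) (auto intro!: derivative_eq_intros y_deriv[OF s] zd)
    also have "(\<Sum>i\<in>I. - A (\<lambda>i. y s i - W s i) i * z (t - s) i
          + A (z (t - s)) i * (y s i - W t i)) =
        - dot I (A (\<lambda>i. y s i - W s i)) (z (t - s)) + dot I (\<lambda>i. y s i - W t i) (A (z (t - s)))"
      by (simp add: dot_def sum.distrib sum_subtractf sum_negf mult.commute)
    also have "\<dots> = dot I (\<lambda>i. W s i - W t i) (A (z (t - s)))"
      unfolding A_adj by (simp add: dot_def sum_negf[symmetric] sum.distrib[symmetric] algebra_simps)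
    finally show ?thesis .
  qed
  moreover have "continuous_on {0..t} \<Phi>"
    unfolding \<Phi>_def dot_def
    by (intro continuous_intros y_cont)
       (auto intro!: DERIV_continuous_on zd DERIV_subset[OF zd])
  ultimately have "norm (\<Phi> t - \<Phi> 0) \<le> B t - B 0"
    using B_cont B_deriv b t
    by (intro differentiable_bound_general[where \<phi>' = b and
          f' = "\<lambda>s. dot I (\<lambda>i. W s i - W t i) (A (z (t - s)))"])
       (auto simp: has_real_derivative_iff_has_vector_derivative)
  moreover have "\<Phi> 0 = dot I (\<lambda>i. W 0 i - W t i) (z t)"
    unfolding \<Phi>_def dot_def by (intro sum.cong) (auto simp: init)
  moreover have "\<Phi> t = dot I (\<lambda>i. y t i - W t i) (z 0)"
    by (simp add: \<Phi>_def)
  ultimately show ?thesis by simp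
qed

lemma L2_set_le_if_dot_le:
  assumes "finite I" "\<And>\<phi>. dot I x \<phi> \<le> c * L2_set \<phi> I" "c \<ge> 0"
  shows "L2_set x I \<le> c"
proof (cases "L2_set x I = 0")
  case False
  then have pos: "L2_set x I > 0" using L2_set_nonneg[of x I] by linarith
  have "L2_set x I * L2_set x I \<le> c * L2_set x I"
    using assms(2)[of x] by (simp add: dot_self power2_eq_square)
  then show ?thesis using pos by simp
qed (use assms in auto)

lemma powr_mult_shift:
  fixes x :: real
  assumes "x > 0"
  shows "x * x powr p = x powr (1 + p)" "x powr p * x = x powr (1 + p)"
  using assms by (simp_all add: powr_add)

text \<open>A weighted geometric mean of two bounds: inside a time integral it trades a power of h
  for integrability.\<close>

lemma min_le_powr:
  fixes x y :: real
  assumes "0 \<le> v" "v \<le> x" "v \<le> y" "0 \<le> p" "p \<le> 1"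
  shows "v \<le> x powr p * y powr (1 - p)"
proof (cases "v = 0")
  case False
  then have "v = v powr p * v powr (1 - p)"
    using assms by (simp add: powr_add[symmetric])
  also have "\<dots> \<le> x powr p * y powr (1 - p)"
    using assms by (intro mult_mono powr_mono2) auto
  finally show ?thesis .
qed auto

text \<open>The error equation detached from the mesh. Here \<open>y\<close> is the error plus the
  correction \<open>W\<close>, \<kappa> a preimage of the main part of the increment of
  \<open>W\<close> under the transposed matrix, and \<open>D\<close> the remaining part. The bound
  \<open>D1\<close> carries h but does not decay as s tends to t, the bound \<open>D2\<close> decays
  but carries no h; the estimates below interpolate between them.\<close>

locale dissipative_error =
  fixes I :: "'i set" and g :: "'i \<Rightarrow> 'i \<Rightarrow> real" and y W \<kappa> D :: "real \<Rightarrow> 'i \<Rightarrow> real"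
    and t h \<epsilon> :: real
  assumes fin: "finite I" and t: "t > 0" and h: "h > 0" and \<epsilon>: "\<epsilon> \<ge> 0"
    and y_cont: "\<And>i. i \<in> I \<Longrightarrow> continuous_on {0..t} (\<lambda>s. y s i)"
    and y_deriv: "\<And>s i. s \<in> {0<..<t} \<Longrightarrow> i \<in> I \<Longrightarrow>
      ((\<lambda>s. y s i) has_real_derivative
        - mat_app I (flip g) (mat_app I g (\<lambda>i. y s i - W s i)) i) (at s)"
    and init: "\<And>i. i \<in> I \<Longrightarrow> y 0 i = W 0 i"
    and W: "\<And>s i. s \<in> {0..t} \<Longrightarrow> i \<in> I \<Longrightarrow> W s i - W t i = mat_app I (flip g) (\<kappa> s) i + D s i"
    and \<kappa>: "\<And>s. s \<in> {0..t} \<Longrightarrow> L2_set (\<kappa> s) I \<le> h * \<epsilon> * (t - s)"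
    and G\<kappa>: "\<And>s. s \<in> {0..t} \<Longrightarrow> L2_set (mat_app I (flip g) (\<kappa> s)) I \<le> \<epsilon> * (t - s)"
    and D1: "\<And>s. s \<in> {0..t} \<Longrightarrow> L2_set (D s) I \<le> \<epsilon> * h"
    and D2: "\<And>s. s \<in> {0..t} \<Longrightarrow> L2_set (D s) I \<le> \<epsilon> * (t - s)"
begin

abbreviation "G \<equiv> mat_app I g"
abbreviation "Gt \<equiv> mat_app I (flip g)"

lemma dot_W:
  assumes "s \<in> {0..t}"
  shows "dot I (\<lambda>i. W s i - W t i) v = dot I (\<kappa> s) (G v) + dot I (D s) v"
proof -
  have "dot I (\<lambda>i. W s i - W t i) v = dot I (Gt (\<kappa> s)) v + dot I (D s) v"
    unfolding dot_def sum.distrib[symmetric] by (intro sum.cong) (auto simp: W[OF assms] algebra_simps)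
  then show ?thesis by (simp add: dot_mat_app)
qed

text \<open>The factor h of \<kappa> is paid for with one more application of G to the test vector;
  pairing through the transpose gives up h and saves that application.\<close>

lemma dot_\<kappa>:
  assumes "s \<in> {0..t}"
  shows "\<bar>dot I (\<kappa> s) (G v)\<bar> \<le> h * \<epsilon> * (t - s) * L2_set (G v) I"
    and "\<bar>dot I (\<kappa> s) (G v)\<bar> \<le> \<epsilon> * (t - s) * L2_set v I"
proof -
  show "\<bar>dot I (\<kappa> s) (G v)\<bar> \<le> h * \<epsilon> * (t - s) * L2_set (G v) I"
    by (rule order_trans[OF dot_le]) (intro mult_right_mono \<kappa> assms L2_set_nonneg)
  have "dot I (\<kappa> s) (G v) = dot I (Gt (\<kappa> s)) v"
    by (simp add: dot_mat_app)
  then show "\<bar>dot I (\<kappa> s) (G v)\<bar> \<le> \<epsilon> * (t - s) * L2_set v I"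
    using order_trans[OF dot_le mult_right_mono[OF G\<kappa>[OF assms] L2_set_nonneg]] by simp
qed

lemma dot_D:
  assumes "s \<in> {0..t}"
  shows "\<bar>dot I (D s) v\<bar> \<le> \<epsilon> * h * L2_set v I"
    and "\<bar>dot I (D s) v\<bar> \<le> \<epsilon> * (t - s) * L2_set v I"
  by (rule order_trans[OF dot_le], intro mult_right_mono D1 D2 assms L2_set_nonneg)+

text \<open>With \<tau> = t - s, three factors of smoothing against one factor \<tau> of the
  increment leave h \<tau>^(-1/2) for the \<kappa> part. The \<open>D\<close> part is min h \<tau>
  times \<tau>^(-1), where h alone is not integrable and \<tau> alone loses h; the geometric mean
  with exponent 3/4 is integrable and keeps more than half a power of h.\<close>

lemma error_bound:
  "L2_set (\<lambda>i. y t i - W t i) I \<le>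
    \<epsilon> * (h + 5 * h * t powr (1/2) + 4 * h powr (3/4) * t powr (1/4))"
proof (rule L2_set_le_if_dot_le)
  fix \<phi> :: "'i \<Rightarrow> real"
  obtain z where z0: "\<And>i. i \<in> I \<Longrightarrow> z 0 i = \<phi> i"
    and z: "\<And>s i. i \<in> I \<Longrightarrow>
      ((\<lambda>s. z s i) has_real_derivative - mat_app I (\<lambda>i i'. \<Sum>l\<in>I. g l i * g l i') (z s) i) (at s)"
    by (rule linear_flow_exists[OF fin, of \<phi> "\<lambda>i i'. \<Sum>l\<in>I. g l i * g l i'"]) blast
  have A: "mat_app I (\<lambda>i i'. \<Sum>l\<in>I. g l i * g l i') x i = Gt (G x) i" for x i
    unfolding mat_app_def flip_def sum_distrib_left sum_distrib_right
    by (subst sum.swap) (simp add: mult_ac)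
  note z = z[unfolded A]
  define n where "n = L2_set \<phi> I"
  have n: "L2_set (z 0) I = n"
    unfolding n_def by (rule L2_set_cong) (auto simp: z0)
  have n0: "n \<ge> 0" by (simp add: n_def)
  \<comment> \<open>A primitive of \<open>b\<close> that vanishes at s = t.\<close>
  define B where "B s = - (\<epsilon> * n * (4 * h * (t - s) powr (1/2) + 4 * h powr (3/4) * (t - s) powr (1/4)))" for s
  define b where "b s = \<epsilon> * n * (2 * h * (t - s) powr (-1/2) + h powr (3/4) * (t - s) powr (-3/4))" for s
  note smooth = flow_smoothing[OF z, unfolded n]
  have "\<bar>dot I (\<lambda>i. y t i - W t i) (z 0)\<bar> \<le> \<bar>dot I (\<lambda>i. W 0 i - W t i) (z t)\<bar> + (B t - B 0)"
  proof (rule duality_estimate[OF t y_cont y_deriv init z])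
    show "continuous_on {0..t} B"
      unfolding B_def by (intro continuous_intros continuous_on_powr') auto
    show "(B has_real_derivative b s) (at s)" if "s \<in> {0<..<t}" for s
      unfolding B_def b_def using that
      by (auto intro!: derivative_eq_intros simp: field_simps)
    show "\<bar>dot I (\<lambda>i. W s i - W t i) (Gt (G (z (t - s))))\<bar> \<le> b s" if s: "s \<in> {0<..<t}" for s
    proof -
      define \<tau> where "\<tau> = t - s"
      have \<tau>: "\<tau> > 0" using s by (simp add: \<tau>_def)
      have s': "s \<in> {0..t}" using s by auto
      define v where "v = Gt (G (z \<tau>))"
      have "\<bar>dot I (\<kappa> s) (G v)\<bar> \<le> h * \<epsilon> * \<tau> * (2 * \<tau> powr (-3/2) * n)"
        using order_trans[OF dot_\<kappa>(1)[OF s'] mult_left_mono[OF smooth(4)[OF _ \<tau>]]] \<tau> h \<epsilon>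
        by (simp add: v_def \<tau>_def)
      also have "\<dots> = \<epsilon> * n * (2 * h * \<tau> powr (-1/2))"
        using powr_mult_shift(1)[OF \<tau>, of "-3/2"] by (simp add: mult_ac)
      finally have 1: "\<bar>dot I (\<kappa> s) (G v)\<bar> \<le> \<epsilon> * n * (2 * h * \<tau> powr (-1/2))" .
      have v: "L2_set v I \<le> \<tau> powr (-1) * n"
        using smooth(3)[OF _ \<tau>] by (simp add: v_def)
      have "\<bar>dot I (D s) v\<bar> \<le> min h \<tau> * \<epsilon> * L2_set v I"
        using dot_D[OF s', of v] unfolding \<tau>_def by (auto simp: min_def mult_ac)
      also have "\<dots> \<le> (h powr (3/4) * \<tau> powr (1/4)) * \<epsilon> * (\<tau> powr (-1) * n)"
        using min_le_powr[of "min h \<tau>" h \<tau> "3/4"] h \<tau> \<epsilon> v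
        by (intro mult_mono) auto
      also have "\<dots> = \<epsilon> * n * (h powr (3/4) * \<tau> powr (-3/4))"
        using powr_add[of \<tau> "1/4" "-1"] by (simp add: mult_ac)
      finally have "\<bar>dot I (D s) v\<bar> \<le> \<epsilon> * n * (h powr (3/4) * \<tau> powr (-3/4))" .
      with 1 show ?thesis
        unfolding dot_W[OF s'] b_def \<tau>_def[symmetric] v_def[symmetric]
        by (simp add: distrib_left)
    qed
  qed auto
  moreover have "\<bar>dot I (\<lambda>i. W 0 i - W t i) (z t)\<bar> \<le> \<epsilon> * n * (h * t powr (1/2) + h)"
  proof -
    have "\<bar>dot I (\<kappa> 0) (G (z t))\<bar> \<le> h * \<epsilon> * t * (t powr (-1/2) * n)"
      using order_trans[OF dot_\<kappa>(1)[of 0] mult_left_mono[OF smooth(2)[OF _ t]]] t h \<epsilon> by simp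
    also have "\<dots> = \<epsilon> * n * (h * t powr (1/2))"
      using powr_mult_shift(1)[OF t, of "-1/2"] by (simp add: mult_ac)
    finally have 1: "\<bar>dot I (\<kappa> 0) (G (z t))\<bar> \<le> \<epsilon> * n * (h * t powr (1/2))" .
    have "\<bar>dot I (D 0) (z t)\<bar> \<le> \<epsilon> * n * h"
      using order_trans[OF dot_D(1)[of 0] mult_left_mono[OF smooth(1)[OF _ t]]] t h \<epsilon> by (simp add: mult_ac)
    with 1 show ?thesis using dot_W[of 0 "z t"] t by (simp add: distrib_left)
  qed
  moreover have "B t - B 0 = \<epsilon> * n * (4 * h * t powr (1/2) + 4 * h powr (3/4) * t powr (1/4))"
    by (simp add: B_def)
  ultimately have "\<bar>dot I (\<lambda>i. y t i - W t i) (z 0)\<bar> \<le>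
      \<epsilon> * n * (h * t powr (1/2) + h) + \<epsilon> * n * (4 * h * t powr (1/2) + 4 * h powr (3/4) * t powr (1/4))"
    by linarith
  moreover have "dot I (\<lambda>i. y t i - W t i) \<phi> = dot I (\<lambda>i. y t i - W t i) (z 0)"
    unfolding dot_def by (intro sum.cong) (auto simp: z0)
  ultimately show "dot I (\<lambda>i. y t i - W t i) \<phi> \<le>
      \<epsilon> * (h + 5 * h * t powr (1/2) + 4 * h powr (3/4) * t powr (1/4)) * L2_set \<phi> I"
    by (simp add: n_def[symmetric] algebra_simps)
qed (use fin \<epsilon> h in auto)

text \<open>Pairing G (y - W) with \<phi> means starting the dual flow from the transpose of G
  applied to \<phi>, which has no bounded norm. But this dual solution is the transpose of G applied
  to the flow x of G G^T started from \<phi>, so the smoothing estimates for x cover the additional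
  factor.\<close>

lemma flux_error_bound:
  "L2_set (G (\<lambda>i. y t i - W t i)) I \<le>
    \<epsilon> * (h + 15 * h powr (1/2) + 48 * h powr (3/4) * t powr (1/8))"
proof (rule L2_set_le_if_dot_le)
  fix \<phi> :: "'i \<Rightarrow> real"
  obtain x where x0: "\<And>i. i \<in> I \<Longrightarrow> x 0 i = \<phi> i"
    and x: "\<And>s i. i \<in> I \<Longrightarrow>
      ((\<lambda>s. x s i) has_real_derivative - mat_app I (\<lambda>i i'. \<Sum>l\<in>I. g i l * g i' l) (x s) i) (at s)"
    by (rule linear_flow_exists[OF fin, of \<phi> "\<lambda>i i'. \<Sum>l\<in>I. g i l * g i' l"]) blast
  have A: "mat_app I (\<lambda>i i'. \<Sum>l\<in>I. g i l * g i' l) v i = G (Gt v) i" for v i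
    unfolding mat_app_def flip_def sum_distrib_left sum_distrib_right
    by (subst sum.swap) (simp add: mult_ac)
  note x = x[unfolded A]
  define z where "z s = Gt (x s)" for s
  have z: "((\<lambda>s. z s i) has_real_derivative - Gt (G (z s)) i) (at s)" for s i
    using mat_app_has_derivative[where g = "flip g" and i = i, OF x]
    by (simp add: z_def mat_app_minus)
  define n where "n = L2_set \<phi> I"
  have n: "L2_set (x 0) I = n"
    unfolding n_def by (rule L2_set_cong) (auto simp: x0)
  have n0: "n \<ge> 0" by (simp add: n_def)
  have smooth: "L2_set (z s) I \<le> s powr (-1/2) * n"
    "L2_set (G (z s)) I \<le> s powr (-1) * n"
    "L2_set (Gt (G (z s))) I \<le> 2 * s powr (-3/2) * n"
    "L2_set (G (Gt (G (z s)))) I \<le> 6 * s powr (-2) * n" if "s > 0" for s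
    using flow_smoothing(2-5)[where g = "flip g" and z = x and I = I and s = s, unfolded flip_flip n] x that
    unfolding z_def by blast+
  \<comment> \<open>Up to scaling the arctangent is the primitive of \<tau>^(-1/2) h / (h + \<tau>).
    Its boundedness yields sqrt h without growth in t. A single power h^p \<tau>^(-1/2-p) would not
    do: it is integrable at 0 only for p < 1/2, which loses part of sqrt h.\<close>
  define B where "B s = - (\<epsilon> * n * (8 * h powr (1/2) * arctan (h powr (-1/2) * (t - s) powr (1/2))
      + 48 * h powr (3/4) * (t - s) powr (1/8)))" for s
  define b where "b s = \<epsilon> * n * (4 * (t - s) powr (-1/2) * (h / (h + (t - s)))
      + 6 * h powr (3/4) * (t - s) powr (-7/8))" for s
  have "\<bar>dot I (\<lambda>i. y t i - W t i) (z 0)\<bar> \<le> \<bar>dot I (\<lambda>i. W 0 i - W t i) (z t)\<bar> + (B t - B 0)"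
  proof (rule duality_estimate[where z = z and W = W and y = y and g = g and I = I and B = B and b = b and t = t])
    show "i \<in> I \<Longrightarrow> ((\<lambda>s. z s i) has_real_derivative - Gt (G (z s)) i) (at s)" for s i
      by (rule z)
    have cont: "continuous_on {0..t} (\<lambda>s. (t - s) powr p)" if "p > 0" for p
      using that by (intro continuous_on_powr' continuous_intros) auto
    have "continuous_on {0..t} (\<lambda>s. - (\<epsilon> * n * (8 * c1 * arctan (c2 * (t - s) powr (1/2))
        + 48 * c3 * (t - s) powr (1/8))))" for c1 c2 c3
      by (rule continuous_on_minus continuous_on_mult_left continuous_on_add continuous_on_arctan cont | simp)+
    then show "continuous_on {0..t} B"
      unfolding B_def .
    show "(B has_real_derivative b s) (at s)" if s: "s \<in> {0<..<t}" for s
    proof -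
      have sq: "(h powr (-1/2) * (t - s) powr (1/2))\<^sup>2 = (t - s) / h"
        using s h by (simp add: power_mult_distrib power2_eq_square powr_add[symmetric] powr_minus divide_simps)
      have hh: "h powr (1/2) * h powr (-1/2) = 1"
        using h by (simp add: powr_add[symmetric])
      have "((\<lambda>s. arctan (h powr (-1/2) * (t - s) powr (1/2))) has_real_derivative
          inverse (1 + (h powr (-1/2) * (t - s) powr (1/2))\<^sup>2) *
            (h powr (-1/2) * (- (1/2) * (t - s) powr (-1/2)))) (at s)"
        using s by (auto intro!: derivative_eq_intros)
      then have "((\<lambda>s. 8 * h powr (1/2) * arctan (h powr (-1/2) * (t - s) powr (1/2))) has_real_derivative
          8 * h powr (1/2) * (inverse (1 + (t - s) / h) *
            (h powr (-1/2) * (- (1/2) * (t - s) powr (-1/2))))) (at s)"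
        unfolding sq by (rule DERIV_cmult)
      also have "8 * h powr (1/2) * (inverse (1 + (t - s) / h) *
            (h powr (-1/2) * (- (1/2) * (t - s) powr (-1/2)))) =
          (h powr (1/2) * h powr (-1/2)) * (- 4 * (t - s) powr (-1/2) * inverse (1 + (t - s) / h))"
        by (simp add: mult_ac)
      also have "inverse (1 + (t - s) / h) = h / (h + (t - s))"
        using h s by (simp add: field_simps)
      finally have 1: "((\<lambda>s. 8 * h powr (1/2) * arctan (h powr (-1/2) * (t - s) powr (1/2))) has_real_derivative
          - (4 * (t - s) powr (-1/2) * (h / (h + (t - s))))) (at s)"
        unfolding hh by simp
      have 2: "((\<lambda>s. 48 * h powr (3/4) * (t - s) powr (1/8)) has_real_derivative
          - (6 * h powr (3/4) * (t - s) powr (-7/8))) (at s)"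
        using s by (auto intro!: derivative_eq_intros)
      show ?thesis
        unfolding B_def b_def
        by (rule DERIV_cong[OF DERIV_minus[OF DERIV_cmult[OF DERIV_add[OF 1 2]]]]) (simp add: algebra_simps)
    qed
    show "\<bar>dot I (\<lambda>i. W s i - W t i) (Gt (G (z (t - s))))\<bar> \<le> b s" if s: "s \<in> {0<..<t}" for s
    proof -
      define \<tau> where "\<tau> = t - s"
      have \<tau>: "\<tau> > 0" using s by (simp add: \<tau>_def)
      have s': "s \<in> {0..t}" using s by auto
      define v where "v = Gt (G (z \<tau>))"
      have v: "L2_set v I \<le> 2 * \<tau> powr (-3/2) * n"
        using smooth(3)[OF \<tau>] by (simp add: v_def)
      have Gv: "L2_set (G v) I \<le> 6 * \<tau> powr (-2) * n"
        using smooth(4)[OF \<tau>] by (simp add: v_def)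
      have "\<bar>dot I (\<kappa> s) (G v)\<bar> \<le> h * \<epsilon> * \<tau> * (6 * \<tau> powr (-2) * n)"
        using order_trans[OF dot_\<kappa>(1)[OF s'] mult_left_mono[OF Gv]] \<tau> h \<epsilon>
        by (simp add: \<tau>_def)
      also have "\<dots> = 6 * \<epsilon> * n * (h * (\<tau> * \<tau> powr (-2)))"
        by (simp only: mult_ac)
      also have "\<tau> * \<tau> powr (-2) = \<tau> powr (-1)"
        using powr_mult_shift(1)[OF \<tau>, of "-2"] by simp
      finally have 1: "\<bar>dot I (\<kappa> s) (G v)\<bar> \<le> 6 * \<epsilon> * n * (h * \<tau> powr (-1))" .
      have "\<bar>dot I (\<kappa> s) (G v)\<bar> \<le> \<epsilon> * \<tau> * (2 * \<tau> powr (-3/2) * n)"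
        using order_trans[OF dot_\<kappa>(2)[OF s'] mult_left_mono[OF v]] \<tau> h \<epsilon>
        by (simp add: \<tau>_def)
      also have "\<dots> = 2 * \<epsilon> * n * (\<tau> powr (-1/2))"
        using powr_mult_shift(1)[OF \<tau>, of "-3/2"] by (simp add: mult_ac)
      also have "\<dots> \<le> 6 * \<epsilon> * n * (\<tau> powr (-1/2))"
        using \<epsilon> n0 by (intro mult_right_mono) auto
      finally have 2: "\<bar>dot I (\<kappa> s) (G v)\<bar> \<le> 6 * \<epsilon> * n * \<tau> powr (-1/2)" .
      \<comment> \<open>The bound h \<tau>^(-1) is not integrable and \<tau>^(-1/2) carries no h;
        weights 3/4 and 1/4 give the integrable h^(3/4) \<tau>^(-7/8).\<close>
      have "\<bar>dot I (\<kappa> s) (G v)\<bar> \<le> 6 * \<epsilon> * n * min (h * \<tau> powr (-1)) (\<tau> powr (-1/2))"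
        using 1 2 by (auto simp: min_def)
      also have "\<dots> \<le> 6 * \<epsilon> * n * ((h * \<tau> powr (-1)) powr (3/4) * (\<tau> powr (-1/2)) powr (1 - 3/4))"
        using h \<tau> \<epsilon> n0 by (intro mult_left_mono min_le_powr) auto
      also have "(h * \<tau> powr (-1)) powr (3/4) * (\<tau> powr (-1/2)) powr (1 - 3/4) = h powr (3/4) * \<tau> powr (-7/8)"
      proof -
        have "(h * \<tau> powr (-1)) powr (3/4) = h powr (3/4) * \<tau> powr (-3/4)"
          using h \<tau> powr_powr[of \<tau> "-1" "3/4"] by (simp add: powr_mult powr_divide powr_minus_divide)
        moreover have "(\<tau> powr (-1/2)) powr (1 - 3/4) = \<tau> powr (-1/8)"
          by (simp add: powr_powr)
        moreover have "\<tau> powr (-3/4) * \<tau> powr (-1/8) = \<tau> powr (-7/8)"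
          using powr_add[of \<tau> "-3/4" "-1/8"] by simp
        ultimately show ?thesis by (simp only: mult.assoc)
      qed
      finally have 3: "\<bar>dot I (\<kappa> s) (G v)\<bar> \<le> \<epsilon> * n * (6 * h powr (3/4) * \<tau> powr (-7/8))"
        by (simp add: mult_ac)
      \<comment> \<open>The minimum is at most the harmonic mean, the majorant whose integral is the
        arctangent.\<close>
      have "min h \<tau> * (h + \<tau>) \<le> 2 * h * \<tau>"
      proof (cases "h \<le> \<tau>")
        case True
        then show ?thesis using h mult_left_mono[OF True, of h] by (simp add: algebra_simps)
      next
        case False
        then show ?thesis using \<tau> mult_left_mono[of \<tau> h \<tau>] by (simp add: algebra_simps)
      qed
      then have mn: "min h \<tau> \<le> 2 * h * \<tau> / (h + \<tau>)"
        using h \<tau> by (simp add: field_simps)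
      have "\<bar>dot I (D s) v\<bar> \<le> min h \<tau> * \<epsilon> * L2_set v I"
        using dot_D[OF s', of v] unfolding \<tau>_def by (auto simp: min_def mult_ac)
      also have "\<dots> \<le> (2 * h * \<tau> / (h + \<tau>)) * \<epsilon> * (2 * \<tau> powr (-3/2) * n)"
        using mn h \<tau> \<epsilon> v by (intro mult_mono) auto
      also have "\<dots> = \<epsilon> * n * (4 * (\<tau> * \<tau> powr (-3/2)) * (h / (h + \<tau>)))"
        by (simp add: mult_ac)
      also have "\<tau> * \<tau> powr (-3/2) = \<tau> powr (-1/2)"
        using powr_mult_shift(1)[OF \<tau>, of "-3/2"] by simp
      finally have "\<bar>dot I (D s) v\<bar> \<le> \<epsilon> * n * (4 * \<tau> powr (-1/2) * (h / (h + \<tau>)))" .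
      with 3 show ?thesis
        unfolding dot_W[OF s'] b_def \<tau>_def[symmetric] v_def[symmetric]
        by (simp add: distrib_left)
    qed
  qed (fact t y_cont y_deriv init)+
  moreover have "\<bar>dot I (\<lambda>i. W 0 i - W t i) (z t)\<bar> \<le> \<epsilon> * n * (h + h powr (1/2))"
  proof -
    have "\<bar>dot I (\<kappa> 0) (G (z t))\<bar> \<le> h * \<epsilon> * t * (t powr (-1) * n)"
      using order_trans[OF dot_\<kappa>(1)[of 0] mult_left_mono[OF smooth(2)[OF t]]] t h \<epsilon> by simp
    also have "\<dots> = \<epsilon> * n * h"
      using powr_mult_shift(1)[OF t, of "-1"] t by (simp add: mult_ac)
    finally have 1: "\<bar>dot I (\<kappa> 0) (G (z t))\<bar> \<le> \<epsilon> * n * h" .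
    have "\<bar>dot I (D 0) (z t)\<bar> \<le> min h t * \<epsilon> * L2_set (z t) I"
      using dot_D[of 0 "z t"] t by (auto simp: min_def mult_ac)
    also have "\<dots> \<le> (h powr (1/2) * t powr (1 - 1/2)) * \<epsilon> * (t powr (-1/2) * n)"
      using h t \<epsilon> smooth(1)[OF t] by (intro mult_mono min_le_powr) auto
    also have "\<dots> = \<epsilon> * n * h powr (1/2)"
      using powr_add[of t "1/2" "-1/2"] t by (simp add: mult_ac)
    finally have "\<bar>dot I (D 0) (z t)\<bar> \<le> \<epsilon> * n * h powr (1/2)" .
    with 1 show ?thesis using dot_W[of 0 "z t"] t by (simp add: distrib_left)
  qed
  moreover have "B t - B 0 \<le> \<epsilon> * n * (14 * h powr (1/2) + 48 * h powr (3/4) * t powr (1/8))"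
  proof -
    \<comment> \<open>The value 7/4 exceeds pi / 2; multiplied by 8 it gives the 14 of the
      claim.\<close>
    have "arctan (h powr (-1/2) * t powr (1/2)) \<le> 7/4"
      using arctan_ubound[of "h powr (-1/2) * t powr (1/2)"] pi_less_4 pi_approx by simp
    then have "8 * h powr (1/2) * arctan (h powr (-1/2) * t powr (1/2)) \<le> 8 * h powr (1/2) * (7/4)"
      by (intro mult_left_mono) auto
    then show ?thesis using \<epsilon> n0 unfolding B_def by (auto intro!: mult_left_mono)
  qed
  ultimately have "\<bar>dot I (\<lambda>i. y t i - W t i) (z 0)\<bar> \<le>
      \<epsilon> * n * (h + h powr (1/2)) + \<epsilon> * n * (14 * h powr (1/2) + 48 * h powr (3/4) * t powr (1/8))"
    by linarith
  moreover have "dot I (G (\<lambda>i. y t i - W t i)) \<phi> = dot I (\<lambda>i. y t i - W t i) (z 0)"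
  proof -
    have "dot I (G (\<lambda>i. y t i - W t i)) \<phi> = dot I (G (\<lambda>i. y t i - W t i)) (x 0)"
      unfolding dot_def by (intro sum.cong) (auto simp: x0)
    then show ?thesis by (simp add: dot_mat_app z_def)
  qed
  ultimately show "dot I (G (\<lambda>i. y t i - W t i)) \<phi> \<le>
      \<epsilon> * (h + 15 * h powr (1/2) + 48 * h powr (3/4) * t powr (1/8)) * L2_set \<phi> I"
    by (simp add: n_def[symmetric] algebra_simps)
qed (use fin \<epsilon> h in auto)

end

section \<open>Integrals of polynomials\<close>

lemma poly_has_integral:
  assumes "a \<le> (b::real)"
  shows "(poly (pderiv p) has_integral poly p b - poly p a) {a..b}"
  using assms by (intro fundamental_theorem_of_calculus)
    (auto simp: has_real_derivative_iff_has_vector_derivative[symmetric] intro!: DERIV_subset[OF poly_DERIV])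

lemma integral_pderiv:
  assumes "a \<le> (b::real)"
  shows "integral {a..b} (poly (pderiv p)) = poly p b - poly p a"
  using poly_has_integral[OF assms] by (rule integral_unique)

lemma poly_antiderivative:
  obtains r :: "real poly" where "pderiv r = p" "degree r \<le> Suc (degree p)"
proof
  define r where "r = (\<Sum>i\<le>degree p. monom (coeff p i / real (Suc i)) (Suc i))"
  have "pderiv r = (\<Sum>i\<le>degree p. monom (coeff p i) i)"
    unfolding r_def by (simp add: higher_pderiv_sum[of 1, simplified] pderiv_monom del: of_nat_Suc)
  then show "pderiv r = p" by (simp add: poly_as_sum_of_monoms)
  show "degree r \<le> Suc (degree p)"
    unfolding r_def by (intro degree_sum_le) (auto intro: order_trans[OF degree_monom_le])
qed

lemma poly_mult_integrable [intro]: "(\<lambda>x. poly p x * poly q x) integrable_on {a..b::real}"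
  by (intro integrable_continuous_interval continuous_intros)

lemma cont_mult_integrable:
  "continuous_on {a..b::real} v \<Longrightarrow> (\<lambda>x. v x * poly q x) integrable_on {a..b}"
  by (intro integrable_continuous_interval continuous_intros)

lemma integral_by_parts_poly:
  assumes "a \<le> (b::real)"
  shows "integral {a..b} (\<lambda>x. poly (pderiv p) x * poly q x) =
    poly p b * poly q b - poly p a * poly q a - integral {a..b} (\<lambda>x. poly p x * poly (pderiv q) x)"
proof -
  have "poly p b * poly q b - poly p a * poly q a = integral {a..b} (poly (pderiv (p * q)))"
    by (simp add: integral_pderiv[OF assms])
  also have "\<dots> = integral {a..b} (\<lambda>x. poly p x * poly (pderiv q) x + poly (pderiv p) x * poly q x)"
    by (intro integral_cong) (simp add: pderiv_mult mult.commute)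
  also have "\<dots> = integral {a..b} (\<lambda>x. poly p x * poly (pderiv q) x)
      + integral {a..b} (\<lambda>x. poly (pderiv p) x * poly q x)"
    by (intro integral_add) auto
  finally show ?thesis by simp
qed

section \<open>Legendre polynomials\<close>

text \<open>At the root every derivative has to hit the vanishing power. The free cofactor
  \<open>r\<close> absorbs the product rule in the induction.\<close>

lemma poly_funpow_pderiv_root:
  "poly ((pderiv ^^ n) ([:-a, 1:] ^ n * r)) a = fact n * poly r (a::real)"
proof (induction n arbitrary: r)
  case (Suc n)
  have "pderiv ([:-a, 1:] ^ Suc n * r) =
      [:-a, 1:] ^ n * (smult (real (Suc n)) r + [:-a, 1:] * pderiv r)"
    by (simp only: pderiv_mult pderiv_power_Suc)
       (simp add: pderiv_pCons algebra_simps smult_add_right)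
  then have "poly ((pderiv ^^ Suc n) ([:-a, 1:] ^ Suc n * r)) a =
      poly ((pderiv ^^ n) ([:-a, 1:] ^ n * (smult (real (Suc n)) r + [:-a, 1:] * pderiv r))) a"
    by (simp only: funpow_Suc_right o_apply)
  then show ?case by (simp only: Suc.IH) simp
qed simp

text \<open>Fewer than m derivatives leave a zero of order m in place; this removes the boundary
  terms when Rodrigues' formula is integrated by parts.\<close>

lemma funpow_pderiv_factor:
  assumes "i \<le> m"
  shows "\<exists>s. (pderiv ^^ i) ([:-a, 1:] ^ m * r) = [:-a, 1:] ^ (m - i) * (s :: real poly)"
  using assms
proof (induction i)
  case (Suc i)
  then obtain s where s: "(pderiv ^^ i) ([:-a, 1:] ^ m * r) = [:-a, 1:] ^ (m - i) * s" by auto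
  obtain n where n: "m - i = Suc n" using Suc.prems by (metis Suc_diff_Suc Suc_le_lessD)
  have "(pderiv ^^ Suc i) ([:-a, 1:] ^ m * r) =
      [:-a, 1:] ^ n * (smult (real (Suc n)) s + [:-a, 1:] * pderiv s)"
    unfolding funpow.simps o_apply s n
    by (simp only: pderiv_mult pderiv_power_Suc)
       (simp add: pderiv_pCons algebra_simps smult_add_right)
  moreover have "m - Suc i = n" using n by simp
  ultimately show ?case by auto
qed auto

text \<open>Two orders of the factors, because the preceding lemmas expect the power that vanishes
  at the point in front.\<close>

lemma rodrigues_factor:
  "[:-1, 0, 1:] ^ m = [:-1, 1:] ^ m * [:1, 1::real:] ^ m"
  "[:-1, 0, 1:] ^ m = [:1, 1:] ^ m * [:-1, 1::real:] ^ m"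
proof -
  have "[:-1, 0, 1::real:] = [:-1, 1:] * [:1, 1:]" by simp
  then show "[:-1, 0, 1:] ^ m = [:-1, 1:] ^ m * [:1, 1::real:] ^ m"
    by (simp only: power_mult_distrib)
  then show "[:-1, 0, 1:] ^ m = [:1, 1:] ^ m * [:-1, 1::real:] ^ m"
    by (simp only: mult.commute)
qed

lemma legendre_1 [simp]: "poly (legendre m) 1 = 1"
  unfolding legendre_def rodrigues_factor(1) by (simp add: poly_funpow_pderiv_root)

lemma legendre_minus_1 [simp]: "poly (legendre m) (- 1) = (- 1) ^ m"
proof -
  have "poly (legendre m) (- 1) = (- 2) ^ m / 2 ^ m"
    unfolding legendre_def rodrigues_factor(2)
    using poly_funpow_pderiv_root[of m "-1" "[:-1, 1:] ^ m"] by simp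
  then show ?thesis by (simp add: power_divide[symmetric])
qed

lemma degree_funpow_pderiv: "degree ((pderiv ^^ n) (p :: real poly)) = degree p - n"
  by (induction n) (auto simp: degree_pderiv)

lemma degree_legendre [simp]: "degree (legendre m) = m"
  unfolding legendre_def by (simp add: degree_funpow_pderiv degree_power_eq)

text \<open>Integration by parts n times: the boundary terms vanish by assumption and the n-th
  derivative of \<open>p\<close> is zero.\<close>

lemma integral_funpow_pderiv_eq_0:
  assumes "\<And>i. i < n \<Longrightarrow> poly ((pderiv ^^ i) q) a = 0" "\<And>i. i < n \<Longrightarrow> poly ((pderiv ^^ i) q) b = 0"
    and "degree p < n" "a \<le> (b::real)"
  shows "integral {a..b} (\<lambda>x. poly ((pderiv ^^ n) q) x * poly p x) = 0"
  using assms
proof (induction n arbitrary: p)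
  case (Suc n)
  have "integral {a..b} (\<lambda>x. poly ((pderiv ^^ n) q) x * poly (pderiv p) x) = 0"
  proof (cases "degree p = 0")
    case True
    then have "pderiv p = 0" by (simp add: pderiv_eq_0_iff)
    then show ?thesis by simp
  next
    case False
    then show ?thesis using Suc.prems by (intro Suc.IH) (auto simp: degree_pderiv)
  qed
  then show ?case
    using Suc.prems(1,2)[of n] by (simp add: integral_by_parts_poly[OF \<open>a \<le> b\<close>])
qed simp

lemma legendre_orthogonal:
  assumes "degree p < m"
  shows "integral {-1..1} (\<lambda>x. poly (legendre m) x * poly p x) = 0"
proof -
  have "poly ((pderiv ^^ i) ([:-1, 0, 1::real:] ^ m)) 1 = 0" if i: "i < m" for i
  proof -
    obtain s where s: "(pderiv ^^ i) ([:-1, 1::real:] ^ m * [:1, 1:] ^ m) = [:-1, 1:] ^ (m - i) * s"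
      using funpow_pderiv_factor[of i m 1 "[:1, 1:] ^ m"] i by auto
    have "poly ((pderiv ^^ i) ([:-1, 0, 1::real:] ^ m)) 1 = poly ([:-1, 1:] ^ (m - i) * s) 1"
      by (simp only: rodrigues_factor(1) s)
    then show ?thesis using i by simp
  qed
  moreover have "poly ((pderiv ^^ i) ([:-1, 0, 1::real:] ^ m)) (-1) = 0" if i: "i < m" for i
  proof -
    obtain s where s: "(pderiv ^^ i) ([:1, 1::real:] ^ m * [:-1, 1:] ^ m) = [:1, 1:] ^ (m - i) * s"
      using funpow_pderiv_factor[of i m "-1" "[:-1, 1:] ^ m"] i by auto
    have "poly ((pderiv ^^ i) ([:-1, 0, 1::real:] ^ m)) (-1) = poly ([:1, 1:] ^ (m - i) * s) (-1)"
      by (simp only: rodrigues_factor(2) s)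
    then show ?thesis using i by simp
  qed
  ultimately have "integral {-1..1} (\<lambda>x. poly ((pderiv ^^ m) ([:-1, 0, 1::real:] ^ m)) x * poly p x) = 0"
    using assms by (intro integral_funpow_pderiv_eq_0) auto
  then show ?thesis
    by (simp add: legendre_def mult.assoc)
qed

text \<open>Write S for the integral. The polynomial x L' - m L has degree below m, hence is
  orthogonal to L, and the integral of x L L' is m S. Integrating (x L^2)' then gives 2 = S + 2 m
  S.\<close>

lemma legendre_square_integral:
  "integral {-1..1} (\<lambda>x. poly (legendre m) x * poly (legendre m) x) = 2 / (2 * real m + 1)"
proof -
  define l where "l = legendre m"
  define S where "S = integral {-1..1} (\<lambda>x. poly l x * poly l x)"
  define r where "r = [:0, 1:] * pderiv l - smult (real m) l"
  have "integral {-1..1} (\<lambda>x. poly l x * poly r x) = 0"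
  proof (cases "m = 0")
    case True
    then have "pderiv l = 0" by (simp add: l_def pderiv_eq_0_iff)
    then show ?thesis using True by (simp add: r_def)
  next
    case False
    have "degree r < m"
    proof (rule degree_lessI)
      show "r \<noteq> 0 \<or> 0 < m" using False by simp
      show "\<forall>i\<ge>m. coeff r i = 0"
      proof (intro allI impI)
        fix i assume "m \<le> i"
        have "coeff r i = (real i - real m) * coeff l i"
          using False \<open>m \<le> i\<close> by (cases i) (auto simp: r_def coeff_pderiv algebra_simps coeff_pCons)
        also have "\<dots> = 0"
          using \<open>m \<le> i\<close> by (cases "i = m") (auto simp: l_def coeff_eq_0)
        finally show "coeff r i = 0" .
      qed
    qed
    then show ?thesis unfolding l_def by (rule legendre_orthogonal)
  qed
  then have *: "integral {-1..1} (\<lambda>x. poly l x * poly ([:0, 1:] * pderiv l) x) = real m * S"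
  proof -
    have "integral {-1..1} (\<lambda>x. poly l x * poly r x) =
        integral {-1..1} (\<lambda>x. poly l x * poly ([:0, 1:] * pderiv l) x - real m * (poly l x * poly l x))"
      by (intro integral_cong) (simp add: r_def algebra_simps)
    also have "\<dots> = integral {-1..1} (\<lambda>x. poly l x * poly ([:0, 1:] * pderiv l) x) - real m * S"
      unfolding S_def
      by (subst integral_diff) (auto intro!: integrable_continuous_interval continuous_intros)
    finally show ?thesis using \<open>integral {-1..1} (\<lambda>x. poly l x * poly r x) = 0\<close> by simp
  qed
  have "2 = integral {-1..1} (poly (pderiv ([:0, 1:] * (l * l))))"
    by (subst integral_pderiv) (simp_all add: l_def power_mult_distrib[symmetric])
  also have "\<dots> = integral {-1..1} (\<lambda>x. poly l x * poly l x + 2 * (poly l x * poly ([:0, 1:] * pderiv l) x))"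
    by (intro integral_cong) (simp add: pderiv_mult pderiv_pCons algebra_simps)
  also have "\<dots> = S + 2 * integral {-1..1} (\<lambda>x. poly l x * poly ([:0, 1:] * pderiv l) x)"
    unfolding S_def
    by (subst integral_add) (auto intro!: integrable_continuous_interval continuous_intros)
  also have "\<dots> = S + 2 * (real m * S)"
    by (simp only: *)
  finally have "S * (2 * real m + 1) = 2" by (simp add: algebra_simps)
  then have "S = 2 / (2 * real m + 1)" by (simp add: field_simps)
  then show ?thesis by (simp add: S_def l_def)
qed

text \<open>An explicit bound on [-1, 1] by the sum of coefficients; the leading 1 makes its powers
  increasing, so that different powers can be merged into the largest.\<close>

definition legendre_bound :: "nat \<Rightarrow> real" where
  "legendre_bound k = 1 + (\<Sum>m\<le>k. \<Sum>i\<le>m. \<bar>coeff (legendre m) i\<bar>)"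

lemma legendre_bound_ge_1: "legendre_bound k \<ge> 1"
  by (simp add: legendre_bound_def sum_nonneg)

lemma abs_legendre_le:
  assumes "m \<le> k" "\<bar>x\<bar> \<le> 1"
  shows "\<bar>poly (legendre m) x\<bar> \<le> legendre_bound k"
proof -
  have "\<bar>poly (legendre m) x\<bar> \<le> (\<Sum>i\<le>m. \<bar>coeff (legendre m) i * x ^ i\<bar>)"
    unfolding poly_altdef degree_legendre by (rule sum_abs)
  also have "\<dots> \<le> (\<Sum>i\<le>m. \<bar>coeff (legendre m) i\<bar>)"
    using assms(2)
    by (intro sum_mono) (auto simp: abs_mult power_abs intro!: mult_left_le power_le_one)
  also have "\<dots> \<le> (\<Sum>m\<le>k. \<Sum>i\<le>m. \<bar>coeff (legendre m) i\<bar>)"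
    using assms(1) by (intro member_le_sum[where f = "\<lambda>m. \<Sum>i\<le>m. \<bar>coeff (legendre m) i\<bar>"]) (auto intro: sum_nonneg)
  finally show ?thesis by (simp add: legendre_bound_def)
qed

lemma degree_smult_sum_le:
  "(\<And>m. m \<in> A \<Longrightarrow> degree (p m) \<le> n) \<Longrightarrow> degree (\<Sum>m\<in>A. smult (c m) (p m)) \<le> n"
  by (cases "finite A") (auto intro!: degree_sum_le order_trans[OF degree_smult_le])

text \<open>Mean zero gives the primitive equal values at both ends, so Rolle's theorem applies. The
  purpose is to show that the Radau sets are nonempty, so that a maximum over them is
  meaningful.\<close>

lemma poly_Rolle_interior:
  assumes "a < (b::real)" "integral {a..b} (poly p) = 0"
  shows "\<exists>x. a < x \<and> x < b \<and> poly p x = 0"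
proof -
  obtain r where r: "pderiv r = p" by (rule poly_antiderivative)
  have "poly r a = poly r b"
    using integral_pderiv[of a b r] assms by (simp add: r)
  then have "\<exists>z>a. z < b \<and> DERIV (poly r) z :> 0"
    using assms(1) by (intro Rolle) (auto intro!: continuous_intros poly_differentiable)
  then show ?thesis
    using DERIV_unique[OF poly_DERIV[of r]] r by metis
qed

text \<open>A sup norm bound of the Gauss-Radau projection and of its top coefficient, valid on
  every interval by scaling. Two of the four Legendre factors come from the orthogonal projection,
  two from the multiple of L k that is subtracted from it.\<close>

definition radau_bound :: "nat \<Rightarrow> real" where
  "radau_bound k = 4 * (1 + (real k + 1) * (2 * real k + 1)) * legendre_bound k ^ 4"

text \<open>
  Throughout, an endpoint \<open>e\<close> of the cell selects between the two Gauss-Radau projections.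
\<close>

locale interval =
  fixes a b :: real
  assumes ab: "a < b"
begin

definition L :: "nat \<Rightarrow> real poly" where
  "L m = pcompose (legendre m) [: - (a + b) / (b - a), 2 / (b - a) :]"

lemma affine_eq: "- (a + b) / (b - a) + x * (2 / (b - a)) = (x - (a + b) / 2) / ((b - a) / 2)"
proof -
  have *: "- s / d + x * (2 / d) = (x - s / 2) / (d / 2)" if "d \<noteq> 0" for s d :: real
    using that by (simp add: field_simps)
  show ?thesis by (rule *) (use ab in simp)
qed

lemma affine_endpoints:
  "(a - (a + b) / 2) / ((b - a) / 2) = - 1" "(b - (a + b) / 2) / ((b - a) / 2) = 1"
proof -
  have "a - (a + b) / 2 = - ((b - a) / 2)" "b - (a + b) / 2 = (b - a) / 2"
    by (simp_all add: field_simps)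
  then show "(a - (a + b) / 2) / ((b - a) / 2) = - 1" "(b - (a + b) / 2) / ((b - a) / 2) = 1"
    using ab by simp_all
qed

lemma poly_L: "poly (L m) x = poly (legendre m) ((x - (a + b) / 2) / ((b - a) / 2))"
  unfolding L_def poly_pcompose affine_eq[symmetric] by simp

lemma L_right [simp]: "poly (L m) b = 1"
  by (simp only: poly_L affine_endpoints legendre_1)

lemma L_left [simp]: "poly (L m) a = (- 1) ^ m"
  by (simp only: poly_L affine_endpoints legendre_minus_1)

lemma degree_L [simp]: "degree (L m) = m"
  using ab by (simp add: L_def degree_pcompose)

lemma L_neq_0 [simp]: "L m \<noteq> 0"
  using L_right[of m] by (metis poly_0 zero_neq_one)

lemma abs_L_le:
  assumes "m \<le> k" "x \<in> {a..b}"
  shows "\<bar>poly (L m) x\<bar> \<le> legendre_bound k"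
proof -
  have "\<bar>(x - (a + b) / 2) / ((b - a) / 2)\<bar> \<le> 1"
    using assms(2) ab by (auto simp: abs_le_iff field_simps)
  then show ?thesis unfolding poly_L by (rule abs_legendre_le[OF assms(1)])
qed

text \<open>The change of variables is carried out on a primitive polynomial, where it is the chain
  rule for \<open>pcompose\<close>.\<close>

lemma integral_affine:
  "integral {a..b} (poly (pcompose p [: - (a + b) / (b - a), 2 / (b - a) :])) =
    (b - a) / 2 * integral {-1..1} (poly p)"
proof -
  define l where "l = [: - (a + b) / (b - a), 2 / (b - a) :]"
  have "poly l x = - (a + b) / (b - a) + x * (2 / (b - a))" for x
    by (simp add: l_def)
  then have l: "poly l a = -1" "poly l b = 1"
    by (simp_all only: affine_eq affine_endpoints)
  obtain r where r: "pderiv r = p" by (rule poly_antiderivative)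
  have pl: "pderiv l = [:2 / (b - a):]" by (simp add: l_def pderiv_pCons)
  have inv: "d / 2 * (2 / d) = 1" if "d \<noteq> 0" for d :: real
    using that by simp
  have "pderiv (smult ((b - a) / 2) (pcompose r l)) = smult ((b - a) / 2 * (2 / (b - a))) (pcompose p l)"
    by (simp only: pderiv_smult pderiv_pcompose r pl mult_pCons_right smult_smult) simp
  also have "(b - a) / 2 * (2 / (b - a)) = 1"
    by (rule inv) (use ab in simp)
  finally have "pderiv (smult ((b - a) / 2) (pcompose r l)) = pcompose p l" by simp
  then have "integral {a..b} (poly (pcompose p l)) = (b - a) / 2 * (poly r 1 - poly r (-1))"
    using integral_pderiv[of a b "smult ((b - a) / 2) (pcompose r l)"] ab
    by (simp add: poly_pcompose l algebra_simps)
  also have "poly r 1 - poly r (-1) = integral {-1..1} (poly p)"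
    using integral_pderiv[of "-1" 1 r] by (simp add: r)
  finally show ?thesis by (simp add: l_def)
qed

lemma L_orthogonal:
  assumes "degree p < m"
  shows "integral {a..b} (\<lambda>x. poly (L m) x * poly p x) = 0"
proof -
  define l where "l = [: - (a + b) / (b - a), 2 / (b - a) :]"
  define p' where "p' = pcompose p [: (a + b) / 2, (b - a) / 2 :]"
  have "pcompose [: (a + b) / 2, (b - a) / 2 :] l = [:0, 1:]"
    using ab by (simp add: l_def pcompose_pCons field_simps)
  then have p: "p = pcompose p' l"
    unfolding p'_def by (simp add: pcompose_assoc[symmetric] pcompose_idR)
  have "degree p' < m"
    using assms degree_pcompose_le[of p "[: (a + b) / 2, (b - a) / 2 :]"] ab
    by (simp add: p'_def)
  then have "integral {-1..1} (poly (legendre m * p')) = 0"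
    using legendre_orthogonal[of p' m] by (simp add: poly_mult[abs_def])
  then have "integral {a..b} (poly (pcompose (legendre m * p') l)) = 0"
    unfolding l_def integral_affine by simp
  then show ?thesis
    by (subst p) (simp add: pcompose_mult L_def l_def poly_mult[abs_def])
qed

lemma L_orthogonal':
  "m \<noteq> n \<Longrightarrow> integral {a..b} (\<lambda>x. poly (L m) x * poly (L n) x) = 0"
  using L_orthogonal[of "L n" m] L_orthogonal[of "L m" n]
  by (cases "m < n") (auto simp: mult.commute)

lemma L_square_integral:
  "integral {a..b} (\<lambda>x. poly (L m) x * poly (L m) x) = (b - a) / (2 * real m + 1)"
proof -
  have "integral {a..b} (\<lambda>x. poly (L m) x * poly (L m) x) =
      integral {a..b} (poly (pcompose (legendre m * legendre m) [: - (a + b) / (b - a), 2 / (b - a) :]))"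
    by (simp add: L_def pcompose_mult poly_mult[abs_def])
  also have "\<dots> = (b - a) / 2 * (2 / (2 * real m + 1))"
    unfolding integral_affine by (simp add: poly_mult[abs_def] legendre_square_integral)
  also have "d / 2 * (2 / r) = d / r" for d r :: real by simp
  finally show ?thesis .
qed

definition lcoef :: "nat \<Rightarrow> (real \<Rightarrow> real) \<Rightarrow> real" where
  "lcoef m v = (2 * real m + 1) / (b - a) * integral {a..b} (\<lambda>x. v x * poly (L m) x)"

lemma integral_mult_L:
  "integral {a..b} (\<lambda>x. v x * poly (L m) x) = (b - a) / (2 * real m + 1) * lcoef m v"
proof -
  have "x = (d / r) * (r / d * x)" if "d \<noteq> 0" "r \<noteq> 0" for x d r :: real
    using that by simp
  moreover have "2 * real m + 1 \<noteq> 0" by linarith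
  ultimately show ?thesis using ab unfolding lcoef_def by simp
qed

lemma lcoef_sum_L:
  assumes "i \<le> k"
  shows "lcoef i (poly (\<Sum>m\<le>k. smult (c m) (L m))) = c i"
proof -
  have "integral {a..b} (\<lambda>x. poly (\<Sum>m\<le>k. smult (c m) (L m)) x * poly (L i) x) =
      integral {a..b} (\<lambda>x. \<Sum>m\<le>k. c m * (poly (L m) x * poly (L i) x))"
    by (simp add: poly_sum sum_distrib_right mult.assoc)
  also have "\<dots> = (\<Sum>m\<le>k. c m * integral {a..b} (\<lambda>x. poly (L m) x * poly (L i) x))"
    by (subst integral_sum) (auto intro!: integrable_continuous_interval continuous_intros)
  also have "\<dots> = (\<Sum>m\<le>k. if m = i then c i * ((b - a) / (2 * real i + 1)) else 0)"
    by (intro sum.cong) (auto simp: L_orthogonal' L_square_integral)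
  also have "\<dots> = c i * ((b - a) / (2 * real i + 1))"
    using assms by simp
  finally show ?thesis using ab by (simp add: lcoef_def)
qed

lemma L_span:
  assumes "degree p \<le> k"
  shows "\<exists>c. p = (\<Sum>m\<le>k. smult (c m) (L m))"
  using assms
proof (induction k arbitrary: p)
  case 0
  have "L 0 = 1"
  proof -
    obtain l where "L 0 = [:l:]" using degree_eq_zeroE[OF degree_L[of 0]] by auto
    then show ?thesis using L_right[of 0] by (simp add: one_pCons)
  qed
  moreover obtain d where "p = [:d:]" using 0 by (auto elim!: degree_eq_zeroE)
  ultimately show ?case by (auto intro!: exI[of _ "\<lambda>_. d"] simp: one_pCons)
next
  case (Suc k)
  define d where "d = coeff p (Suc k) / lead_coeff (L (Suc k))"
  have "lead_coeff (L (Suc k)) \<noteq> 0" by (simp del: degree_L)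
  then have "coeff (p - smult d (L (Suc k))) (Suc k) = 0"
    by (simp add: d_def)
  moreover have "degree (p - smult d (L (Suc k))) \<le> Suc k"
    using Suc.prems by (intro degree_diff_le) (auto intro: order_trans[OF degree_smult_le])
  ultimately have "degree (p - smult d (L (Suc k))) \<le> k"
    by (metis degree_le le_antisym le_Suc_eq coeff_eq_0 leading_coeff_0_iff not_less_eq_eq degree_0 le0)
  then obtain c where "p - smult d (L (Suc k)) = (\<Sum>m\<le>k. smult (c m) (L m))"
    using Suc.IH by blast
  then have "p = (\<Sum>m\<le>k. smult (c m) (L m)) + smult d (L (Suc k))"
    by (simp add: algebra_simps)
  also have "\<dots> = (\<Sum>m\<le>Suc k. smult ((c(Suc k := d)) m) (L m))"
    by simp
  finally show ?case by blast
qed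

definition legendre_proj :: "nat \<Rightarrow> (real \<Rightarrow> real) \<Rightarrow> real poly" where
  "legendre_proj k v = (\<Sum>m\<le>k. smult (lcoef m v) (L m))"

lemma legendre_proj_poly: "degree p \<le> k \<Longrightarrow> legendre_proj k (poly p) = p"
proof -
  assume "degree p \<le> k"
  then obtain c where c: "p = (\<Sum>m\<le>k. smult (c m) (L m))" using L_span by blast
  have "legendre_proj k (poly p) = (\<Sum>m\<le>k. smult (c m) (L m))"
    unfolding legendre_proj_def by (intro sum.cong refl) (simp add: c lcoef_sum_L)
  then show ?thesis using c by simp
qed

lemma degree_legendre_proj: "degree (legendre_proj k v) \<le> k"
  unfolding legendre_proj_def by (intro degree_smult_sum_le) auto

lemma integral_poly_expand:
  assumes "degree w \<le> k" "continuous_on {a..b} v"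
  shows "integral {a..b} (\<lambda>x. v x * poly w x) =
    (\<Sum>m\<le>k. (b - a) / (2 * real m + 1) * (lcoef m v * lcoef m (poly w)))"
proof -
  have "integral {a..b} (\<lambda>x. v x * poly w x) =
      integral {a..b} (\<lambda>x. \<Sum>m\<le>k. lcoef m (poly w) * (v x * poly (L m) x))"
    by (subst legendre_proj_poly[OF assms(1), symmetric])
       (simp add: legendre_proj_def poly_sum sum_distrib_left mult_ac)
  also have "\<dots> = (\<Sum>m\<le>k. lcoef m (poly w) * integral {a..b} (\<lambda>x. v x * poly (L m) x))"
    by (subst integral_sum) (auto intro!: integrable_continuous_interval continuous_intros assms)
  finally show ?thesis by (simp add: integral_mult_L mult_ac)
qed

lemma lcoef_diff:
  assumes "continuous_on {a..b} v" "continuous_on {a..b} w"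
  shows "lcoef m (\<lambda>x. v x - w x) = lcoef m v - lcoef m w"
proof -
  have "integral {a..b} (\<lambda>x. (v x - w x) * poly (L m) x) =
      integral {a..b} (\<lambda>x. v x * poly (L m) x - w x * poly (L m) x)"
    by (simp add: algebra_simps)
  also have "\<dots> = integral {a..b} (\<lambda>x. v x * poly (L m) x) - integral {a..b} (\<lambda>x. w x * poly (L m) x)"
    by (intro integral_diff cont_mult_integrable assms)
  finally show ?thesis by (simp add: lcoef_def right_diff_distrib)
qed

lemma abs_lcoef_le:
  assumes "continuous_on {a..b} v" "\<And>x. x \<in> {a..b} \<Longrightarrow> \<bar>v x\<bar> \<le> K" "m \<le> k"
  shows "\<bar>lcoef m v\<bar> \<le> (2 * real k + 1) * legendre_bound k * K"
proof -
  have K: "K \<ge> 0" using assms(2)[of a] ab by auto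
  have "norm (integral {a..b} (\<lambda>x. v x * poly (L m) x)) \<le> K * legendre_bound k * (b - a)"
    using ab assms legendre_bound_ge_1[of k] K
    by (intro integral_bound) (auto intro!: continuous_intros mult_mono abs_L_le simp: abs_mult)
  then have "\<bar>lcoef m v\<bar> \<le> (2 * real m + 1) / (b - a) * (K * legendre_bound k * (b - a))"
    using ab unfolding lcoef_def abs_mult by (intro mult_mono) auto
  also have "\<dots> = (2 * real m + 1) * (legendre_bound k * K)"
    using ab by simp
  also have "\<dots> \<le> (2 * real k + 1) * (legendre_bound k * K)"
    using assms(3) legendre_bound_ge_1[of k] K by (intro mult_right_mono) auto
  finally show ?thesis by (simp add: mult_ac)
qed

section \<open>Gauss-Radau projections\<close>

text \<open>Since L k is 1 or -1 at an end point, this is the multiple of L k to be subtracted from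
  the orthogonal projection in order to interpolate v at e. Depending on the end it is
  \<open>coef_bar\<close> or \<open>coef_tilde\<close>.\<close>

definition radau_coef :: "nat \<Rightarrow> real \<Rightarrow> (real \<Rightarrow> real) \<Rightarrow> real" where
  "radau_coef k e v = poly (L k) e * (poly (legendre_proj k v) e - v e)"

definition radau_proj :: "nat \<Rightarrow> real \<Rightarrow> (real \<Rightarrow> real) \<Rightarrow> real poly" where
  "radau_proj k e v = legendre_proj k v - smult (radau_coef k e v) (L k)"

lemma L_endpoint_sq: "e \<in> {a, b} \<Longrightarrow> poly (L m) e * poly (L m) e = 1"
  by (auto simp: power_mult_distrib[symmetric])

lemma degree_radau_proj: "degree (radau_proj k e v) \<le> k"
  unfolding radau_proj_def
  by (intro degree_diff_le degree_legendre_proj order_trans[OF degree_smult_le]) simp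

lemma radau_proj_endpoint:
  assumes "e \<in> {a, b}"
  shows "poly (radau_proj k e v) e = v e"
proof -
  have "poly (radau_proj k e v) e =
      poly (legendre_proj k v) e - (poly (L k) e * poly (L k) e) * (poly (legendre_proj k v) e - v e)"
    by (simp add: radau_proj_def radau_coef_def mult_ac)
  then show ?thesis by (simp only: L_endpoint_sq[OF assms]) simp
qed

text \<open>Against test polynomials of degree k rather than k - 1, the projection leaves a single
  residual, a multiple of L k. Removing this residual is the task of the correction
  functions.\<close>

lemma radau_proj_integral:
  assumes "continuous_on {a..b} v" "degree w \<le> k"
  shows "integral {a..b} (\<lambda>x. v x * poly w x) - integral {a..b} (\<lambda>x. poly (radau_proj k e v) x * poly w x)
    = radau_coef k e v * integral {a..b} (\<lambda>x. poly (L k) x * poly w x)"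
proof -
  have "integral {a..b} (\<lambda>x. poly (legendre_proj k v) x * poly w x) = integral {a..b} (\<lambda>x. v x * poly w x)"
    unfolding integral_poly_expand[OF assms(2) assms(1)]
    by (subst integral_poly_expand[OF assms(2)]) (auto intro!: continuous_intros sum.cong simp: legendre_proj_def lcoef_sum_L)
  moreover have "integral {a..b} (\<lambda>x. poly (radau_proj k e v) x * poly w x) =
      integral {a..b} (\<lambda>x. poly (legendre_proj k v) x * poly w x
        - radau_coef k e v * (poly (L k) x * poly w x))"
    by (simp add: radau_proj_def algebra_simps)
  moreover have "\<dots> = integral {a..b} (\<lambda>x. poly (legendre_proj k v) x * poly w x)
      - radau_coef k e v * integral {a..b} (\<lambda>x. poly (L k) x * poly w x)"
    by (subst integral_diff) (auto intro!: integrable_continuous_interval continuous_intros)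
  ultimately show ?thesis by simp
qed

lemma radau_proj_moments:
  assumes "continuous_on {a..b} v" "degree w < k"
  shows "integral {a..b} (\<lambda>x. poly (radau_proj k e v) x * poly w x) = integral {a..b} (\<lambda>x. v x * poly w x)"
  using radau_proj_integral[OF assms(1), of w k e] assms(2) L_orthogonal[of w k] by simp

lemma radau_proj_poly:
  assumes "degree p \<le> k"
  shows "radau_coef k e (poly p) = 0" "radau_proj k e (poly p) = p"
proof -
  show "radau_coef k e (poly p) = 0"
    by (simp add: radau_coef_def legendre_proj_poly[OF assms])
  then show "radau_proj k e (poly p) = p"
    by (simp add: radau_proj_def legendre_proj_poly[OF assms])
qed

text \<open>The moments fix all Legendre coefficients below k; as L k does not vanish at an end
  point, interpolation fixes the last one.\<close>

lemma radau_proj_unique: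
  assumes "continuous_on {a..b} v" "k \<ge> 1" "e \<in> {a, b}" "degree p \<le> k"
    and "\<And>w. degree w \<le> k - 1 \<Longrightarrow>
      integral {a..b} (\<lambda>x. poly p x * poly w x) = integral {a..b} (\<lambda>x. v x * poly w x)"
    and "poly p e = v e"
  shows "p = radau_proj k e v"
proof -
  define d where "d = p - radau_proj k e v"
  have deg: "degree d \<le> k"
    unfolding d_def by (intro degree_diff_le assms degree_radau_proj)
  have "lcoef m (poly d) = 0" if "m < k" for m
  proof -
    have "lcoef m (poly d) = lcoef m (poly p) - lcoef m (poly (radau_proj k e v))"
      unfolding d_def poly_diff[abs_def] by (intro lcoef_diff continuous_intros)
    then show ?thesis
      using that assms(5)[of "L m"] radau_proj_moments[OF assms(1), of "L m" k e]
      by (simp add: lcoef_def)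
  qed
  then have d: "d = smult (lcoef k (poly d)) (L k)"
    using legendre_proj_poly[OF deg] assms(2)
    by (cases k) (simp_all add: legendre_proj_def lessThan_Suc_atMost[symmetric])
  have "poly d e = 0"
    by (simp add: d_def radau_proj_endpoint[OF assms(3)] assms(6))
  moreover have "poly (L k) e \<noteq> 0"
    using L_endpoint_sq[OF assms(3), of k] by auto
  ultimately have "lcoef k (poly d) = 0"
    using d by (metis mult_eq_0_iff poly_smult)
  then have "d = 0" using d by simp
  then show ?thesis by (simp add: d_def)
qed

lemma abs_legendre_proj_le:
  assumes "continuous_on {a..b} v" "\<And>x. x \<in> {a..b} \<Longrightarrow> \<bar>v x\<bar> \<le> K" "x \<in> {a..b}"
  shows "\<bar>poly (legendre_proj k v) x\<bar> \<le> (real k + 1) * (2 * real k + 1) * (legendre_bound k)\<^sup>2 * K"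
proof -
  have K: "K \<ge> 0" using assms(2)[of a] ab by auto
  have "\<bar>poly (legendre_proj k v) x\<bar> \<le> (\<Sum>m\<le>k. \<bar>lcoef m v * poly (L m) x\<bar>)"
    unfolding legendre_proj_def by (simp add: poly_sum sum_abs)
  also have "\<dots> \<le> (\<Sum>m\<le>k. ((2 * real k + 1) * legendre_bound k * K) * legendre_bound k)"
    unfolding abs_mult using assms legendre_bound_ge_1[of k] K
    by (intro sum_mono mult_mono abs_lcoef_le abs_L_le) auto
  finally show ?thesis by (simp add: power2_eq_square mult_ac add_ac)
qed

lemma abs_radau_le:
  assumes v: "continuous_on {a..b} v" "\<And>x. x \<in> {a..b} \<Longrightarrow> \<bar>v x\<bar> \<le> K" and e: "e \<in> {a, b}"
  shows "\<bar>radau_coef k e v\<bar> \<le> radau_bound k * K"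
    and "x \<in> {a..b} \<Longrightarrow> \<bar>poly (radau_proj k e v) x\<bar> \<le> radau_bound k * K"
proof -
  have K: "K \<ge> 0" using v(2)[of a] ab by auto
  define B where "B = legendre_bound k"
  define A where "A = (real k + 1) * (2 * real k + 1)"
  have A: "A \<ge> 0" by (simp add: A_def)
  have B: "1 \<le> B" by (simp add: B_def legendre_bound_ge_1)
  have pw: "B ^ i \<le> B ^ 4" if "i \<le> 4" for i
    using B that by (rule power_increasing[rotated])
  have P: "\<bar>poly (legendre_proj k v) x\<bar> \<le> A * B\<^sup>2 * K" if "x \<in> {a..b}" for x
    using abs_legendre_proj_le[OF v that, of k] by (simp add: A_def B_def)
  have e': "e \<in> {a..b}" using e ab by auto
  have c: "\<bar>radau_coef k e v\<bar> \<le> B * (A * B\<^sup>2 * K + K)"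
    unfolding radau_coef_def abs_mult
    using abs_L_le[OF _ e', of k k] P[OF e'] v(2)[OF e'] B
    by (intro mult_mono) (auto simp: B_def)
  also have "\<dots> = A * B ^ 3 * K + B ^ 1 * K" by (simp add: algebra_simps eval_nat_numeral)
  also have "\<dots> \<le> A * B ^ 4 * K + B ^ 4 * K"
    using A K by (intro add_mono mult_right_mono mult_left_mono pw) auto
  also have "\<dots> \<le> 4 * (1 + A) * B ^ 4 * K"
    using A K B by (simp add: algebra_simps)
  finally show "\<bar>radau_coef k e v\<bar> \<le> radau_bound k * K"
    by (simp add: radau_bound_def A_def B_def)
  assume x: "x \<in> {a..b}"
  have "\<bar>poly (radau_proj k e v) x\<bar> \<le> \<bar>poly (legendre_proj k v) x\<bar> + \<bar>radau_coef k e v * poly (L k) x\<bar>"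
    by (simp add: radau_proj_def abs_triangle_ineq4)
  also have "\<dots> \<le> A * B\<^sup>2 * K + B * (A * B\<^sup>2 * K + K) * B"
    unfolding abs_mult using abs_L_le[OF _ x, of k k] c P[OF x] B A K
    by (intro add_mono mult_mono) (auto simp: B_def)
  also have "\<dots> = A * B ^ 2 * K + A * B ^ 4 * K + B ^ 2 * K" by (simp add: algebra_simps eval_nat_numeral)
  also have "\<dots> \<le> A * B ^ 4 * K + A * B ^ 4 * K + B ^ 4 * K"
    using A K by (intro add_mono mult_right_mono mult_left_mono pw) auto
  also have "\<dots> \<le> 4 * (1 + A) * B ^ 4 * K"
    using A K B by (simp add: algebra_simps)
  finally show "\<bar>poly (radau_proj k e v) x\<bar> \<le> radau_bound k * K"
    by (simp add: radau_bound_def A_def B_def)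
qed

lemma legendre_proj_diff:
  assumes "continuous_on {a..b} v" "continuous_on {a..b} w"
  shows "legendre_proj k (\<lambda>x. v x - w x) = legendre_proj k v - legendre_proj k w"
  by (simp add: legendre_proj_def lcoef_diff[OF assms] smult_diff_left sum_subtractf)

lemma radau_coef_diff:
  assumes "continuous_on {a..b} v" "continuous_on {a..b} w"
  shows "radau_coef k e (\<lambda>x. v x - w x) = radau_coef k e v - radau_coef k e w"
  by (simp add: radau_coef_def legendre_proj_diff[OF assms] algebra_simps)

lemma radau_proj_diff:
  assumes "continuous_on {a..b} v" "continuous_on {a..b} w"
  shows "radau_proj k e (\<lambda>x. v x - w x) = radau_proj k e v - radau_proj k e w"
  by (simp add: radau_proj_def legendre_proj_diff[OF assms] radau_coef_diff[OF assms] smult_diff_left)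

text \<open>The coefficient vanishes on polynomials of degree k, so only the distance of v from them
  counts.\<close>

lemma radau_coef_le_if_approx:
  assumes v: "continuous_on {a..b} v" and e: "e \<in> {a, b}"
    and p: "degree p \<le> k" "\<And>x. x \<in> {a..b} \<Longrightarrow> \<bar>v x - poly p x\<bar> \<le> K"
  shows "\<bar>radau_coef k e v\<bar> \<le> radau_bound k * K"
proof -
  have "radau_coef k e (\<lambda>x. v x - poly p x) = radau_coef k e v"
    using radau_coef_diff[OF v, of "poly p" k e] radau_proj_poly(1)[OF p(1)] by (simp add: continuous_intros)
  moreover have "\<bar>radau_coef k e (\<lambda>x. v x - poly p x)\<bar> \<le> radau_bound k * K"
    by (intro abs_radau_le continuous_intros v p e)
  ultimately show ?thesis by simp
qed

text \<open>
  For a polynomial of degree \<open>k + 1\<close> the projection error is a multiple of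
  \<open>L (k + 1) \<plusminus> L k\<close>, hence vanishes at the Radau points.
\<close>

lemma radau_superconvergence:
  assumes v: "continuous_on {a..b} v" and e: "e \<in> {a, b}"
    and p: "degree p \<le> k + 1" "\<And>x. x \<in> {a..b} \<Longrightarrow> \<bar>v x - poly p x\<bar> \<le> K"
    and x: "x \<in> {a..b}" "poly (L k) e * poly (L (k + 1)) x = poly (L (k + 1)) e * poly (L k) x"
  shows "\<bar>v x - poly (radau_proj k e v) x\<bar> \<le> (1 + radau_bound k) * K"
proof -
  define Q where "Q = p - radau_proj k e (poly p)"
  have Q: "degree Q \<le> k + 1"
    unfolding Q_def using degree_radau_proj[of k e "poly p"] by (intro degree_diff_le p) simp
  have lq: "lcoef m (poly Q) = 0" if "m < k" for m
  proof -
    have "lcoef m (poly Q) = lcoef m (poly p) - lcoef m (poly (radau_proj k e (poly p)))"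
      unfolding Q_def poly_diff[abs_def] by (intro lcoef_diff continuous_intros)
    then show ?thesis
      using that radau_proj_moments[of "poly p" "L m" k e] by (simp add: lcoef_def continuous_intros)
  qed
  define q1 q2 where "q1 = lcoef k (poly Q)" and "q2 = lcoef (k + 1) (poly Q)"
  have "Q = (\<Sum>m<k. smult (lcoef m (poly Q)) (L m)) + smult q1 (L k) + smult q2 (L (k + 1))"
    using legendre_proj_poly[OF Q]
    by (simp add: legendre_proj_def lessThan_Suc_atMost[symmetric] q1_def q2_def)
  also have "(\<Sum>m<k. smult (lcoef m (poly Q)) (L m)) = 0"
    by (intro sum.neutral) (simp add: lq)
  finally have Qe: "Q = smult q1 (L k) + smult q2 (L (k + 1))" by simp
  have "poly Q e = 0"
    by (simp add: Q_def radau_proj_endpoint[OF e])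
  then have 0: "q1 * poly (L k) e + q2 * poly (L (k + 1)) e = 0"
    unfolding Qe by simp
  have "poly (L k) e * poly Q x = q1 * poly (L k) e * poly (L k) x + q2 * (poly (L k) e * poly (L (k + 1)) x)"
    by (subst Qe) (simp add: algebra_simps)
  also have "\<dots> = (q1 * poly (L k) e + q2 * poly (L (k + 1)) e) * poly (L k) x"
    unfolding x(2) by (simp add: algebra_simps)
  finally have "poly (L k) e * poly Q x = 0" unfolding 0 by simp
  moreover have "poly (L k) e \<noteq> 0"
    using L_endpoint_sq[OF e, of k] by auto
  ultimately have "poly Q x = 0" by simp
  \<comment> \<open>The part of v that is not captured by \<open>p\<close> is handled by boundedness
    of the projection alone.\<close>
  moreover have "v x - poly (radau_proj k e v) x =
      poly Q x + (v x - poly p x) - poly (radau_proj k e (\<lambda>x. v x - poly p x)) x"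
    by (simp add: Q_def radau_proj_diff[OF v] continuous_intros)
  moreover have "\<bar>poly (radau_proj k e (\<lambda>x. v x - poly p x)) x\<bar> \<le> radau_bound k * K"
    by (intro abs_radau_le continuous_intros v p e x)
  moreover have "\<bar>v x - poly p x\<bar> \<le> K" by (rule p(2)[OF x(1)])
  ultimately show ?thesis by (simp add: distrib_right)
qed

text \<open>For positive k both L k and L (k + 1) have mean zero, and with them the combination
  whose roots are the Radau points.\<close>

lemma radau_point_exists:
  assumes "k \<ge> 1"
  shows "\<exists>x. a < x \<and> x < b \<and> poly (L k) e * poly (L (k + 1)) x = poly (L (k + 1)) e * poly (L k) x"
proof -
  define Q where "Q = smult (poly (L k) e) (L (k + 1)) - smult (poly (L (k + 1)) e) (L k)"
  have "integral {a..b} (poly (L m)) = 0" if "m \<ge> 1" for m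
    using L_orthogonal[of 1 m] that by simp
  then have "integral {a..b} (poly Q) = 0"
    using assms unfolding Q_def poly_diff[abs_def] poly_smult[abs_def]
    by (subst integral_diff) (auto intro!: integrable_continuous_interval continuous_intros)
  then show ?thesis
    using poly_Rolle_interior[OF ab, of Q] by (auto simp: Q_def)
qed

lemma finite_radau_points:
  assumes "e \<in> {a, b}"
  shows "finite {x. poly (L k) e * poly (L (k + 1)) x = poly (L (k + 1)) e * poly (L k) x}"
proof -
  define Q where "Q = smult (poly (L k) e) (L (k + 1)) - smult (poly (L (k + 1)) e) (L k)"
  have "poly (L k) e \<noteq> 0"
    using L_endpoint_sq[OF assms, of k] by auto
  then have "coeff Q (k + 1) \<noteq> 0"
    using leading_coeff_0_iff[of "L (k + 1)"] by (simp add: Q_def coeff_eq_0)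
  then have "Q \<noteq> 0" by auto
  then have "finite {x. poly Q x = 0}" by (rule poly_roots_finite)
  then show ?thesis by (simp add: Q_def)
qed

section \<open>The scaled antiderivative\<close>

definition Ds :: "(real \<Rightarrow> real) \<Rightarrow> real \<Rightarrow> real" where
  "Ds v x = 2 / (b - a) * integral {a..x} v"

lemma Ds_left [simp]: "Ds v a = 0"
  by (simp add: Ds_def)

lemma Ds_right: "integral {a..b} v = 0 \<Longrightarrow> Ds v b = 0"
  by (simp add: Ds_def)

lemma Ds_poly:
  obtains r where "pderiv r = smult (2 / (b - a)) p" "\<And>x. x \<in> {a..b} \<Longrightarrow> Ds (poly p) x = poly r x"
proof -
  obtain s where s: "pderiv s = p" by (rule poly_antiderivative)
  define r where "r = smult (2 / (b - a)) (s - [:poly s a:])"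
  have "pderiv r = smult (2 / (b - a)) p"
    by (simp add: r_def pderiv_smult pderiv_diff s)
  moreover have "Ds (poly p) x = poly r x" if "x \<in> {a..b}" for x
    using integral_pderiv[of a x s] that by (simp add: Ds_def r_def s)
  ultimately show ?thesis by (rule that)
qed

lemma continuous_on_Ds: "continuous_on {a..b} (Ds (poly p))"
proof -
  obtain r where r: "\<And>x. x \<in> {a..b} \<Longrightarrow> Ds (poly p) x = poly r x" by (metis Ds_poly)
  have "continuous_on {a..b} (poly r)" by (intro continuous_intros)
  then show ?thesis using continuous_on_cong[of "{a..b}" "{a..b}" "Ds (poly p)" "poly r"] r by blast
qed

lemma Ds_by_parts:
  assumes "integral {a..b} (poly p) = 0"
  shows "integral {a..b} (\<lambda>x. Ds (poly p) x * poly (pderiv w) x) =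
    - (2 / (b - a)) * integral {a..b} (\<lambda>x. poly p x * poly w x)"
proof -
  obtain r where r: "pderiv r = smult (2 / (b - a)) p" "\<And>x. x \<in> {a..b} \<Longrightarrow> Ds (poly p) x = poly r x"
    by (rule Ds_poly[of p]) blast
  have "integral {a..b} (\<lambda>x. Ds (poly p) x * poly (pderiv w) x) =
      integral {a..b} (\<lambda>x. poly r x * poly (pderiv w) x)"
    by (intro integral_cong) (simp add: r)
  also have "\<dots> = - integral {a..b} (\<lambda>x. poly (pderiv r) x * poly w x)"
    using integral_by_parts_poly[of a b r w] ab r(2)[of a] r(2)[of b] Ds_right[OF assms] by simp
  also have "\<dots> = - (2 / (b - a)) * integral {a..b} (\<lambda>x. poly p x * poly w x)"
    by (simp add: r(1) mult.assoc)
  finally show ?thesis .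
qed

lemma abs_Ds_le:
  assumes "\<And>x. x \<in> {a..b} \<Longrightarrow> \<bar>poly p x\<bar> \<le> K" "x \<in> {a..b}"
  shows "\<bar>Ds (poly p) x\<bar> \<le> 2 * K"
proof -
  have "norm (integral {a..x} (poly p)) \<le> K * (x - a)"
    using assms by (intro integral_bound) (auto intro!: continuous_intros)
  also have "\<dots> \<le> K * (b - a)"
    using assms(1)[of a] assms(2) ab by (intro mult_left_mono) auto
  finally show ?thesis
    using ab by (simp add: Ds_def abs_mult field_simps)
qed

text \<open>
  The step \<open>p \<mapsto> P D\<^sub>s\<^sup>-\<^sup>1 p\<close> that produces the correction functions; it acts as a left inverse, up to
  scaling, of the local weak derivative.
\<close>

definition lift :: "nat \<Rightarrow> real \<Rightarrow> real poly \<Rightarrow> real poly" where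
  "lift k e p = radau_proj k e (Ds (poly p))"

lemma degree_lift: "degree (lift k e p) \<le> k"
  by (simp add: lift_def degree_radau_proj)

text \<open>Mean zero makes the antiderivative vanish at both ends, so whichever end is
  interpolated, the correction adds nothing to the flux taken there.\<close>

lemma lift_endpoint:
  assumes "e \<in> {a, b}" "integral {a..b} (poly p) = 0"
  shows "poly (lift k e p) e = 0"
  using assms Ds_right[OF assms(2)] unfolding lift_def by (subst radau_proj_endpoint) auto

text \<open>The derivative of the test polynomial has degree below k, so the projection drops out of
  the integral; the remaining integration by parts has no boundary terms.\<close>

lemma lift_weak_derivative:
  assumes "integral {a..b} (poly p) = 0" "degree w \<le> k" "k \<ge> 1"
  shows "(b - a) / 2 * integral {a..b} (\<lambda>x. poly (lift k e p) x * poly (pderiv w) x) =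
    - integral {a..b} (\<lambda>x. poly p x * poly w x)"
proof -
  have "degree (pderiv w) < k" using assms by (simp add: degree_pderiv)
  then have "integral {a..b} (\<lambda>x. poly (lift k e p) x * poly (pderiv w) x) =
      - (2 / (b - a)) * integral {a..b} (\<lambda>x. poly p x * poly w x)"
    unfolding lift_def Ds_by_parts[OF assms(1), symmetric]
    by (intro radau_proj_moments continuous_on_Ds)
  then show ?thesis using ab by simp
qed

text \<open>Testing with w = x turns the mean of the lift into the first moment of L k, which is
  zero for k \<ge> 2. Hence the lift can be applied a second time.\<close>

lemma lift_mean_zero:
  assumes "integral {a..b} (poly (L k)) = 0" "k \<ge> 2"
  shows "integral {a..b} (poly (lift k e (L k))) = 0"
  using lift_weak_derivative[of "L k" "[:0, 1:]" k e] assms L_orthogonal[of "[:0, 1:]" k] ab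
  by (simp add: pderiv_pCons)

lemma integral_L_eq_0: "m \<ge> 1 \<Longrightarrow> integral {a..b} (poly (L m)) = 0"
  using L_orthogonal[of 1 m] by simp

lemma abs_lift_le:
  assumes "\<And>x. x \<in> {a..b} \<Longrightarrow> \<bar>poly p x\<bar> \<le> K" "x \<in> {a..b}" "e \<in> {a, b}"
  shows "\<bar>poly (lift k e p) x\<bar> \<le> radau_bound k * (2 * K)"
  unfolding lift_def using assms abs_Ds_le by (intro abs_radau_le continuous_on_Ds) auto

end

section \<open>Taylor polynomials\<close>

text \<open>A polynomial approximating the derivative is integrated; each order contributes one
  factor of the interval length.\<close>

lemma taylor_approx:
  fixes D :: "nat \<Rightarrow> real \<Rightarrow> real"
  assumes "a \<le> b"
    and "\<And>i x. i < n \<Longrightarrow> x \<in> {a..b} \<Longrightarrow> (D i has_real_derivative D (Suc i) x) (at x within {a..b})"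
    and "\<And>x. x \<in> {a..b} \<Longrightarrow> \<bar>D n x\<bar> \<le> K"
  shows "\<exists>p. degree p \<le> n - 1 \<and> (\<forall>x\<in>{a..b}. \<bar>D 0 x - poly p x\<bar> \<le> K * (b - a) ^ n)"
  using assms(2,3)
proof (induction n arbitrary: D)
  case 0
  then show ?case by (intro exI[of _ 0]) auto
next
  case (Suc n)
  have "\<exists>p. degree p \<le> n - 1 \<and> (\<forall>x\<in>{a..b}. \<bar>D (Suc 0) x - poly p x\<bar> \<le> K * (b - a) ^ n)"
    using Suc.prems by (intro Suc.IH[of "\<lambda>i. D (Suc i)"]) auto
  then obtain p where p: "degree p \<le> n - 1" "\<And>x. x \<in> {a..b} \<Longrightarrow> \<bar>D 1 x - poly p x\<bar> \<le> K * (b - a) ^ n"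
    by auto
  \<comment> \<open>The subtraction n - 1 is truncated: for n = 0 the induction hypothesis yields a
    constant, whose primitive would have degree 1 > n. The zero polynomial takes its place.\<close>
  obtain r where r: "pderiv r = (if n = 0 then 0 else p)" "degree r \<le> n"
  proof (cases "n = 0")
    case True
    then show ?thesis using that[of 0] by simp
  next
    case False
    then show ?thesis using that poly_antiderivative[of p] p(1)
      by (metis Suc_pred' le_trans not_gr_zero Suc_le_mono)
  qed
  have d: "\<bar>D 1 x - poly (pderiv r) x\<bar> \<le> K * (b - a) ^ n" if "x \<in> {a..b}" for x
    using p(2)[OF that] Suc.prems(2)[OF that] r(1) by (cases "n = 0") auto
  define q where "q = r + [:D 0 a - poly r a:]"
  have q: "pderiv q = pderiv r" by (simp add: q_def pderiv_add)
  have "degree q \<le> n" unfolding q_def by (intro degree_add_le r(2)) simp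
  moreover have "\<bar>D 0 x - poly q x\<bar> \<le> K * (b - a) ^ Suc n" if x: "x \<in> {a..b}" for x
  proof -
    have "norm ((D 0 x - poly q x) - (D 0 a - poly q a)) \<le> K * (b - a) ^ n * norm (x - a)"
    proof (rule field_differentiable_bound[of "{a..b}"])
      show "((\<lambda>x. D 0 x - poly q x) has_real_derivative D 1 z - poly (pderiv q) z) (at z within {a..b})"
        if "z \<in> {a..b}" for z
        using Suc.prems(1)[of 0 z] that
        by (auto intro!: derivative_eq_intros DERIV_subset[OF poly_DERIV])
      show "norm (D 1 z - poly (pderiv q) z) \<le> K * (b - a) ^ n" if "z \<in> {a..b}" for z
        using d[OF that] by (simp add: q)
    qed (use x assms(1) in auto)
    moreover have "D 0 a - poly q a = 0" by (simp add: q_def)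
    ultimately have "\<bar>D 0 x - poly q x\<bar> \<le> K * (b - a) ^ n * (x - a)" using x by simp
    also have "\<dots> \<le> K * (b - a) ^ n * (b - a)"
      using x d[OF x] by (intro mult_left_mono) auto
    finally show ?thesis by (simp add: mult_ac)
  qed
  ultimately show ?case by auto
qed

section \<open>Local corrections on a cell\<close>

context interval
begin

lemma cont_integral_diff:
  assumes "continuous_on {a..b} v" "continuous_on {a..b} v'"
  shows "integral {a..b} (\<lambda>x. (v x - v' x) * poly w x) =
    integral {a..b} (\<lambda>x. v x * poly w x) - integral {a..b} (\<lambda>x. v' x * poly w x)"
  unfolding left_diff_distrib using assms by (intro integral_diff cont_mult_integrable)

lemma poly_integral_diff:
  "integral {a..b} (\<lambda>x. poly (p - p') x * poly w x) =
    integral {a..b} (\<lambda>x. poly p x * poly w x) - integral {a..b} (\<lambda>x. poly p' x * poly w x)"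
  unfolding poly_diff by (intro cont_integral_diff continuous_intros)

lemma poly_integral_smult:
  "integral {a..b} (\<lambda>x. poly (smult c p) x * poly w x) = c * integral {a..b} (\<lambda>x. poly p x * poly w x)"
  by (simp add: mult.assoc)

lemma integral_by_parts_cont:
  assumes "\<And>x. x \<in> {a..b} \<Longrightarrow> (v has_real_derivative v' x) (at x within {a..b})" "continuous_on {a..b} v'"
  shows "integral {a..b} (\<lambda>x. v' x * poly w x) =
    v b * poly w b - v a * poly w a - integral {a..b} (\<lambda>x. v x * poly (pderiv w) x)"
proof -
  have cv: "continuous_on {a..b} v" using assms(1) by (rule DERIV_continuous_on)
  have "((\<lambda>x. v' x * poly w x + v x * poly (pderiv w) x) has_integral v b * poly w b - v a * poly w a) {a..b}"
  proof (rule fundamental_theorem_of_calculus)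
    fix x assume x: "x \<in> {a..b}"
    show "((\<lambda>x. v x * poly w x) has_vector_derivative v' x * poly w x + v x * poly (pderiv w) x) (at x within {a..b})"
      unfolding has_real_derivative_iff_has_vector_derivative[symmetric]
      using DERIV_mult[OF assms(1)[OF x] DERIV_subset[OF poly_DERIV[of w x]]] by (simp add: algebra_simps)
  qed (use ab in simp)
  then have "integral {a..b} (\<lambda>x. v' x * poly w x + v x * poly (pderiv w) x) = v b * poly w b - v a * poly w a"
    by (rule integral_unique)
  moreover have "integral {a..b} (\<lambda>x. v' x * poly w x + v x * poly (pderiv w) x) =
      integral {a..b} (\<lambda>x. v' x * poly w x) + integral {a..b} (\<lambda>x. v x * poly (pderiv w) x)"
    by (intro integral_add cont_mult_integrable assms(2) cv)
  ultimately show ?thesis by simp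
qed

lemma lift_scaled:
  assumes "integral {a..b} (poly p) = 0" "degree w \<le> k" "k \<ge> 1"
  shows "integral {a..b} (\<lambda>x. poly (smult ((b - a) / 2 * c) (lift k e p)) x * poly (pderiv w) x) =
    - integral {a..b} (\<lambda>x. poly (smult c p) x * poly w x)"
proof -
  have "integral {a..b} (\<lambda>x. poly (smult ((b - a) / 2 * c) (lift k e p)) x * poly (pderiv w) x) =
      c * ((b - a) / 2 * integral {a..b} (\<lambda>x. poly (lift k e p) x * poly (pderiv w) x))"
    by (subst poly_integral_smult) (simp only: mult_ac)
  then show ?thesis
    unfolding lift_weak_derivative[OF assms] by (simp only: poly_integral_smult mult_minus_right)
qed

text \<open>
  The correction identities of the paper on one cell: \<open>e\<close> is the interpolation point for \<open>u\<close> and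
  \<open>e'\<close> the one for \<open>q\<close>; \<open>U\<close>, \<open>Q\<close> are the discrete solutions. The corrections turn the
  projection residuals into exact discrete derivatives.
\<close>

lemma gradient_identity:
  fixes e e' d fa fb :: real and u q :: "real \<Rightarrow> real"
  assumes k: "k \<ge> 2" and w: "degree w \<le> k"
    and u: "\<And>x. x \<in> {a..b} \<Longrightarrow> (u has_real_derivative q x) (at x within {a..b})" and q: "continuous_on {a..b} q"
    and scheme: "integral {a..b} (\<lambda>x. poly Q x * poly w x) =
      - integral {a..b} (\<lambda>x. poly U x * poly (pderiv w) x) + fb * poly w b - fa * poly w a"
  defines "\<eta> \<equiv> radau_proj k e' q - smult ((b - a) / 2 * d) (lift k e' (L k)) - Q"
    and "\<xi> \<equiv> radau_proj k e u - smult ((b - a) / 2 * ((b - a) / 2 * d)) (lift k e (lift k e' (L k)))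
      - smult ((b - a) / 2 * radau_coef k e' q) (lift k e (L k)) - U"
  shows "integral {a..b} (\<lambda>x. poly \<eta> x * poly w x) =
    - integral {a..b} (\<lambda>x. poly \<xi> x * poly (pderiv w) x) + (u b - fb) * poly w b - (u a - fa) * poly w a"
proof -
  have k1: "k \<ge> 1" using k by simp
  have Lk: "integral {a..b} (poly (L k)) = 0" by (rule integral_L_eq_0[OF k1])
  have uc: "continuous_on {a..b} u" using u by (rule DERIV_continuous_on)
  have w': "degree (pderiv w) < k" using w k by (simp add: degree_pderiv)
  have 1: "integral {a..b} (\<lambda>x. q x * poly w x) =
      u b * poly w b - u a * poly w a - integral {a..b} (\<lambda>x. u x * poly (pderiv w) x)"
    by (rule integral_by_parts_cont[OF u q])
  have 2: "integral {a..b} (\<lambda>x. q x * poly w x) - integral {a..b} (\<lambda>x. poly (radau_proj k e' q) x * poly w x) =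
      radau_coef k e' q * integral {a..b} (\<lambda>x. poly (L k) x * poly w x)"
    by (rule radau_proj_integral[OF q w])
  have 3: "integral {a..b} (\<lambda>x. poly (radau_proj k e u) x * poly (pderiv w) x) =
      integral {a..b} (\<lambda>x. u x * poly (pderiv w) x)"
    by (rule radau_proj_moments[OF uc w'])
  note 4 = lift_scaled[OF Lk w k1, of "radau_coef k e' q" e]
  note 5 = lift_scaled[OF lift_mean_zero[OF Lk k] w k1, of "(b - a) / 2 * d" e e']
  show ?thesis
    unfolding \<eta>_def \<xi>_def poly_integral_diff 4 5 3 scheme
    using 1 2 by (simp only: poly_integral_smult) (simp add: algebra_simps)
qed

text \<open>The multiple of the lift in the correction of q is forced here: it cancels the residual
  of the projection of \<open>r\<close>, which will be u_t. The gradient identity holds for every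
  such multiple \<open>d\<close>, so both hold together once \<open>d\<close> has this
  value.\<close>

lemma divergence_identity:
  fixes e e' fa fb :: real and q r :: "real \<Rightarrow> real"
  assumes k: "k \<ge> 2" and w: "degree w \<le> k"
    and q: "\<And>x. x \<in> {a..b} \<Longrightarrow> (q has_real_derivative r x) (at x within {a..b})" and r: "continuous_on {a..b} r"
    and scheme: "integral {a..b} (\<lambda>x. poly U' x * poly w x) =
      - integral {a..b} (\<lambda>x. poly Q x * poly (pderiv w) x) + fb * poly w b - fa * poly w a"
  defines "\<eta> \<equiv> radau_proj k e' q - smult ((b - a) / 2 * radau_coef k e r) (lift k e' (L k)) - Q"
  shows "integral {a..b} (\<lambda>x. poly (radau_proj k e r - U') x * poly w x) =
    - integral {a..b} (\<lambda>x. poly \<eta> x * poly (pderiv w) x) + (q b - fb) * poly w b - (q a - fa) * poly w a"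
proof -
  have k1: "k \<ge> 1" using k by simp
  have Lk: "integral {a..b} (poly (L k)) = 0" by (rule integral_L_eq_0[OF k1])
  have qc: "continuous_on {a..b} q" using q by (rule DERIV_continuous_on)
  have w': "degree (pderiv w) < k" using w k by (simp add: degree_pderiv)
  have 1: "integral {a..b} (\<lambda>x. r x * poly w x) =
      q b * poly w b - q a * poly w a - integral {a..b} (\<lambda>x. q x * poly (pderiv w) x)"
    by (rule integral_by_parts_cont[OF q r])
  have 2: "integral {a..b} (\<lambda>x. r x * poly w x) - integral {a..b} (\<lambda>x. poly (radau_proj k e r) x * poly w x) =
      radau_coef k e r * integral {a..b} (\<lambda>x. poly (L k) x * poly w x)"
    by (rule radau_proj_integral[OF r w])
  have 3: "integral {a..b} (\<lambda>x. poly (radau_proj k e' q) x * poly (pderiv w) x) =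
      integral {a..b} (\<lambda>x. q x * poly (pderiv w) x)"
    by (rule radau_proj_moments[OF qc w'])
  note 4 = lift_scaled[OF Lk w k1, of "radau_coef k e r" e']
  show ?thesis
    unfolding \<eta>_def poly_integral_diff 4 3 scheme
    using 1 2 by (simp only: poly_integral_smult) (simp add: algebra_simps)
qed

lemma radau_coef_taylor:
  fixes D :: "nat \<Rightarrow> real \<Rightarrow> real"
  assumes e: "e \<in> {a, b}" and n: "n \<le> k + 1"
    and D: "\<And>i x. i < n \<Longrightarrow> x \<in> {a..b} \<Longrightarrow> (D i has_real_derivative D (Suc i) x) (at x within {a..b})"
    and cont: "continuous_on {a..b} (D 0)"
    and le: "\<And>x. x \<in> {a..b} \<Longrightarrow> \<bar>D n x\<bar> \<le> K"
  shows "\<bar>radau_coef k e (D 0)\<bar> \<le> radau_bound k * (K * (b - a) ^ n)"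
proof -
  obtain p where p: "degree p \<le> n - 1" "\<forall>x\<in>{a..b}. \<bar>D 0 x - poly p x\<bar> \<le> K * (b - a) ^ n"
    using taylor_approx[of a b n D K] D le ab by auto
  then show ?thesis
    using n by (intro radau_coef_le_if_approx[OF cont e, of p]) auto
qed

lemma radau_superconvergence_taylor:
  fixes D :: "nat \<Rightarrow> real \<Rightarrow> real"
  assumes e: "e \<in> {a, b}"
    and D: "\<And>i x. i < k + 2 \<Longrightarrow> x \<in> {a..b} \<Longrightarrow> (D i has_real_derivative D (Suc i) x) (at x within {a..b})"
    and le: "\<And>x. x \<in> {a..b} \<Longrightarrow> \<bar>D (k + 2) x\<bar> \<le> K"
    and x: "x \<in> {a..b}" "poly (L k) e * poly (L (k + 1)) x = poly (L (k + 1)) e * poly (L k) x"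
  shows "\<bar>D 0 x - poly (radau_proj k e (D 0)) x\<bar> \<le> (1 + radau_bound k) * (K * (b - a) ^ (k + 2))"
proof -
  obtain p where p: "degree p \<le> k + 2 - 1" "\<forall>x\<in>{a..b}. \<bar>D 0 x - poly p x\<bar> \<le> K * (b - a) ^ (k + 2)"
    using taylor_approx[of a b "k + 2" D K] D le ab by auto
  moreover have "continuous_on {a..b} (D 0)" by (rule DERIV_continuous_on[OF D[of 0]]) auto
  ultimately show ?thesis
    by (intro radau_superconvergence[OF _ e, of _ p] x) auto
qed

end

section \<open>Meshes and numerical fluxes\<close>

locale mesh =
  fixes N :: nat and X :: "nat \<Rightarrow> real" and c :: real
  assumes mesh: "quasi_uniform_mesh c N X"
begin

definition h :: real where "h = mesh_size N X"

lemma N_ge_1: "N \<ge> 1" and X_0: "X 0 = 0" and X_N: "X N = 2 * pi"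
  and X_step: "\<And>j. j \<in> {1..N} \<Longrightarrow> X (j - 1) < X j"
  and h_le: "\<And>j. j \<in> {1..N} \<Longrightarrow> h \<le> c * cell_len X j"
  using mesh by (auto simp: quasi_uniform_mesh_def h_def)

lemma interval_cell: "j \<in> {1..N} \<Longrightarrow> interval (X (j - 1)) (X j)"
  by (rule interval.intro) (rule X_step)

lemma cell_len_le: "j \<in> {1..N} \<Longrightarrow> cell_len X j \<le> h"
  unfolding h_def mesh_size_def by (intro Max_ge) auto

lemma cell_len_pos: "j \<in> {1..N} \<Longrightarrow> cell_len X j > 0"
  using X_step by (simp add: cell_len_def)

lemma h_pos: "h > 0"
  using cell_len_le[of 1] cell_len_pos[of 1] N_ge_1 by simp

lemma c_pos: "c > 0"
proof -
  have 1: "1 \<in> {1..N}" using N_ge_1 by simp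
  have "0 < c * cell_len X 1" using h_le[OF 1] h_pos by linarith
  then show ?thesis using cell_len_pos[OF 1] by (simp add: zero_less_mult_iff)
qed

lemma X_mono: "i \<le> j \<Longrightarrow> j \<le> N \<Longrightarrow> X i \<le> X j"
proof (induction j)
  case (Suc j)
  then show ?case using X_step[of "Suc j"] by (cases "i = Suc j") auto
qed simp

lemma X_in: "i \<le> N \<Longrightarrow> X i \<in> \<Omega>"
  using X_mono[of 0 i] X_mono[of i N] X_0 X_N by simp

lemma cell_subset: "j \<in> {1..N} \<Longrightarrow> {X (j - 1)..X j} \<subseteq> \<Omega>"
  using X_in[of j] X_in[of "j - 1"] by auto

lemma sum_telescope: "(\<Sum>j=1..n::nat. f j - f (j - 1)) = f n - (f 0 :: real)"
  by (induction n) auto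

lemma sum_cell_len: "(\<Sum>j=1..N. cell_len X j) = 2 * pi"
  unfolding cell_len_def sum_telescope by (simp add: X_0 X_N)

lemma h_le_2pi: "h \<le> 2 * pi"
proof -
  have "h \<in> cell_len X ` {1..N}"
    unfolding h_def mesh_size_def using N_ge_1 by (intro Max_in) auto
  then obtain j where j: "j \<in> {1..N}" "h = cell_len X j" by auto
  moreover have "j \<le> N" "j - 1 \<le> N" using j(1) by auto
  ultimately show ?thesis using X_in[of j] X_in[of "j - 1"] by (auto simp: cell_len_def)
qed

end

text \<open>
  Both fluxes are handled at once: the Boolean is true for the limit from the left, which is used
  for \<open>u\<close> in the first flux choice and for \<open>q\<close> in the second.
\<close>

definition endpt :: "bool \<Rightarrow> (nat \<Rightarrow> real) \<Rightarrow> nat \<Rightarrow> real" where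
  "endpt b X j = (if b then X j else X (j - 1))"

definition node_trace :: "bool \<Rightarrow> boundary_data \<Rightarrow> nat \<Rightarrow> (nat \<Rightarrow> real) \<Rightarrow> real \<Rightarrow> (nat \<Rightarrow> real poly) \<Rightarrow> nat \<Rightarrow> real" where
  "node_trace b bd N X t v = (if b then trace_minus X (outer_left bd N X t v) v
     else trace_plus N X (outer_right bd N X t v) v)"

lemma flux_u_trace: "flux_u fl bd N X t v = node_trace (fl = FluxI) bd N X t v"
  by (cases fl) (simp_all add: node_trace_def)

lemma flux_q_trace: "flux_q fl bd N X t v = node_trace (fl \<noteq> FluxI) bd N X t v"
  by (cases fl) (simp_all add: node_trace_def)

fun homogeneous :: "boundary_data \<Rightarrow> boundary_data" where
  "homogeneous Periodic = Periodic"
| "homogeneous (Mixed g0 g1) = Mixed (\<lambda>_. 0) (\<lambda>_. 0)"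

fun consistent :: "bool \<Rightarrow> boundary_data \<Rightarrow> real \<Rightarrow> (real \<Rightarrow> real) \<Rightarrow> bool" where
  "consistent b Periodic t w \<longleftrightarrow> w 0 = w (2 * pi)"
| "consistent b (Mixed g0 g1) t w \<longleftrightarrow> (if b then w 0 = g0 t else w (2 * pi) = g1 t)"

lemma boundary_condition_consistent:
  assumes "boundary_condition fl bd T u q" "t \<in> {0..T}"
  shows "consistent (fl = FluxI) bd t (\<lambda>x. u x t)" "consistent (fl \<noteq> FluxI) bd t (\<lambda>x. q x t)"
  using assms by (cases fl; cases bd; simp)+

context mesh
begin

abbreviation cell_integral :: "nat \<Rightarrow> real poly \<Rightarrow> real poly \<Rightarrow> real" where
  "cell_integral j p w \<equiv> integral {X (j - 1)..X j} (\<lambda>x. poly p x * poly w x)"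

text \<open>Exact solution and scheme share the boundary data, which cancel in the difference and
  leave homogeneous ones. Interpolation at the end from which the flux is taken identifies the value
  of w at a node with the trace of \<open>p\<close>.\<close>

lemma trace_error:
  assumes "consistent b bd t w" "\<And>j. j \<in> {1..N} \<Longrightarrow> poly (p j) (endpt b X j) = w (endpt b X j)" "i \<le> N"
  shows "w (X i) - node_trace b bd N X t v i = node_trace b (homogeneous bd) N X 0 (\<lambda>j. p j - v j) i"
proof -
  have 1: "poly (p j) (X j) = w (X j)" if "b" "j \<in> {1..N}" for j using assms(2)[of j] that by (simp add: endpt_def)
  have 2: "poly (p (Suc j)) (X j) = w (X j)" if "\<not> b" "j < N" for j
    using assms(2)[of "Suc j"] that by (simp add: endpt_def)
  show ?thesis
    using assms(1,3) 1[of i] 1[of N] 2[of i] 2[of 0] N_ge_1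
    by (cases bd; cases b; cases "i = 0"; cases "i = N") (auto simp: node_trace_def trace_minus_def trace_plus_def X_0 X_N)
qed

text \<open>The discrete derivative on one cell, tested with \<open>w\<close>, for homogeneous
  boundary data. For one value of the Boolean it is the matrix G, for the other minus the transpose
  of that matrix.\<close>

definition form :: "bool \<Rightarrow> boundary_data \<Rightarrow> nat \<Rightarrow> (nat \<Rightarrow> real poly) \<Rightarrow> real poly \<Rightarrow> real" where
  "form b bd j v w = - cell_integral j (v j) (pderiv w)
     + node_trace b (homogeneous bd) N X 0 v j * poly w (X j)
     - node_trace b (homogeneous bd) N X 0 v (j - 1) * poly w (X (j - 1))"

text \<open>Integration by parts on every cell leaves a telescoping sum of products of a left and a
  right trace. The terms at 0 and 2 pi cancel by periodicity or vanish with the homogeneous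
  data.\<close>

lemma form_antisymmetric_aux:
  "(\<Sum>j=1..N. form True bd j v (w j)) = - (\<Sum>j=1..N. form False bd j w (v j))"
proof -
  define tv where "tv = node_trace True (homogeneous bd) N X 0 v"
  define tw where "tw = node_trace False (homogeneous bd) N X 0 w"
  have tv: "tv j = poly (v j) (X j)" if "j \<in> {1..N}" for j
    using that by (simp add: tv_def node_trace_def trace_minus_def)
  have tw: "tw (j - 1) = poly (w j) (X (j - 1))" if "j \<in> {1..N}" for j
    using that by (auto simp: tw_def node_trace_def trace_plus_def)
  have "form True bd j v (w j) + form False bd j w (v j) = tw j * tv j - tw (j - 1) * tv (j - 1)"
    if j: "j \<in> {1..N}" for j
  proof -
    have le: "X (j - 1) \<le> X j" using X_step[OF j] by simp
    have "cell_integral j (pderiv (v j)) (w j) =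
        poly (v j) (X j) * poly (w j) (X j) - poly (v j) (X (j - 1)) * poly (w j) (X (j - 1))
        - cell_integral j (v j) (pderiv (w j))"
      by (rule integral_by_parts_poly[OF le])
    moreover have "cell_integral j (pderiv (v j)) (w j) = cell_integral j (w j) (pderiv (v j))"
      by (simp add: mult.commute)
    ultimately show ?thesis
      unfolding form_def tv_def[symmetric] tw_def[symmetric] tw[OF j] tv[OF j] by (simp add: algebra_simps)
  qed
  then have "(\<Sum>j=1..N. form True bd j v (w j)) + (\<Sum>j=1..N. form False bd j w (v j)) =
      (\<Sum>j=1..N. tw j * tv j - tw (j - 1) * tv (j - 1))"
    by (simp add: sum.distrib[symmetric])
  also have "\<dots> = tw N * tv N - tw 0 * tv 0"
    by (rule sum_telescope)
  also have "\<dots> = 0"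
    using N_ge_1 by (cases bd) (auto simp: tv_def tw_def node_trace_def trace_minus_def trace_plus_def)
  finally show ?thesis by simp
qed

lemma form_antisymmetric:
  "(\<Sum>j=1..N. form b bd j v (w j)) = - (\<Sum>j=1..N. form (\<not> b) bd j w (v j))"
  using form_antisymmetric_aux[of bd v w] form_antisymmetric_aux[of bd w v] by (cases b) auto

text \<open>Applied to corrections, all of which vanish at the flux points: their discrete
  derivative is purely local.\<close>

lemma form_zero_trace:
  assumes "\<And>j. j \<in> {1..N} \<Longrightarrow> poly (v j) (endpt b X j) = 0" "j \<in> {1..N}"
  shows "form b bd j v w = - cell_integral j (v j) (pderiv w)"
proof -
  have "node_trace b (homogeneous bd) N X 0 v i = 0" if "i \<le> N" for i

    using assms(1)[of i] assms(1)[of "Suc i"] assms(1)[of N] assms(1)[of 1] that N_ge_1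
    by (cases bd; cases b; cases "i = 0"; cases "i = N") (auto simp: node_trace_def trace_minus_def trace_plus_def endpt_def)
  moreover have "j \<le> N" "j - 1 \<le> N" using assms(2) by auto
  ultimately show ?thesis by (simp add: form_def)
qed

end

declare One_nat_def [simp del]

section \<open>Translation of the interpolation function\<close>

context mesh
begin

abbreviation leg :: "nat \<Rightarrow> nat \<Rightarrow> real poly" where
  "leg j \<equiv> interval.L (X (j - 1)) (X j)"

abbreviation proj :: "bool \<Rightarrow> nat \<Rightarrow> nat \<Rightarrow> (real \<Rightarrow> real) \<Rightarrow> real poly" where
  "proj b k j \<equiv> interval.radau_proj (X (j - 1)) (X j) k (endpt b X j)"

abbreviation pcoef :: "bool \<Rightarrow> nat \<Rightarrow> nat \<Rightarrow> (real \<Rightarrow> real) \<Rightarrow> real" where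
  "pcoef b k j \<equiv> interval.radau_coef (X (j - 1)) (X j) k (endpt b X j)"

abbreviation clift :: "bool \<Rightarrow> nat \<Rightarrow> nat \<Rightarrow> real poly \<Rightarrow> real poly" where
  "clift b k j \<equiv> interval.lift (X (j - 1)) (X j) k (endpt b X j)"

lemma endpt_in: "endpt b X j \<in> {X (j - 1), X j}"
  by (simp add: endpt_def)

lemma cell_legendre_eq:
  assumes "j \<in> {1..N}"
  shows "cell_legendre X j m = poly (leg j m)"
  by (rule ext)
     (simp add: cell_legendre_def interval.poly_L[OF interval_cell[OF assms]] midpt_def hbar_def cell_len_def)

lemma Ds_inv_eq:
  assumes "j \<in> {1..N}"
  shows "Ds_inv X j v = interval.Ds (X (j - 1)) (X j) v"
  by (rule ext) (simp add: Ds_inv_def interval.Ds_def[OF interval_cell[OF assms]] hbar_def cell_len_def)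

lemma P_minus_eq:
  assumes j: "j \<in> {1..N}" and k: "k \<ge> 1" and v: "continuous_on {X (j - 1)..X j} v"
  shows "P_minus k X j v = proj True k j v"
proof -
  interpret interval "X (j - 1)" "X j" by (rule interval_cell[OF j])
  show ?thesis
    unfolding P_minus_def ip_def cell_def
  proof (rule the_equality)
    show "degree (proj True k j v) \<le> k \<and>
        (\<forall>w. degree w \<le> k - 1 \<longrightarrow> cell_integral j (proj True k j v) w = integral {X (j - 1)..X j} (\<lambda>x. v x * poly w x)) \<and>
        poly (proj True k j v) (X j) = v (X j)"
      using degree_radau_proj radau_proj_moments[OF v] k radau_proj_endpoint[OF endpt_in, of k True v]
      by (auto simp: endpt_def)
    show "p = proj True k j v"
      if "degree p \<le> k \<and> (\<forall>w. degree w \<le> k - 1 \<longrightarrow>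
          cell_integral j p w = integral {X (j - 1)..X j} (\<lambda>x. v x * poly w x)) \<and> poly p (X j) = v (X j)" for p
      using that by (intro radau_proj_unique[OF v k endpt_in]) (auto simp: endpt_def)
  qed
qed

lemma P_plus_eq:
  assumes j: "j \<in> {1..N}" and k: "k \<ge> 1" and v: "continuous_on {X (j - 1)..X j} v"
  shows "P_plus k X j v = proj False k j v"
proof -
  interpret interval "X (j - 1)" "X j" by (rule interval_cell[OF j])
  show ?thesis
    unfolding P_plus_def ip_def cell_def
  proof (rule the_equality)
    show "degree (proj False k j v) \<le> k \<and>
        (\<forall>w. degree w \<le> k - 1 \<longrightarrow> cell_integral j (proj False k j v) w = integral {X (j - 1)..X j} (\<lambda>x. v x * poly w x)) \<and>
        poly (proj False k j v) (X (j - 1)) = v (X (j - 1))"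
      using degree_radau_proj radau_proj_moments[OF v] k radau_proj_endpoint[OF endpt_in, of k False v]
      by (auto simp: endpt_def)
    show "p = proj False k j v"
      if "degree p \<le> k \<and> (\<forall>w. degree w \<le> k - 1 \<longrightarrow>
          cell_integral j p w = integral {X (j - 1)..X j} (\<lambda>x. v x * poly w x)) \<and> poly p (X (j - 1)) = v (X (j - 1))" for p
      using that by (intro radau_proj_unique[OF v k endpt_in]) (auto simp: endpt_def)
  qed
qed

lemma correction_functions_eq:
  assumes j: "j \<in> {1..N}" and k: "k \<ge> 1"
  shows "F1 k X j = clift False k j (leg j k)" "F2 k X j = clift True k j (leg j k)"
    "F1_bar k X j = clift True k j (clift False k j (leg j k))"
    "F2_bar k X j = clift False k j (clift True k j (leg j k))"
proof -
  interpret interval "X (j - 1)" "X j" by (rule interval_cell[OF j])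
  show 1: "F1 k X j = clift False k j (leg j k)"
    by (simp add: F1_def Ds_inv_eq[OF j] cell_legendre_eq[OF j] P_plus_eq[OF j k continuous_on_Ds] lift_def)
  show 2: "F2 k X j = clift True k j (leg j k)"
    by (simp add: F2_def Ds_inv_eq[OF j] cell_legendre_eq[OF j] P_minus_eq[OF j k continuous_on_Ds] lift_def)
  show "F1_bar k X j = clift True k j (clift False k j (leg j k))"
    unfolding F1_bar_def 1 Ds_inv_eq[OF j] P_minus_eq[OF j k continuous_on_Ds] by (simp only: lift_def)
  show "F2_bar k X j = clift False k j (clift True k j (leg j k))"
    unfolding F2_bar_def 2 Ds_inv_eq[OF j] P_plus_eq[OF j k continuous_on_Ds] by (simp only: lift_def)
qed

text \<open>With the signs s, the sum in the coefficient formulas is the orthogonal projection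
  evaluated at an end of the cell, where L m is 1 or (-1)^m, up to a common sign.\<close>

lemma legendre_sum_integral:
  assumes j: "j \<in> {1..N}" and v: "continuous_on {X (j - 1)..X j} v"
  shows "1 / cell_len X j * integral (cell X j) (\<lambda>x. v x * (\<Sum>m\<le>k. s m * real (2 * m + 1) * cell_legendre X j m x)) =
    (\<Sum>m\<le>k. s m * interval.lcoef (X (j - 1)) (X j) m v)"
proof -
  interpret interval "X (j - 1)" "X j" by (rule interval_cell[OF j])
  have "integral (cell X j) (\<lambda>x. v x * (\<Sum>m\<le>k. s m * real (2 * m + 1) * cell_legendre X j m x)) =
      integral {X (j - 1)..X j} (\<lambda>x. \<Sum>m\<le>k. (s m * real (2 * m + 1)) * (v x * poly (L m) x))"
    by (simp add: cell_def cell_legendre_eq[OF j] sum_distrib_left mult_ac)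
  also have "\<dots> = (\<Sum>m\<le>k. (s m * real (2 * m + 1)) * integral {X (j - 1)..X j} (\<lambda>x. v x * poly (L m) x))"
    using v by (subst integral_sum) (auto intro!: integrable_continuous_interval continuous_intros)
  finally show ?thesis
    by (simp add: sum_distrib_left lcoef_def cell_len_def mult_ac)
qed

lemma coef_bar_eq:
  assumes j: "j \<in> {1..N}" and v: "continuous_on {X (j - 1)..X j} (\<lambda>x. v x t)"
  shows "coef_bar k X j v t = pcoef True k j (\<lambda>x. v x t)"
proof -
  interpret interval "X (j - 1)" "X j" by (rule interval_cell[OF j])
  show ?thesis
    using legendre_sum_integral[OF j v, where k = k and s = "\<lambda>_. 1"]
    by (simp add: coef_bar_def radau_coef_def legendre_proj_def endpt_def poly_sum)
qed

lemma coef_tilde_eq: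
  assumes j: "j \<in> {1..N}" and v: "continuous_on {X (j - 1)..X j} (\<lambda>x. v x t)"
  shows "coef_tilde k X j v t = pcoef False k j (\<lambda>x. v x t)"
proof -
  interpret interval "X (j - 1)" "X j" by (rule interval_cell[OF j])
  show ?thesis
    unfolding coef_tilde_def legendre_sum_integral[OF j v, where k = k and s = "\<lambda>m. (- 1) ^ (k + m)"]
    by (simp add: radau_coef_def legendre_proj_def endpt_def poly_sum right_diff_distrib sum_distrib_left power_add mult_ac)
qed

section \<open>Coordinates\<close>

text \<open>Normalized in L2 of its cell, so that Euclidean norms of coordinates are L2 norms of
  piecewise polynomials.\<close>

definition basis :: "nat \<times> nat \<Rightarrow> real poly" where
  "basis i = smult (sqrt ((2 * real (snd i) + 1) / cell_len X (fst i))) (leg (fst i) (snd i))"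

definition basis_fun :: "nat \<times> nat \<Rightarrow> nat \<Rightarrow> real poly" where
  "basis_fun i j = (if j = fst i then basis i else 0)"

definition coords :: "(nat \<Rightarrow> real poly) \<Rightarrow> nat \<times> nat \<Rightarrow> real" where
  "coords v i = cell_integral (fst i) (v (fst i)) (basis i)"

abbreviation index :: "nat \<Rightarrow> (nat \<times> nat) set" where
  "index k \<equiv> {1..N} \<times> {..k}"

lemma degree_basis: "i \<in> index k \<Longrightarrow> degree (basis i) \<le> k"
  using interval.degree_L[OF interval_cell, of "fst i" "snd i"]
  by (auto simp: basis_def intro: order_trans[OF degree_smult_le])

lemma coords_expand:
  assumes j: "j \<in> {1..N}" and v: "degree (v j) \<le> k"
  shows "v j = (\<Sum>m\<le>k. smult (coords v (j, m)) (basis (j, m)))"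
proof -
  interpret interval "X (j - 1)" "X j" by (rule interval_cell[OF j])
  have "smult (coords v (j, m)) (basis (j, m)) = smult (lcoef m (poly (v j))) (L m)" for m
  proof -
    define r where "r = (2 * real m + 1) / cell_len X j"
    have "r \<ge> 0" using cell_len_pos[OF j] by (simp add: r_def)
    have "coords v (j, m) = integral {X (j - 1)..X j} (\<lambda>x. sqrt r * (poly (v j) x * poly (L m) x))"
      by (simp add: coords_def basis_def r_def mult_ac)
    then have "coords v (j, m) = sqrt r * cell_integral j (v j) (L m)"
      by simp
    then have "coords v (j, m) * sqrt r = (sqrt r * sqrt r) * cell_integral j (v j) (L m)"
      by (simp add: mult_ac)
    also have "sqrt r * sqrt r = r" using \<open>r \<ge> 0\<close> by simp
    also have "r * cell_integral j (v j) (L m) = lcoef m (poly (v j))"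
      by (simp add: lcoef_def r_def cell_len_def)
    finally show ?thesis by (simp add: basis_def r_def)
  qed
  then show ?thesis
    using legendre_proj_poly[OF v] by (simp add: legendre_proj_def)
qed

text \<open>Only the basis functions that live on cell j contribute. The functional \<Lambda> stands
  for evaluation at a point or integration against a fixed polynomial.\<close>

lemma sum_basis_fun:
  assumes "j \<in> {1..N}" "\<Lambda> 0 = (0 :: real)"
  shows "(\<Sum>i\<in>index k. a i * \<Lambda> (basis_fun i j)) = (\<Sum>m\<le>k. a (j, m) * \<Lambda> (basis (j, m)))"
proof -
  have "(\<Sum>i\<in>index k. a i * \<Lambda> (basis_fun i j)) =
      (\<Sum>j'=1..N. \<Sum>m\<le>k. a (j', m) * \<Lambda> (basis_fun (j', m) j))"
    by (simp add: sum.cartesian_product)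
  also have "\<dots> = (\<Sum>j'=1..N. if j' = j then \<Sum>m\<le>k. a (j, m) * \<Lambda> (basis (j, m)) else 0)"
    by (intro sum.cong refl) (auto simp: basis_fun_def assms(2))
  also have "\<dots> = (\<Sum>m\<le>k. a (j, m) * \<Lambda> (basis (j, m)))"
    using assms(1) by simp
  finally show ?thesis .
qed

lemma poly_coords:
  assumes "j \<in> {1..N}" "degree (v j) \<le> k"
  shows "poly (v j) x = (\<Sum>i\<in>index k. coords v i * poly (basis_fun i j) x)"
  using sum_basis_fun[OF assms(1), where \<Lambda> = "\<lambda>p. poly p x" and k = k and a = "coords v"]
  by (subst coords_expand[where v = v, OF assms]) (simp add: poly_sum)

lemma cell_integral_sum_left:
  "cell_integral j (\<Sum>m\<in>A. smult (a m) (p m)) w = (\<Sum>m\<in>A. a m * cell_integral j (p m) w)"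
proof (cases "finite A")
  case True
  have "cell_integral j (\<Sum>m\<in>A. smult (a m) (p m)) w =
      integral {X (j - 1)..X j} (\<lambda>x. \<Sum>m\<in>A. a m * (poly (p m) x * poly w x))"
    by (simp add: poly_sum sum_distrib_right mult.assoc)
  also have "\<dots> = (\<Sum>m\<in>A. a m * cell_integral j (p m) w)"
    using True by (subst integral_sum) (auto intro!: integrable_continuous_interval continuous_intros)
  finally show ?thesis .
qed simp

lemma cell_integral_commute: "cell_integral j p w = cell_integral j w p"
  by (simp add: mult.commute)

lemma cell_integral_coords:
  assumes "j \<in> {1..N}" "degree (v j) \<le> k"
  shows "cell_integral j (v j) w = (\<Sum>i\<in>index k. coords v i * cell_integral j (basis_fun i j) w)"
proof -
  have "cell_integral j (v j) w = (\<Sum>m\<le>k. coords v (j, m) * cell_integral j (basis (j, m)) w)"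
    by (subst coords_expand[where v = v, OF assms]) (rule cell_integral_sum_left)
  then show ?thesis
    using sum_basis_fun[OF assms(1), where \<Lambda> = "\<lambda>p. cell_integral j p w" and k = k and a = "coords v"] by simp
qed

lemma trace_coords:
  assumes v: "\<And>j. j \<in> {1..N} \<Longrightarrow> degree (v j) \<le> k" and "n \<le> N"
  shows "node_trace b (homogeneous bd) N X 0 v n =
    (\<Sum>i\<in>index k. coords v i * node_trace b (homogeneous bd) N X 0 (basis_fun i) n)"
proof -
  have p: "poly (v j) x = (\<Sum>i\<in>index k. coords v i * poly (basis_fun i j) x)" if "j \<in> {1..N}" for j x
    by (intro poly_coords that v)
  have "N \<in> {1..N}" "1 \<in> {1..N}" using N_ge_1 by auto
  then show ?thesis
    using p[of n] p[of "n + 1"] p[of N] p[of 1] assms(2)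
    by (cases bd; cases b; cases "n = 0"; cases "n = N") (auto simp: node_trace_def trace_minus_def trace_plus_def)
qed

lemma form_coords:
  assumes v: "\<And>j. j \<in> {1..N} \<Longrightarrow> degree (v j) \<le> k" and j: "j \<in> {1..N}"
  shows "form b bd j v w = (\<Sum>i\<in>index k. coords v i * form b bd j (basis_fun i) w)"
proof -
  have le: "j \<le> N" "j - 1 \<le> N" using j by auto
  have t1: "node_trace b (homogeneous bd) N X 0 v j =
      (\<Sum>i\<in>index k. coords v i * node_trace b (homogeneous bd) N X 0 (basis_fun i) j)"
    by (rule trace_coords[OF v le(1)])
  have t2: "node_trace b (homogeneous bd) N X 0 v (j - 1) =
      (\<Sum>i\<in>index k. coords v i * node_trace b (homogeneous bd) N X 0 (basis_fun i) (j - 1))"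
    by (rule trace_coords[OF v le(2)])
  show ?thesis
    unfolding form_def t1 t2 cell_integral_coords[where v = v, OF j v[OF j]]
    by (simp add: sum_distrib_left sum_distrib_right sum.distrib sum_subtractf sum_negf algebra_simps)
qed

lemma form_sum_right:
  "form b bd j v (\<Sum>m\<in>A. smult (a m) (p m)) = (\<Sum>m\<in>A. a m * form b bd j v (p m))"
proof (cases "finite A")
  case True
  have "pderiv (\<Sum>m\<in>A. smult (a m) (p m)) = (\<Sum>m\<in>A. smult (a m) (pderiv (p m)))"
    using higher_pderiv_sum[of "Suc 0" "\<lambda>m. smult (a m) (p m)" A] by (simp add: pderiv_smult)
  then have "cell_integral j (v j) (pderiv (\<Sum>m\<in>A. smult (a m) (p m))) =
      (\<Sum>m\<in>A. a m * cell_integral j (v j) (pderiv (p m)))"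
    using cell_integral_sum_left[where j = j and a = a and p = "\<lambda>m. pderiv (p m)" and A = A and w = "v j"]
    unfolding cell_integral_commute[of j "v j"] by simp
  then show ?thesis
    unfolding form_def
    by (simp add: poly_sum sum_distrib_left sum_distrib_right sum.distrib sum_subtractf sum_negf algebra_simps)
qed (simp add: form_def)

lemma form_zero_right: "form b bd j v 0 = 0"
  by (simp add: form_def)

definition grad_matrix :: "bool \<Rightarrow> boundary_data \<Rightarrow> nat \<times> nat \<Rightarrow> nat \<times> nat \<Rightarrow> real" where
  "grad_matrix b bd i i' = form b bd (fst i) (basis_fun i') (basis i)"

lemma grad_matrix_coords:
  assumes v: "\<And>j. j \<in> {1..N} \<Longrightarrow> degree (v j) \<le> k" and i: "i \<in> index k"
  shows "mat_app (index k) (grad_matrix b bd) (coords v) i = form b bd (fst i) v (basis i)"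
  using form_coords[where v = v and b = b and bd = bd and j = "fst i" and w = "basis i", OF v] i
  by (auto simp: mat_app_def grad_matrix_def mult.commute)

text \<open>Transposition puts the expanded function into the test slot of the form; antisymmetry
  brings it back as a discrete derivative with the opposite flux.\<close>

lemma flip_grad_matrix_coords:
  assumes w: "\<And>j. j \<in> {1..N} \<Longrightarrow> degree (w j) \<le> k" and i: "i \<in> index k"
  shows "mat_app (index k) (flip (grad_matrix b bd)) (coords w) i = - form (\<not> b) bd (fst i) w (basis i)"
proof -
  have "mat_app (index k) (flip (grad_matrix b bd)) (coords w) i =
      (\<Sum>j=1..N. \<Sum>m\<le>k. coords w (j, m) * form b bd j (basis_fun i) (basis (j, m)))"
    unfolding mat_app_def flip_def grad_matrix_def by (simp add: sum.cartesian_product case_prod_beta mult.commute)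
  also have "\<dots> = (\<Sum>j=1..N. form b bd j (basis_fun i) (w j))"
  proof (intro sum.cong refl)
    fix j assume j: "j \<in> {1..N}"
    show "(\<Sum>m\<le>k. coords w (j, m) * form b bd j (basis_fun i) (basis (j, m))) = form b bd j (basis_fun i) (w j)"
      using form_sum_right[of b bd j "basis_fun i" "\<lambda>m. coords w (j, m)" "\<lambda>m. basis (j, m)" "{..k}"]
        coords_expand[where v = w, OF j w[OF j]] by simp
  qed
  also have "\<dots> = - (\<Sum>j=1..N. form (\<not> b) bd j w (basis_fun i j))"
    by (rule form_antisymmetric)
  also have "(\<Sum>j=1..N. form (\<not> b) bd j w (basis_fun i j)) =
      (\<Sum>j=1..N. if j = fst i then form (\<not> b) bd (fst i) w (basis i) else 0)"
    by (intro sum.cong refl) (simp add: basis_fun_def form_zero_right)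
  also have "\<dots> = form (\<not> b) bd (fst i) w (basis i)"
    using i by auto
  finally show ?thesis .
qed

lemma abs_basis_le:
  assumes i: "i \<in> index k" and x: "x \<in> {X (fst i - 1)..X (fst i)}"
  shows "\<bar>poly (basis i) x\<bar> \<le> sqrt ((2 * real k + 1) / cell_len X (fst i)) * legendre_bound k"
proof -
  have j: "fst i \<in> {1..N}" and m: "snd i \<le> k" using i by auto
  have "sqrt ((2 * real (snd i) + 1) / cell_len X (fst i)) \<le> sqrt ((2 * real k + 1) / cell_len X (fst i))"
    using m cell_len_pos[OF j] by (intro real_sqrt_le_mono divide_right_mono) auto
  then show ?thesis
    using interval.abs_L_le[OF interval_cell[OF j] m x] cell_len_pos[OF j] legendre_bound_ge_1[of k]
    unfolding basis_def by (auto simp: abs_mult intro!: mult_mono)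
qed

definition coord_const :: "nat \<Rightarrow> real" where
  "coord_const k = legendre_bound k * sqrt ((2 * real k + 1) * (real k + 1) * (2 * pi))"

text \<open>A squared coordinate is at most a constant times S^2 and the cell length. The lengths
  add up to 2 pi, so the number of cells drops out.\<close>

lemma L2_coords_le:
  assumes v: "\<And>j x. j \<in> {1..N} \<Longrightarrow> x \<in> {X (j - 1)..X j} \<Longrightarrow> \<bar>poly (v j) x\<bar> \<le> S"
  shows "L2_set (coords v) (index k) \<le> coord_const k * S"
proof -
  define B where "B = legendre_bound k"
  have B: "B \<ge> 1" by (simp add: B_def legendre_bound_ge_1)
  have "1 \<in> {1..N}" using N_ge_1 by simp
  then have S: "S \<ge> 0" using v[of 1 "X 0"] X_step[of 1] by force
  have co: "(coords v (j, m))\<^sup>2 \<le> S\<^sup>2 * B\<^sup>2 * (2 * real k + 1) * cell_len X j" if "j \<in> {1..N}" "m \<le> k" for j m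
  proof -
    define l where "l = cell_len X j"
    have l: "l > 0" using cell_len_pos that by (simp add: l_def)
    have "norm (coords v (j, m)) \<le> (S * (sqrt ((2 * real k + 1) / l) * B)) * (X j - X (j - 1))"
      unfolding coords_def fst_conv
    proof (rule integral_bound)
      fix x assume x: "x \<in> {X (j - 1)..X j}"
      show "norm (poly (v j) x * poly (basis (j, m)) x) \<le> S * (sqrt ((2 * real k + 1) / l) * B)"
        using v[of j x] abs_basis_le[of "(j, m)" k x] that x S
        unfolding norm_mult by (intro mult_mono) (auto simp: l_def B_def)
    qed (use that X_step[of j] in \<open>auto intro!: continuous_intros simp: less_imp_le\<close>)
    also have "X j - X (j - 1) = l" by (simp add: l_def cell_len_def)
    finally have "\<bar>coords v (j, m)\<bar>\<^sup>2 \<le> ((S * (sqrt ((2 * real k + 1) / l) * B)) * l)\<^sup>2"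
      by (intro power_mono) auto
    also have "\<dots> = S\<^sup>2 * B\<^sup>2 * ((2 * real k + 1) / l) * l\<^sup>2"
      using l by (simp add: power_mult_distrib)
    also have "\<dots> = S\<^sup>2 * B\<^sup>2 * (2 * real k + 1) * l"
      using l by (simp add: power2_eq_square)
    finally show ?thesis by (simp add: l_def)
  qed
  have "(\<Sum>i\<in>index k. (coords v i)\<^sup>2) = (\<Sum>j=1..N. \<Sum>m\<le>k. (coords v (j, m))\<^sup>2)"
    by (simp add: sum.cartesian_product)
  also have "\<dots> \<le> (\<Sum>j=1..N. \<Sum>m\<le>k. S\<^sup>2 * B\<^sup>2 * (2 * real k + 1) * cell_len X j)"
    by (intro sum_mono co) auto
  also have "\<dots> = (\<Sum>j=1..N. (real k + 1) * (S\<^sup>2 * B\<^sup>2 * (2 * real k + 1)) * cell_len X j)"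
    by (intro sum.cong refl) (simp add: add_ac mult_ac)
  also have "\<dots> = (real k + 1) * (S\<^sup>2 * B\<^sup>2 * (2 * real k + 1)) * (\<Sum>j=1..N. cell_len X j)"
    by (simp only: sum_distrib_left)
  also have "\<dots> = S\<^sup>2 * B\<^sup>2 * ((2 * real k + 1) * (real k + 1) * (2 * pi))"
    unfolding sum_cell_len by (simp only: mult_ac)
  finally have "L2_set (coords v) (index k) \<le> sqrt (S\<^sup>2 * B\<^sup>2 * ((2 * real k + 1) * (real k + 1) * (2 * pi)))"
    unfolding L2_set_def by (rule real_sqrt_le_mono)
  also have "\<dots> = coord_const k * S"
    using S B by (simp add: real_sqrt_mult coord_const_def B_def)
  finally show ?thesis .
qed

definition inverse_const :: "nat \<Rightarrow> real" where
  "inverse_const k = (real k + 1) * legendre_bound k * sqrt ((2 * real k + 1) * c)"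

text \<open>The inverse inequality: in the worst case the whole norm sits on one cell, whose length
  is at least h / c, and this costs h^(-1/2).\<close>

lemma abs_poly_le_L2_coords:
  assumes j: "j \<in> {1..N}" and v: "degree (v j) \<le> k" and x: "x \<in> {X (j - 1)..X j}"
  shows "\<bar>poly (v j) x\<bar> \<le> inverse_const k * h powr (-1/2) * L2_set (coords v) (index k)"
proof -
  define n where "n = L2_set (coords v) (index k)"
  have n0: "n \<ge> 0" by (simp add: n_def)
  have B: "legendre_bound k \<ge> 1" by (rule legendre_bound_ge_1)
  have l: "cell_len X j > 0" by (rule cell_len_pos[OF j])
  have "1 / cell_len X j \<le> c / h"
    using h_le[OF j] h_pos l by (simp add: field_simps)
  then have "(2 * real k + 1) * (1 / cell_len X j) \<le> (2 * real k + 1) * (c / h)"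
    by (intro mult_left_mono) auto
  then have sq: "sqrt ((2 * real k + 1) / cell_len X j) \<le> sqrt ((2 * real k + 1) * c / h)"
    by simp
  have "\<bar>poly (v j) x\<bar> \<le> (\<Sum>m\<le>k. \<bar>coords v (j, m)\<bar> * \<bar>poly (basis (j, m)) x\<bar>)"
    by (subst coords_expand[where v = v, OF j v]) (simp add: poly_sum abs_mult[symmetric] sum_abs)
  also have "\<dots> \<le> (\<Sum>m\<le>k. n * (sqrt ((2 * real k + 1) * c / h) * legendre_bound k))"
  proof (intro sum_mono mult_mono)
    fix m assume m: "m \<in> {..k}"
    then have i: "(j, m) \<in> index k" using j by simp
    show "\<bar>coords v (j, m)\<bar> \<le> n"
    proof -
      have "(coords v (j, m))\<^sup>2 \<le> (\<Sum>i\<in>index k. (coords v i)\<^sup>2)"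
        using i by (intro member_le_sum[where f = "\<lambda>i. (coords v i)\<^sup>2"]) auto
      then have "sqrt ((coords v (j, m))\<^sup>2) \<le> n" unfolding n_def L2_set_def by (rule real_sqrt_le_mono)
      then show ?thesis by simp
    qed
    show "\<bar>poly (basis (j, m)) x\<bar> \<le> sqrt ((2 * real k + 1) * c / h) * legendre_bound k"
      using abs_basis_le[OF i, of x] x sq B
      by (auto intro: order_trans[OF _ mult_right_mono])
  qed (use n0 in auto)
  also have "\<dots> = (real k + 1) * (n * (sqrt ((2 * real k + 1) * c / h) * legendre_bound k))"
    by (simp add: add_ac)
  also have "sqrt ((2 * real k + 1) * c / h) = sqrt ((2 * real k + 1) * c) * h powr (-1/2)"
    using h_pos by (simp add: real_sqrt_divide powr_minus_divide powr_half_sqrt)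
  finally show ?thesis by (simp add: inverse_const_def n_def mult_ac)
qed

end

section \<open>Lagrange interpolation and the Radau points\<close>

lemma DERIV_cong_on:
  assumes "t \<in> S" "\<And>r. r \<in> S \<Longrightarrow> f r = g r" "(g has_real_derivative d) (at t within S)"
  shows "(f has_real_derivative d) (at t within S)"
  using assms unfolding has_field_derivative_def by (rule has_derivative_transform)

text \<open>The scheme provides the time derivative of \<open>uh\<close> pointwise in x. Writing a
  polynomial through its values at 0, ..., k carries this over to its integrals.\<close>

lemma lagrange_basis:
  "\<exists>l :: nat \<Rightarrow> real poly. \<forall>p. degree p \<le> k \<longrightarrow> p = (\<Sum>i\<le>k. smult (poly p (real i)) (l i))"
proof -
  define l where "l i = smult (1 / (\<Prod>n\<in>{..k} - {i}. real i - real n)) (\<Prod>n\<in>{..k} - {i}. [:- real n, 1:])" for i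
  have li: "poly (l i) (real n) = (if n = i then 1 else 0)" if "i \<le> k" "n \<le> k" for i n
    using that by (auto simp: l_def poly_prod)
  have dl: "degree (l i) \<le> k" if "i \<le> k" for i
  proof -
    have "degree (\<Prod>n\<in>{..k} - {i}. [:- real n, 1:]) \<le> (\<Sum>n\<in>{..k} - {i}. degree [:- real n, 1:])"
      using degree_prod_sum_le[of "{..k} - {i}" "\<lambda>n. [:- real n, 1:]"] by (simp only: o_def finite_Diff finite_atMost)
    also have "\<dots> = k" using that by simp
    finally show ?thesis unfolding l_def by (rule order_trans[OF degree_smult_le])
  qed
  have "p = (\<Sum>i\<le>k. smult (poly p (real i)) (l i))" if p: "degree p \<le> k" for p
  proof (rule poly_eqI_degree[where A = "real ` {..k}"])
    show "poly p x = poly (\<Sum>i\<le>k. smult (poly p (real i)) (l i)) x" if x: "x \<in> real ` {..k}" for x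
    proof -
      obtain n where n: "n \<le> k" "x = real n" using x by auto
      have "poly (\<Sum>i\<le>k. smult (poly p (real i)) (l i)) x = (\<Sum>i\<le>k. poly p (real i) * poly (l i) (real n))"
        by (simp add: poly_sum n(2))
      also have "\<dots> = (\<Sum>i\<le>k. if i = n then poly p (real n) else 0)"
        by (intro sum.cong refl) (use n in \<open>auto simp: li\<close>)
      finally show ?thesis using n by simp
    qed
    have card: "card (real ` {..k}) = Suc k" by (subst card_image) (auto simp: inj_on_def)
    show "card (real ` {..k}) > degree p" using p card by simp
    have "degree (\<Sum>i\<le>k. smult (poly p (real i)) (l i)) \<le> k"
      by (intro degree_smult_sum_le dl) auto
    then show "card (real ` {..k}) > degree (\<Sum>i\<le>k. smult (poly p (real i)) (l i))" using card by simp
  qed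
  then show ?thesis by blast
qed

lemma (in interval) radau_cong:
  assumes "\<And>x. x \<in> {a..b} \<Longrightarrow> v x = w x" "e \<in> {a, b}"
  shows "radau_coef k e v = radau_coef k e w" "radau_proj k e v = radau_proj k e w"
proof -
  have "lcoef m v = lcoef m w" for m
    unfolding lcoef_def using assms(1) by (intro arg_cong[where f = "(*) _"] integral_cong) auto
  then have lp: "legendre_proj k v = legendre_proj k w" by (simp add: legendre_proj_def)
  have e: "v e = w e" using assms ab by auto
  show "radau_coef k e v = radau_coef k e w" by (simp add: radau_coef_def lp e)
  then show "radau_proj k e v = radau_proj k e w" by (simp add: radau_proj_def lp)
qed

text \<open>The flag names the interpolated end: the projection that interpolates at the right end
  superconverges at the right Radau points, the other one at the left.\<close>

definition radau_set :: "bool \<Rightarrow> nat \<Rightarrow> (nat \<Rightarrow> real) \<Rightarrow> nat \<Rightarrow> real set" where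
  "radau_set b k X j = (if b then right_radau k X j else left_radau k X j)"

context mesh
begin

lemma coords_diff: "coords (\<lambda>j. v j - w j) i = coords v i - coords w i"
proof -
  have "coords (\<lambda>j. v j - w j) i = integral {X (fst i - 1)..X (fst i)}
      (\<lambda>x. poly (v (fst i)) x * poly (basis i) x - poly (w (fst i)) x * poly (basis i) x)"
    by (simp add: coords_def algebra_simps)
  also have "\<dots> = coords v i - coords w i"
    unfolding coords_def by (intro integral_diff) auto
  finally show ?thesis .
qed

text \<open>As L m is 1 at the right end and (-1)^m at the left end, one equation covers the roots
  of L (k + 1) - L k and those of L (k + 1) + L k.\<close>

lemma radau_set_subset:
  assumes j: "j \<in> {1..N}" and x: "x \<in> radau_set b k X j"
  shows "x \<in> {X (j - 1)..X j}"
    "poly (leg j k) (endpt b X j) * poly (leg j (k + 1)) x = poly (leg j (k + 1)) (endpt b X j) * poly (leg j k) x"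
proof -
  interpret interval "X (j - 1)" "X j" by (rule interval_cell[OF j])
  show "x \<in> {X (j - 1)..X j}"
    using x by (auto simp: radau_set_def right_radau_def left_radau_def cell_def split: if_splits)
  show "poly (leg j k) (endpt b X j) * poly (leg j (k + 1)) x = poly (leg j (k + 1)) (endpt b X j) * poly (leg j k) x"
    using x by (auto simp: radau_set_def right_radau_def left_radau_def endpt_def cell_legendre_eq[OF j]
        add_eq_0_iff power_add split: if_splits)
qed

lemma radau_set_finite_nonempty:
  assumes j: "j \<in> {1..N}" and k: "k \<ge> 1"
  shows "finite (radau_set b k X j)" "radau_set b k X j \<noteq> {}"
proof -
  interpret interval "X (j - 1)" "X j" by (rule interval_cell[OF j])
  have "radau_set b k X j \<subseteq> {x. poly (leg j k) (endpt b X j) * poly (leg j (k + 1)) x =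
      poly (leg j (k + 1)) (endpt b X j) * poly (leg j k) x}"
    using radau_set_subset(2)[OF j] by blast
  then show "finite (radau_set b k X j)"
    using finite_radau_points[OF endpt_in] by (rule finite_subset)
  obtain x where x: "X (j - 1) < x" "x < X j"
    "poly (leg j k) (endpt b X j) * poly (leg j (k + 1)) x = poly (leg j (k + 1)) (endpt b X j) * poly (leg j k) x"
    using radau_point_exists[OF k] by blast
  have "poly (leg j (k + 1)) x + poly (leg j k) x = 0" if "\<not> b"
  proof -
    have "(- 1) ^ k * (poly (leg j (k + 1)) x + poly (leg j k) x) = 0"
      using x(3) that by (simp add: endpt_def power_add algebra_simps)
    then show ?thesis by simp
  qed
  then have "x \<in> radau_set b k X j"
    using x by (auto simp: radau_set_def right_radau_def left_radau_def endpt_def cell_legendre_eq[OF j] cell_def)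
  then show "radau_set b k X j \<noteq> {}" by blast
qed

lemma max_error_le:
  assumes "k \<ge> 1" and le: "\<And>j x. j \<in> {1..N} \<Longrightarrow> x \<in> radau_set b k X j \<Longrightarrow> \<bar>w x t - poly (v t j) x\<bar> \<le> B"
  shows "max_error N (radau_set b k X) w v t \<le> B"
proof -
  have "1 \<in> {1..N}" using N_ge_1 by simp
  then have ne: "(SIGMA j:{1..N}. radau_set b k X j) \<noteq> {}"
    using radau_set_finite_nonempty(2)[of 1 k b] assms(1) by blast
  have "finite (SIGMA j:{1..N}. radau_set b k X j)"
    using radau_set_finite_nonempty(1)[OF _ assms(1)] by (intro finite_SigmaI) auto
  then show ?thesis
    unfolding max_error_def using ne le by (subst Max_le_iff) auto
qed

end

section \<open>Powers of h and t\<close>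

text \<open>The factor h^(1/2) is split off because the inverse inequality will consume it. The
  other powers are absorbed by x^p \<le> 1 + x, and h \<le> 2 pi gives sqrt h \<le> 3.\<close>

lemma time_growth_u:
  fixes h t :: real
  assumes h: "0 < h" "h \<le> 2 * pi" and t: "t \<ge> 0"
  shows "h + 5 * h * t powr (1/2) + 4 * h powr (3/4) * t powr (1/4) \<le> 27 * h powr (1/2) * (1 + t * sqrt h)"
proof -
  define s where "s = h powr (1/2)"
  have s: "s > 0" "s * s = h" "sqrt h = s"
    using h by (auto simp: s_def powr_half_sqrt powr_add[symmetric])
  have s3: "s \<le> 3"
  proof (rule power2_le_imp_le)
    show "s\<^sup>2 \<le> 3\<^sup>2" using s h pi_less_4 by (simp add: power2_eq_square)
  qed simp
  have root: "x powr p \<le> 1 + x" if "x \<ge> 0" "0 \<le> p" "p \<le> 1" for x p :: real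
  proof (cases "x \<le> 1")
    case True
    then have "x powr p \<le> 1" using that powr_mono2[of p x 1] by simp
    then show ?thesis using that by simp
  next
    case False
    then have "x powr p \<le> x powr 1" using that by (intro powr_mono) auto
    then show ?thesis using that by simp
  qed
  have a: "h \<le> s * 3" using s s3 mult_left_mono[of s 3 s] by simp
  have "s * t powr (1/2) \<le> s * (1 + t)" using s t by (intro mult_left_mono root) auto
  also have "\<dots> \<le> 3 + t * s" using s3 by (simp add: algebra_simps)
  finally have "s * (s * t powr (1/2)) \<le> s * (3 + t * s)" using s by (intro mult_left_mono) auto
  then have b: "h * t powr (1/2) \<le> s * (3 + t * s)" using s by (simp add: mult.assoc[symmetric])
  have "h powr (3/4) * t powr (1/4) = s * (h * t) powr (1/4)"
    using h t powr_add[of h "1/2" "1/4"] by (simp add: s_def powr_mult)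
  also have "\<dots> \<le> s * (1 + h * t)" using s t h by (intro mult_left_mono root) auto
  also have "h * t \<le> 3 * (t * s)" using a t mult_right_mono[of h "s * 3" t] by (simp add: mult_ac)
  finally have c: "h powr (3/4) * t powr (1/4) \<le> s * (1 + 3 * (t * s))" using s by simp
  have "h + 5 * (h * t powr (1/2)) + 4 * (h powr (3/4) * t powr (1/4)) \<le>
      s * 3 + 5 * (s * (3 + t * s)) + 4 * (s * (1 + 3 * (t * s)))"
    using a b c by (intro add_mono mult_left_mono) auto
  also have "\<dots> \<le> 27 * s * (1 + t * s)" using s t by (simp add: algebra_simps)
  finally show ?thesis by (simp add: s s_def[symmetric] mult.assoc)
qed

text \<open>Here h^(1/4) t^(1/8) is h^(1/8) (t h)^(1/8): the first factor is at most 2, the second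
  at most 1 + sqrt (t h).\<close>

lemma time_growth_q:
  fixes h t :: real
  assumes h: "0 < h" "h \<le> 2 * pi" and t: "t \<ge> 0"
  shows "h + 15 * h powr (1/2) + 48 * h powr (3/4) * t powr (1/8) \<le> 120 * h powr (1/2) * (1 + sqrt (t * h))"
proof -
  define s where "s = h powr (1/2)"
  have s: "s > 0" "s * s = h"
    using h by (auto simp: s_def powr_add[symmetric])
  have s3: "s \<le> 3"
  proof (rule power2_le_imp_le)
    show "s\<^sup>2 \<le> 3\<^sup>2" using s h pi_less_4 by (simp add: power2_eq_square)
  qed simp
  define r where "r = sqrt (t * h)"
  have r: "r \<ge> 0" using t h by (simp add: r_def)
  have a: "h \<le> s * 3" using s s3 mult_left_mono[of s 3 s] by simp
  have "(t * h) powr (1/8) \<le> 1 + r"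
  proof (cases "t * h \<le> 1")
    case True
    then have "(t * h) powr (1/8) \<le> 1" using t h powr_mono2[of "1/8" "t * h" 1] by simp
    then show ?thesis using r by simp
  next
    case False
    then have "(t * h) powr (1/8) \<le> (t * h) powr (1/2)" by (intro powr_mono) auto
    then show ?thesis using t h by (simp add: r_def powr_half_sqrt)
  qed
  moreover have "h powr (1/8) \<le> 2"
  proof -
    have "h powr (1/8) \<le> 256 powr (1/8)" using h pi_less_4 by (intro powr_mono2) auto
    also have "(256::real) = 2 powr 8" by simp
    also have "(2 powr 8) powr (1/8) = (2::real)" by (simp only: powr_powr) simp
    finally show ?thesis .
  qed
  ultimately have "h powr (1/8) * (t * h) powr (1/8) \<le> 2 * (1 + r)"
    using r by (intro mult_mono) auto
  then have "s * (h powr (1/8) * (t * h) powr (1/8)) \<le> s * (2 * (1 + r))"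
    using s by (intro mult_left_mono) auto
  moreover have "h powr (3/4) * t powr (1/8) = s * (h powr (1/8) * (t * h) powr (1/8))"
    using h t powr_add[of h "1/8" "1/8"] powr_add[of h "1/2" "1/4"] by (simp add: s_def powr_mult mult_ac)
  ultimately have c: "h powr (3/4) * t powr (1/8) \<le> s * (2 * (1 + r))" by simp
  have "h + 15 * s + 48 * (h powr (3/4) * t powr (1/8)) \<le> s * 3 + 15 * s + 48 * (s * (2 * (1 + r)))"
    using a c by (intro add_mono mult_left_mono) auto
  also have "\<dots> \<le> 120 * s * (1 + r)" using s r by (simp add: algebra_simps)
  finally show ?thesis by (simp add: s_def[symmetric] r_def mult.assoc)
qed

text \<open>Sup norm bounds of the correction functions, one lift of L k here and two lifts below;
  the 2 is the bound of the scaled antiderivative.\<close>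

definition lift_bound :: "nat \<Rightarrow> real" where
  "lift_bound k = 2 * radau_bound k * legendre_bound k"

definition lift2_bound :: "nat \<Rightarrow> real" where
  "lift2_bound k = 2 * radau_bound k * lift_bound k"

lemma radau_bound_pos: "radau_bound k > 0"
proof -
  have "legendre_bound k > 0" using legendre_bound_ge_1[of k] by simp
  then show ?thesis unfolding radau_bound_def by (intro mult_pos_pos zero_less_power add_pos_nonneg) auto
qed

lemma lift_bound_pos: "lift_bound k > 0" "lift2_bound k > 0"
proof -
  have "legendre_bound k > 0" using legendre_bound_ge_1[of k] by simp
  then show "lift_bound k > 0" using radau_bound_pos[of k] by (simp add: lift_bound_def)
  then show "lift2_bound k > 0" using radau_bound_pos[of k] by (simp add: lift2_bound_def)
qed

section \<open>The error equation\<close>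

text \<open>The situation once regularity is settled. \<open>D t i\<close> is the space derivative
  of order i, and \<open>D t 2\<close> serves both as u_xx and as u_t. Order k + 3 is bounded, but
  only the orders below it are Lipschitz in time.\<close>

locale ldg_error = mesh N X c for N X c +
  fixes k :: nat and fl :: flux and bd :: boundary_data and T M :: real
    and u q :: "real \<Rightarrow> real \<Rightarrow> real" and uh qh uht :: "real \<Rightarrow> nat \<Rightarrow> real poly"
    and D :: "real \<Rightarrow> nat \<Rightarrow> real \<Rightarrow> real"
  assumes k: "k \<ge> 2" and T: "T > 0"
    and D0: "\<And>t x. t \<in> {0..T} \<Longrightarrow> x \<in> \<Omega> \<Longrightarrow> D t 0 x = u x t"
    and D1: "\<And>t x. t \<in> {0..T} \<Longrightarrow> x \<in> \<Omega> \<Longrightarrow> D t 1 x = q x t"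
    and DD: "\<And>t i x. t \<in> {0..T} \<Longrightarrow> i < k + 3 \<Longrightarrow> x \<in> \<Omega> \<Longrightarrow>
      (D t i has_real_derivative D t (Suc i) x) (at x within \<Omega>)"
    and Dc: "\<And>t i. t \<in> {0..T} \<Longrightarrow> i \<le> k + 3 \<Longrightarrow> continuous_on \<Omega> (D t i)"
    and Db: "\<And>t i x. t \<in> {0..T} \<Longrightarrow> i \<le> k + 3 \<Longrightarrow> x \<in> \<Omega> \<Longrightarrow> \<bar>D t i x\<bar> \<le> M"
    and Dlip: "\<And>s t i x. s \<in> {0..T} \<Longrightarrow> t \<in> {0..T} \<Longrightarrow> i < k + 3 \<Longrightarrow> x \<in> \<Omega> \<Longrightarrow>
      \<bar>D t i x - D s i x\<bar> \<le> M * \<bar>t - s\<bar>"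
    and Dt: "\<And>t x. t \<in> {0..T} \<Longrightarrow> x \<in> \<Omega> \<Longrightarrow> (u x has_real_derivative D t 2 x) (at t within {0..T})"
    and bc: "boundary_condition fl bd T u q"
    and deg: "\<And>t j. t \<in> {0..T} \<Longrightarrow> j \<in> {1..N} \<Longrightarrow> degree (uh t j) \<le> k"
      "\<And>t j. t \<in> {0..T} \<Longrightarrow> j \<in> {1..N} \<Longrightarrow> degree (qh t j) \<le> k"
      "\<And>t j. t \<in> {0..T} \<Longrightarrow> j \<in> {1..N} \<Longrightarrow> degree (uht t j) \<le> k"
    and uh_deriv: "\<And>t j x. t \<in> {0..T} \<Longrightarrow> j \<in> {1..N} \<Longrightarrow>
      ((\<lambda>s. poly (uh s j) x) has_real_derivative poly (uht t j) x) (at t within {0..T})"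
    and scheme_u: "\<And>t j w. t \<in> {0..T} \<Longrightarrow> j \<in> {1..N} \<Longrightarrow> degree w \<le> k \<Longrightarrow>
      integral {X (j - 1)..X j} (\<lambda>x. poly (uht t j) x * poly w x) =
      - integral {X (j - 1)..X j} (\<lambda>x. poly (qh t j) x * poly (pderiv w) x)
      + node_trace (fl \<noteq> FluxI) bd N X t (qh t) j * poly w (X j)
      - node_trace (fl \<noteq> FluxI) bd N X t (qh t) (j - 1) * poly w (X (j - 1))"
    and scheme_q: "\<And>t j w. t \<in> {0..T} \<Longrightarrow> j \<in> {1..N} \<Longrightarrow> degree w \<le> k \<Longrightarrow>
      integral {X (j - 1)..X j} (\<lambda>x. poly (qh t j) x * poly w x) =
      - integral {X (j - 1)..X j} (\<lambda>x. poly (uh t j) x * poly (pderiv w) x)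
      + node_trace (fl = FluxI) bd N X t (uh t) j * poly w (X j)
      - node_trace (fl = FluxI) bd N X t (uh t) (j - 1) * poly w (X (j - 1))"
    and init: "\<And>j. j \<in> {1..N} \<Longrightarrow> uh 0 j = u_interp fl k X T u q 0 j"
begin

abbreviation "ul \<equiv> fl = FluxI"

abbreviation "half j \<equiv> (X j - X (j - 1)) / 2"

text \<open>Because \<open>D t 2\<close> is u_t, this is the time derivative of the coefficient of u
  that appears in the interpolation function.\<close>

definition "cu t j = pcoef ul k j (D t 2)"
definition "cq t j = pcoef (\<not> ul) k j (D t 1)"
definition "G1 j = clift ul k j (leg j k)"
definition "H1 j = clift (\<not> ul) k j (leg j k)"
definition "G2 j = clift ul k j (H1 j)"
definition "H2 j = clift (\<not> ul) k j (G1 j)"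
text \<open>\<open>W1\<close> and \<open>W2\<close> together correct the projection of u, and
  \<open>Z\<close> corrects that of q. The potential \<open>pot\<close> is a further lift of
  \<open>W1\<close>, interpolated at the other end: it is smaller by a factor h, and
  \<open>W1\<close> is minus its discrete derivative.\<close>

definition "W1 t j = smult (half j * cq t j) (G1 j)"
definition "W2 t j = smult (half j * (half j * cu t j)) (G2 j)"
definition "Z t j = smult (half j * cu t j) (H1 j)"
definition "pot t j = smult (half j * - (half j * cq t j)) (H2 j)"
definition "pu t j = proj ul k j (D t 0)"
definition "pq t j = proj (\<not> ul) k j (D t 1)"
definition "xi t j = pu t j - W2 t j - W1 t j - uh t j"
definition "eta t j = pq t j - Z t j - qh t j"

lemma k1: "k \<ge> 1" using k by simp

lemma M0: "M \<ge> 0" using Db[of 0 0 0] T by simp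

lemma cell_in: "j \<in> {1..N} \<Longrightarrow> x \<in> {X (j - 1)..X j} \<Longrightarrow> x \<in> \<Omega>"
  using cell_subset by blast

lemma D_cell:
  assumes "t \<in> {0..T}" "i < k + 3" "j \<in> {1..N}" "x \<in> {X (j - 1)..X j}"
  shows "(D t i has_real_derivative D t (Suc i) x) (at x within {X (j - 1)..X j})"
  by (rule DERIV_subset[OF DD[OF assms(1,2) cell_in[OF assms(3,4)]] cell_subset[OF assms(3)]])

lemma D_cell_cont: "t \<in> {0..T} \<Longrightarrow> i \<le> k + 3 \<Longrightarrow> j \<in> {1..N} \<Longrightarrow> continuous_on {X (j - 1)..X j} (D t i)"
  by (rule continuous_on_subset[OF Dc cell_subset])

lemma integral_leg: "j \<in> {1..N} \<Longrightarrow> integral {X (j - 1)..X j} (poly (leg j k)) = 0"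
  by (rule interval.integral_L_eq_0[OF interval_cell k1])

lemma integral_lift1: "j \<in> {1..N} \<Longrightarrow> integral {X (j - 1)..X j} (poly (clift b k j (leg j k))) = 0"
  by (rule interval.lift_mean_zero[OF interval_cell integral_leg k])

lemma lift_endpt: "j \<in> {1..N} \<Longrightarrow> integral {X (j - 1)..X j} (poly p) = 0 \<Longrightarrow> poly (clift b k j p) (endpt b X j) = 0"
  by (rule interval.lift_endpoint[OF interval_cell endpt_in])

lemma degree_clift: "j \<in> {1..N} \<Longrightarrow> degree (clift b k j p) \<le> k"
  by (rule interval.degree_lift[OF interval_cell])

lemma degrees:
  assumes "j \<in> {1..N}"
  shows "degree (W1 t j) \<le> k" "degree (W2 t j) \<le> k" "degree (Z t j) \<le> k" "degree (pot t j) \<le> k"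
    "degree (pu t j) \<le> k" "degree (pq t j) \<le> k"
  using degree_clift[OF assms] interval.degree_radau_proj[OF interval_cell[OF assms]]
  by (auto simp: W1_def W2_def Z_def pot_def pu_def pq_def G1_def G2_def H1_def H2_def
      intro: order_trans[OF degree_smult_le])

lemma degree_xi_eta:
  assumes "t \<in> {0..T}" "j \<in> {1..N}"
  shows "degree (xi t j) \<le> k" "degree (eta t j) \<le> k"
  unfolding xi_def eta_def by (intro degree_diff_le degrees deg assms)+

text \<open>The corrections vanish at the end from which the flux of u is taken, so the corrected
  projection still has the exact trace there and the local identities fit together with homogeneous
  data.\<close>

lemma eta_eq_form:
  assumes t: "t \<in> {0..T}" and j: "j \<in> {1..N}" and w: "degree w \<le> k"
  shows "cell_integral j (eta t j) w = form ul bd j (xi t) w"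
proof -
  have con: "consistent ul bd t (D t 0)"
    using boundary_condition_consistent(1)[OF bc t] D0[OF t] by (cases bd) auto
  have ends: "poly (pu t j - W2 t j - W1 t j) (endpt ul X j) = D t 0 (endpt ul X j)" if j: "j \<in> {1..N}" for j
    using interval.radau_proj_endpoint[OF interval_cell[OF j] endpt_in]
      lift_endpt[OF j integral_leg[OF j]] lift_endpt[OF j integral_lift1[OF j]]
    by (simp add: pu_def W1_def W2_def G1_def G2_def H1_def)
  have tr: "D t 0 (X i) - node_trace ul bd N X t (uh t) i = node_trace ul (homogeneous bd) N X 0 (xi t) i"
    if "i \<le> N" for i
    using trace_error[OF con ends that] by (simp add: xi_def[abs_def])
  have u': "(D t 0 has_real_derivative D t 1 x) (at x within {X (j - 1)..X j})" if "x \<in> {X (j - 1)..X j}" for x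
    using D_cell[OF t _ j that, of 0] by (simp add: One_nat_def)
  have q0: "continuous_on {X (j - 1)..X j} (D t 1)" by (rule D_cell_cont[OF t _ j]) simp
  have le: "j \<le> N" "j - 1 \<le> N" using j by auto
  have "cell_integral j (eta t j) w = - cell_integral j (xi t j) (pderiv w)
      + (D t 0 (X j) - node_trace ul bd N X t (uh t) j) * poly w (X j)
      - (D t 0 (X (j - 1)) - node_trace ul bd N X t (uh t) (j - 1)) * poly w (X (j - 1))"
    unfolding eta_def xi_def pq_def pu_def Z_def W1_def W2_def G1_def G2_def H1_def cq_def
    by (rule interval.gradient_identity[OF interval_cell[OF j] k w u' q0 scheme_q[OF t j w]])
  also have "\<dots> = form ul bd j (xi t) w"
    using tr[OF le(1)] tr[OF le(2)] by (simp add: form_def)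
  finally show ?thesis .
qed

text \<open>The projection of u_t is the time derivative of \<open>pu\<close>, so the left side is
  the time derivative of \<open>pu - uh\<close> in weak form.\<close>

lemma time_derivative_eq_form:
  assumes t: "t \<in> {0..T}" and j: "j \<in> {1..N}" and w: "degree w \<le> k"
  shows "cell_integral j (proj ul k j (D t 2) - uht t j) w = form (\<not> ul) bd j (eta t) w"
proof -
  have con: "consistent (\<not> ul) bd t (D t 1)"
    using boundary_condition_consistent(2)[OF bc t] D1[OF t] by (cases bd) auto
  have ends: "poly (pq t j - Z t j) (endpt (\<not> ul) X j) = D t 1 (endpt (\<not> ul) X j)" if j: "j \<in> {1..N}" for j
    using interval.radau_proj_endpoint[OF interval_cell[OF j] endpt_in]
      lift_endpt[OF j integral_leg[OF j]]
    by (simp add: pq_def Z_def H1_def)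
  have tr: "D t 1 (X i) - node_trace (\<not> ul) bd N X t (qh t) i = node_trace (\<not> ul) (homogeneous bd) N X 0 (eta t) i"
    if "i \<le> N" for i
    using trace_error[OF con ends that] by (simp add: eta_def[abs_def])
  have q': "(D t 1 has_real_derivative D t 2 x) (at x within {X (j - 1)..X j})" if "x \<in> {X (j - 1)..X j}" for x
    using D_cell[OF t _ j that, of 1] by (simp add: numeral_2_eq_2 One_nat_def)
  have r0: "continuous_on {X (j - 1)..X j} (D t 2)" by (rule D_cell_cont[OF t _ j]) simp
  have le: "j \<le> N" "j - 1 \<le> N" using j by auto
  have "cell_integral j (proj ul k j (D t 2) - uht t j) w = - cell_integral j (eta t j) (pderiv w)
      + (D t 1 (X j) - node_trace (\<not> ul) bd N X t (qh t) j) * poly w (X j)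
      - (D t 1 (X (j - 1)) - node_trace (\<not> ul) bd N X t (qh t) (j - 1)) * poly w (X (j - 1))"
    unfolding eta_def pq_def Z_def H1_def cu_def
    by (rule interval.divergence_identity[OF interval_cell[OF j] k w q' r0 scheme_u[OF t j w]])
  also have "\<dots> = form (\<not> ul) bd j (eta t) w"
    using tr[OF le(1)] tr[OF le(2)] by (simp add: form_def)
  finally show ?thesis .
qed

text \<open>\<open>G1\<close> has mean zero because k \<ge> 2, so lifting it once more inverts the
  discrete derivative. This provides the preimage \<kappa> for the duality argument.\<close>

lemma W1_eq_form:
  assumes j: "j \<in> {1..N}" and w: "degree w \<le> k"
  shows "cell_integral j (W1 s j - W1 t j) w = - form (\<not> ul) bd j (\<lambda>j. pot s j - pot t j) w"
proof -
  interpret interval "X (j - 1)" "X j" by (rule interval_cell[OF j])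
  have pot: "cell_integral j (pot t j) (pderiv w) = cell_integral j (W1 t j) w" for t
    unfolding pot_def H2_def W1_def G1_def lift_scaled[OF integral_lift1[OF j] w k1]
    by (simp only: poly_integral_smult mult_minus_left minus_minus)
  have "form (\<not> ul) bd j (\<lambda>j. pot s j - pot t j) w = - cell_integral j (pot s j - pot t j) (pderiv w)"
    by (rule form_zero_trace[OF _ j])
      (simp add: pot_def H2_def G1_def lift_endpt[OF _ integral_lift1])
  then show ?thesis by (simp only: poly_integral_diff pot minus_minus)
qed

section \<open>Bounds of the corrections\<close>

lemma power_cell_le:
  assumes "j \<in> {1..N}" shows "(X j - X (j - 1)) ^ n \<le> h ^ n"
  using cell_len_le[OF assms] cell_len_pos[OF assms] by (intro power_mono) (auto simp: cell_len_def)

lemma half_le: "j \<in> {1..N} \<Longrightarrow> 0 \<le> half j \<and> half j \<le> h"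
  using cell_len_le[of j] cell_len_pos[of j] by (auto simp: cell_len_def)

lemma taylor_coef_bound:
  assumes j: "j \<in> {1..N}" and n: "n \<le> k + 1" and K: "K \<ge> 0"
    and "\<And>i x. i < n \<Longrightarrow> x \<in> {X (j - 1)..X j} \<Longrightarrow> (E i has_real_derivative E (Suc i) x) (at x within {X (j - 1)..X j})"
    and "continuous_on {X (j - 1)..X j} (E 0)" "\<And>x. x \<in> {X (j - 1)..X j} \<Longrightarrow> \<bar>E n x\<bar> \<le> K"
  shows "\<bar>pcoef b k j (E 0)\<bar> \<le> radau_bound k * (K * h ^ n)"
proof -
  have "\<bar>pcoef b k j (E 0)\<bar> \<le> radau_bound k * (K * (X j - X (j - 1)) ^ n)"
    by (rule interval.radau_coef_taylor[OF interval_cell[OF j] endpt_in n assms(4-6)])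
  also have "\<dots> \<le> radau_bound k * (K * h ^ n)"
    using radau_bound_pos[of k] K by (intro mult_left_mono power_cell_le[OF j]) auto
  finally show ?thesis .
qed

text \<open>For \<open>cu\<close>, k + 1 derivatives of u_xx use up the available order k + 3
  exactly.\<close>

lemma coef_bounds:
  assumes t: "t \<in> {0..T}" and j: "j \<in> {1..N}"
  shows "\<bar>cu t j\<bar> \<le> radau_bound k * (M * h ^ (k + 1))" "\<bar>cq t j\<bar> \<le> radau_bound k * (M * h ^ (k + 1))"
proof -
  have "\<bar>pcoef b k j (D t (0 + n))\<bar> \<le> radau_bound k * (M * h ^ (k + 1))" if n: "n \<le> 2" for b n
  proof (rule taylor_coef_bound[OF j le_refl M0, of "\<lambda>i. D t (i + n)"])
    show "(D t (i + n) has_real_derivative D t (Suc i + n) x) (at x within {X (j - 1)..X j})"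
      if "i < k + 1" "x \<in> {X (j - 1)..X j}" for i x
      using D_cell[OF t _ j that(2), of "i + n"] that(1) n by simp
    show "continuous_on {X (j - 1)..X j} (D t (0 + n))" using n by (intro D_cell_cont t j) simp
    show "\<bar>D t (k + 1 + n) x\<bar> \<le> M" if "x \<in> {X (j - 1)..X j}" for x
      using n by (intro Db t cell_in[OF j that]) simp
  qed
  from this[of 2 ul] this[of 1 "\<not> ul"]
  show "\<bar>cu t j\<bar> \<le> radau_bound k * (M * h ^ (k + 1))" "\<bar>cq t j\<bar> \<le> radau_bound k * (M * h ^ (k + 1))"
    by (simp_all add: cu_def cq_def del: add_2_eq_Suc')
qed

text \<open>Lipschitz bounds in time stop below order k + 3. That leaves k + 1 derivatives for u_x
  but only k for u_xx, and so \<open>cu\<close> loses one power of h.\<close>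

lemma coef_diff_bounds:
  assumes s: "s \<in> {0..T}" and t: "t \<in> {0..T}" and j: "j \<in> {1..N}"
  shows "\<bar>cu s j - cu t j\<bar> \<le> radau_bound k * (M * \<bar>s - t\<bar> * h ^ k)"
    "\<bar>cq s j - cq t j\<bar> \<le> radau_bound k * (M * \<bar>s - t\<bar> * h ^ (k + 1))"
proof -
  interpret interval "X (j - 1)" "X j" by (rule interval_cell[OF j])
  have der: "((\<lambda>x. D s i x - D t i x) has_real_derivative D s (Suc i) x - D t (Suc i) x) (at x within {X (j - 1)..X j})"
    if "i < k + 3" "x \<in> {X (j - 1)..X j}" for i x
    using that by (intro DERIV_diff D_cell s t j)
  have cont: "continuous_on {X (j - 1)..X j} (\<lambda>x. D s i x - D t i x)" if "i \<le> k + 3" for i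
    using that by (intro continuous_on_diff D_cell_cont s t j)
  have le: "\<bar>D s i x - D t i x\<bar> \<le> M * \<bar>s - t\<bar>" if "i < k + 3" "x \<in> {X (j - 1)..X j}" for i x
    using that by (intro Dlip s t cell_in[OF j])
  have K: "M * \<bar>s - t\<bar> \<ge> 0" using M0 by simp
  have bound: "\<bar>pcoef b k j (\<lambda>x. D s (0 + n) x - D t (0 + n) x)\<bar> \<le> radau_bound k * (M * \<bar>s - t\<bar> * h ^ m)"
    if n: "m \<le> k + 1" "m + n < k + 3" for b m n
  proof (rule taylor_coef_bound[OF j n(1) K, of "\<lambda>i x. D s (i + n) x - D t (i + n) x"])
    show "((\<lambda>x. D s (i + n) x - D t (i + n) x) has_real_derivative
        D s (Suc i + n) x - D t (Suc i + n) x) (at x within {X (j - 1)..X j})"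
      if "i < m" "x \<in> {X (j - 1)..X j}" for i x
      using der[of "i + n" x] that n by simp
    show "continuous_on {X (j - 1)..X j} (\<lambda>x. D s (0 + n) x - D t (0 + n) x)" using n by (intro cont) simp
    show "\<bar>D s (m + n) x - D t (m + n) x\<bar> \<le> M * \<bar>s - t\<bar>" if "x \<in> {X (j - 1)..X j}" for x
      by (rule le[OF n(2) that])
  qed
  have "cu s j - cu t j = pcoef ul k j (\<lambda>x. D s 2 x - D t 2 x)"
    unfolding cu_def using k by (intro radau_coef_diff[symmetric] D_cell_cont s t j) auto
  then show "\<bar>cu s j - cu t j\<bar> \<le> radau_bound k * (M * \<bar>s - t\<bar> * h ^ k)"
    using bound[of k 2 ul] by (simp del: add_2_eq_Suc')
  have "cq s j - cq t j = pcoef (\<not> ul) k j (\<lambda>x. D s 1 x - D t 1 x)"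
    unfolding cq_def by (intro radau_coef_diff[symmetric] D_cell_cont s t j) auto
  then show "\<bar>cq s j - cq t j\<bar> \<le> radau_bound k * (M * \<bar>s - t\<bar> * h ^ (k + 1))"
    using bound[of "k + 1" 1 "\<not> ul"] by simp
qed

lemma lift_le:
  assumes j: "j \<in> {1..N}" and x: "x \<in> {X (j - 1)..X j}"
  shows "\<bar>poly (clift b k j (leg j k)) x\<bar> \<le> lift_bound k"
    "\<bar>poly (clift b' k j (clift b k j (leg j k))) x\<bar> \<le> lift2_bound k"
proof -
  interpret interval "X (j - 1)" "X j" by (rule interval_cell[OF j])
  have 1: "\<bar>poly (clift b k j (leg j k)) x\<bar> \<le> lift_bound k" if "x \<in> {X (j - 1)..X j}" for x
    using abs_lift_le[where p = "L k" and e = "endpt b X j" and k = k and x = x, OF _ that endpt_in] abs_L_le[of k k]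
    by (fastforce simp: lift_bound_def)
  then show "\<bar>poly (clift b k j (leg j k)) x\<bar> \<le> lift_bound k" using x by blast
  show "\<bar>poly (clift b' k j (clift b k j (leg j k))) x\<bar> \<le> lift2_bound k"
    using abs_lift_le[where p = "clift b k j (leg j k)" and e = "endpt b' X j" and k = k and x = x, OF 1 x endpt_in]
    by (simp add: lift2_bound_def)
qed

lemma smult_le:
  assumes "\<bar>a :: real\<bar> \<le> A" "\<bar>poly p x\<bar> \<le> B" shows "\<bar>poly (smult a p) x\<bar> \<le> A * B"
  using mult_mono'[OF assms(1) assms(2) abs_ge_zero abs_ge_zero] by (simp add: abs_mult)

lemma half_mult_le:
  assumes "j \<in> {1..N}" "\<bar>a\<bar> \<le> A" shows "\<bar>half j * a\<bar> \<le> h * A"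
proof -
  have "\<bar>half j * a\<bar> = half j * \<bar>a\<bar>" using half_le[OF assms(1)] by (simp add: abs_mult)
  also have "\<dots> \<le> h * A" using half_le[OF assms(1)] assms(2) by (intro mult_mono) auto
  finally show ?thesis .
qed

lemma correction_bounds:
  assumes t: "t \<in> {0..T}" and j: "j \<in> {1..N}" and x: "x \<in> {X (j - 1)..X j}"
  shows "\<bar>poly (W1 t j) x\<bar> \<le> radau_bound k * lift_bound k * M * h ^ (k + 2)"
    "\<bar>poly (Z t j) x\<bar> \<le> radau_bound k * lift_bound k * M * h ^ (k + 2)"
    "\<bar>poly (W2 t j) x\<bar> \<le> radau_bound k * lift2_bound k * M * h ^ (k + 3)"
proof -
  note l = lift_le[OF j x] and cb = coef_bounds[OF t j]
  have "\<bar>poly (W1 t j) x\<bar> \<le> (h * (radau_bound k * (M * h ^ (k + 1)))) * lift_bound k"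
    unfolding W1_def G1_def by (intro smult_le half_mult_le j cb l)
  then show "\<bar>poly (W1 t j) x\<bar> \<le> radau_bound k * lift_bound k * M * h ^ (k + 2)"
    by (simp add: mult_ac power_add power2_eq_square)
  have "\<bar>poly (Z t j) x\<bar> \<le> (h * (radau_bound k * (M * h ^ (k + 1)))) * lift_bound k"
    unfolding Z_def H1_def by (intro smult_le half_mult_le j cb l)
  then show "\<bar>poly (Z t j) x\<bar> \<le> radau_bound k * lift_bound k * M * h ^ (k + 2)"
    by (simp add: mult_ac power_add power2_eq_square)
  have "\<bar>poly (W2 t j) x\<bar> \<le> (h * (h * (radau_bound k * (M * h ^ (k + 1))))) * lift2_bound k"
    unfolding W2_def G2_def H1_def by (intro smult_le half_mult_le j cb l)
  then show "\<bar>poly (W2 t j) x\<bar> \<le> radau_bound k * lift2_bound k * M * h ^ (k + 3)"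
    by (simp add: mult_ac power_add power3_eq_cube)
qed

text \<open>\<open>W2\<close> has two bounds: one proportional to the time difference with the lost
  power of h, and one of full order for all times. They become \<open>D2\<close> and
  \<open>D1\<close> of the abstract setting.\<close>

lemma correction_diff_bounds:
  assumes s: "s \<in> {0..T}" and t: "t \<in> {0..T}" and j: "j \<in> {1..N}" and x: "x \<in> {X (j - 1)..X j}"
  shows "\<bar>poly (W1 s j - W1 t j) x\<bar> \<le> radau_bound k * lift_bound k * M * h ^ (k + 2) * \<bar>s - t\<bar>"
    "\<bar>poly (pot s j - pot t j) x\<bar> \<le> radau_bound k * lift2_bound k * M * h ^ (k + 3) * \<bar>s - t\<bar>"
    "\<bar>poly (W2 s j - W2 t j) x\<bar> \<le> radau_bound k * lift2_bound k * M * h ^ (k + 2) * \<bar>s - t\<bar>"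
    "\<bar>poly (W2 s j - W2 t j) x\<bar> \<le> 2 * (radau_bound k * lift2_bound k * M * h ^ (k + 3))"
proof -
  note l = lift_le[OF j x] and cb = coef_diff_bounds[OF s t j]
  have "W1 s j - W1 t j = smult (half j * (cq s j - cq t j)) (G1 j)"
    unfolding W1_def smult_diff_left[symmetric] by (simp only: right_diff_distrib)
  then have "\<bar>poly (W1 s j - W1 t j) x\<bar> \<le> (h * (radau_bound k * (M * \<bar>s - t\<bar> * h ^ (k + 1)))) * lift_bound k"
    unfolding G1_def by (simp only:) (intro smult_le half_mult_le j cb l)
  then show "\<bar>poly (W1 s j - W1 t j) x\<bar> \<le> radau_bound k * lift_bound k * M * h ^ (k + 2) * \<bar>s - t\<bar>"
    by (simp add: mult_ac power_add power2_eq_square)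
  have "pot s j - pot t j = smult (half j * (half j * (cq t j - cq s j))) (H2 j)"
    unfolding pot_def smult_diff_left[symmetric] by (simp only: right_diff_distrib) simp
  moreover have "\<bar>cq t j - cq s j\<bar> \<le> radau_bound k * (M * \<bar>s - t\<bar> * h ^ (k + 1))"
    using cb(2) by (simp add: abs_minus_commute)
  ultimately have "\<bar>poly (pot s j - pot t j) x\<bar> \<le> (h * (h * (radau_bound k * (M * \<bar>s - t\<bar> * h ^ (k + 1))))) * lift2_bound k"
    unfolding H2_def G1_def by (simp only:) (intro smult_le half_mult_le j l)
  then show "\<bar>poly (pot s j - pot t j) x\<bar> \<le> radau_bound k * lift2_bound k * M * h ^ (k + 3) * \<bar>s - t\<bar>"
    by (simp add: mult_ac power_add power3_eq_cube)
  have "W2 s j - W2 t j = smult (half j * (half j * (cu s j - cu t j))) (G2 j)"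
    unfolding W2_def smult_diff_left[symmetric] by (simp only: right_diff_distrib)
  then have "\<bar>poly (W2 s j - W2 t j) x\<bar> \<le> (h * (h * (radau_bound k * (M * \<bar>s - t\<bar> * h ^ k)))) * lift2_bound k"
    unfolding G2_def H1_def by (simp only:) (intro smult_le half_mult_le j cb l)
  then show "\<bar>poly (W2 s j - W2 t j) x\<bar> \<le> radau_bound k * lift2_bound k * M * h ^ (k + 2) * \<bar>s - t\<bar>"
    by (simp add: mult_ac power_add power2_eq_square)
  show "\<bar>poly (W2 s j - W2 t j) x\<bar> \<le> 2 * (radau_bound k * lift2_bound k * M * h ^ (k + 3))"
    using correction_bounds(3)[OF s j x] correction_bounds(3)[OF t j x] by simp
qed

end

context ldg_error
begin

section \<open>Time derivatives\<close>

lemma D_time: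
  assumes "t \<in> {0..T}" "x \<in> \<Omega>"
  shows "((\<lambda>r. D r 0 x) has_real_derivative D t 2 x) (at t within {0..T})"
  by (rule DERIV_cong_on[OF assms(1) D0[OF _ assms(2)] Dt[OF assms]])

text \<open>Lipschitz in space through the bound of order 3 and in time by hypothesis;
  differentiation under the integral asks for joint continuity.\<close>

lemma D2_jointly_continuous: "continuous_on ({0..T} \<times> \<Omega>) (\<lambda>(r, x). D r 2 x)"
proof (rule continuous_on_iff[THEN iffD2], intro ballI allI impI)
  fix z :: "real \<times> real" and e :: real
  assume z: "z \<in> {0..T} \<times> \<Omega>" and e: "e > 0"
  obtain t x where tx: "z = (t, x)" "t \<in> {0..T}" "x \<in> \<Omega>" using z by auto
  have "\<bar>D r 2 y - D t 2 x\<bar> \<le> 2 * M * dist (r, y) (t, x)" if ry: "r \<in> {0..T}" "y \<in> \<Omega>" for r y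
  proof -
    have "norm (D r 2 y - D r 2 x) \<le> M * norm (y - x)"
    proof (rule field_differentiable_bound[of \<Omega> _ "D r 3"])
      show "(D r 2 has_real_derivative D r 3 v) (at v within \<Omega>)" if "v \<in> \<Omega>" for v
        using DD[OF ry(1) _ that, of 2] by (simp add: numeral_3_eq_3 numeral_2_eq_2)
      show "norm (D r 3 v) \<le> M" if "v \<in> \<Omega>" for v using Db[OF ry(1) _ that, of 3] by simp
    qed (use ry tx in auto)
    moreover have "\<bar>D r 2 x - D t 2 x\<bar> \<le> M * \<bar>r - t\<bar>" using Dlip[OF tx(2) ry(1) _ tx(3), of 2] by simp
    moreover have "M * norm (y - x) \<le> M * dist (r, y) (t, x)"
      using M0 dist_snd_le[of "(r, y)" "(t, x)"] by (intro mult_left_mono) (auto simp: dist_norm)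
    moreover have "M * \<bar>r - t\<bar> \<le> M * dist (r, y) (t, x)"
      using M0 dist_fst_le[of "(r, y)" "(t, x)"] by (intro mult_left_mono) (auto simp: dist_real_def)
    ultimately show ?thesis by simp
  qed
  note le = this
  show "\<exists>d>0. \<forall>z'\<in>{0..T} \<times> \<Omega>. dist z' z < d \<longrightarrow>
      dist (case z' of (r, x) \<Rightarrow> D r 2 x) (case z of (r, x) \<Rightarrow> D r 2 x) < e"
  proof (rule exI[of _ "e / (2 * M + 1)"], intro conjI ballI impI)
    show "e / (2 * M + 1) > 0" using e M0 by (intro divide_pos_pos) auto
  next
    fix z' assume z': "z' \<in> {0..T} \<times> \<Omega>" "dist z' z < e / (2 * M + 1)"
    obtain r y where ry: "z' = (r, y)" "r \<in> {0..T}" "y \<in> \<Omega>" using z' by auto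
    have "\<bar>D r 2 y - D t 2 x\<bar> \<le> 2 * M * dist z' z" using le[OF ry(2,3)] by (simp add: ry tx)
    also have "\<dots> \<le> (2 * M + 1) * dist z' z" by (intro mult_right_mono) auto
    also have "\<dots> < e" using z'(2) M0 by (simp add: field_simps)
    finally show "dist (case z' of (r, x) \<Rightarrow> D r 2 x) (case z of (r, x) \<Rightarrow> D r 2 x) < e"
      by (simp add: ry tx dist_real_def)
  qed
qed

lemma integral_time_derivative:
  assumes t: "t \<in> {0..T}" and j: "j \<in> {1..N}"
  shows "((\<lambda>r. integral {X (j - 1)..X j} (\<lambda>x. D r 0 x * poly w x)) has_real_derivative
    integral {X (j - 1)..X j} (\<lambda>x. D t 2 x * poly w x)) (at t within {0..T})"
proof -
  have "((\<lambda>r. integral (cbox (X (j - 1)) (X j)) (\<lambda>x. D r 0 x * poly w x)) has_real_derivative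
    integral (cbox (X (j - 1)) (X j)) (\<lambda>x. D t 2 x * poly w x)) (at t within {0..T})"
  proof (rule leibniz_rule_field_derivative)
    show "((\<lambda>r. D r 0 x * poly w x) has_real_derivative D r 2 x * poly w x) (at r within {0..T})"
      if "r \<in> {0..T}" "x \<in> cbox (X (j - 1)) (X j)" for r x
    proof -
      have "x \<in> \<Omega>" using that(2) by (intro cell_in[OF j]) (simp add: box_real)
      then show ?thesis by (rule DERIV_cmult_right[OF D_time[OF that(1)]])
    qed
    show "(\<lambda>x. D r 0 x * poly w x) integrable_on cbox (X (j - 1)) (X j)" if "r \<in> {0..T}" for r
      unfolding box_real by (intro cont_mult_integrable D_cell_cont that j) simp
    have sub: "{0..T} \<times> cbox (X (j - 1)) (X j) \<subseteq> {0..T} \<times> \<Omega>"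
      using cell_subset[OF j] by (auto simp: box_real)
    have "continuous_on ({0..T} \<times> cbox (X (j - 1)) (X j)) (\<lambda>z. (case z of (r, x) \<Rightarrow> D r 2 x) * poly w (snd z))"
      by (intro continuous_intros continuous_on_subset[OF D2_jointly_continuous sub])
    then show "continuous_on ({0..T} \<times> cbox (X (j - 1)) (X j)) (\<lambda>(r, x). D r 2 x * poly w x)"
      by (simp add: case_prod_beta)
  qed (use t in auto)
  then show ?thesis by (simp add: box_real)
qed

lemma pcoef_time_derivative:
  assumes t: "t \<in> {0..T}" and j: "j \<in> {1..N}"
  shows "((\<lambda>r. pcoef b k j (D r 0)) has_real_derivative pcoef b k j (D t 2)) (at t within {0..T})"
proof -
  interpret interval "X (j - 1)" "X j" by (rule interval_cell[OF j])
  have e: "endpt b X j \<in> \<Omega>"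
    using X_in[of j] X_in[of "j - 1"] j by (auto simp: endpt_def)
  have l: "((\<lambda>r. lcoef m (D r 0)) has_real_derivative lcoef m (D t 2)) (at t within {0..T})" for m
    unfolding lcoef_def by (rule DERIV_cmult[OF integral_time_derivative[OF t j]])
  have "((\<lambda>r. \<Sum>m\<le>k. lcoef m (D r 0) * poly (L m) (endpt b X j)) has_real_derivative
      (\<Sum>m\<le>k. lcoef m (D t 2) * poly (L m) (endpt b X j))) (at t within {0..T})"
    by (intro DERIV_sum DERIV_cmult_right l)
  then show ?thesis
    unfolding radau_coef_def legendre_proj_def poly_sum poly_smult
    by (intro DERIV_cmult DERIV_diff D_time[OF t e])
qed

lemma uh_integral_derivative:
  assumes t: "t \<in> {0..T}" and j: "j \<in> {1..N}"
  shows "((\<lambda>r. cell_integral j (uh r j) w) has_real_derivative cell_integral j (uht t j) w) (at t within {0..T})"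
proof -
  obtain l :: "nat \<Rightarrow> real poly" where l: "\<And>p. degree p \<le> k \<Longrightarrow> p = (\<Sum>i\<le>k. smult (poly p (real i)) (l i))"
    using lagrange_basis[of k] by blast
  have eq: "cell_integral j p w = (\<Sum>i\<le>k. poly p (real i) * cell_integral j (l i) w)" if "degree p \<le> k" for p
    using cell_integral_sum_left[of j "\<lambda>i. poly p (real i)" l "{..k}" w] l[OF that] by simp
  have "((\<lambda>r. \<Sum>i\<le>k. poly (uh r j) (real i) * cell_integral j (l i) w) has_real_derivative
      (\<Sum>i\<le>k. poly (uht t j) (real i) * cell_integral j (l i) w)) (at t within {0..T})"
    by (intro DERIV_sum DERIV_cmult_right uh_deriv t j)
  moreover have e: "cell_integral j (uh r j) w = (\<Sum>i\<le>k. poly (uh r j) (real i) * cell_integral j (l i) w)"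
    if "r \<in> {0..T}" for r
    by (rule eq[OF deg(1)[OF that j]])
  ultimately show ?thesis
    unfolding eq[OF deg(3)[OF t j]] by (intro DERIV_cong_on[OF t e])
qed

text \<open>The error plus its correction: a quantity whose time derivative is accessible without
  differentiating the correction.\<close>

definition "yv t j = pu t j - uh t j"

text \<open>Projection and time derivative commute: tested with a basis polynomial, the projection
  is an integral of u minus a multiple of \<open>pcoef\<close>, and both have explicit time
  derivatives.\<close>

lemma coords_derivative:
  assumes t: "t \<in> {0..T}" and i: "i \<in> index k"
  shows "((\<lambda>r. coords (yv r) i) has_real_derivative
    cell_integral (fst i) (proj ul k (fst i) (D t 2) - uht t (fst i)) (basis i)) (at t within {0..T})"
proof -
  have j: "fst i \<in> {1..N}" using i by auto
  let ?j = "fst i"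
  interpret interval "X (?j - 1)" "X ?j" by (rule interval_cell[OF j])
  have 1: "cell_integral ?j (proj ul k ?j v) (basis i) =
      integral {X (?j - 1)..X ?j} (\<lambda>x. v x * poly (basis i) x) - pcoef ul k ?j v * cell_integral ?j (leg ?j k) (basis i)"
    if "continuous_on {X (?j - 1)..X ?j} v" for v
    using radau_proj_integral[OF that degree_basis[OF i], of "endpt ul X ?j"] by simp
  have eq: "coords (yv r) i = integral {X (?j - 1)..X ?j} (\<lambda>x. D r 0 x * poly (basis i) x)
      - pcoef ul k ?j (D r 0) * cell_integral ?j (leg ?j k) (basis i) - cell_integral ?j (uh r ?j) (basis i)"
    if "r \<in> {0..T}" for r
    unfolding coords_def yv_def pu_def poly_integral_diff
    by (subst 1) (use D_cell_cont[OF that _ j, of 0] in auto)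
  have "((\<lambda>r. integral {X (?j - 1)..X ?j} (\<lambda>x. D r 0 x * poly (basis i) x)
      - pcoef ul k ?j (D r 0) * cell_integral ?j (leg ?j k) (basis i) - cell_integral ?j (uh r ?j) (basis i))
    has_real_derivative integral {X (?j - 1)..X ?j} (\<lambda>x. D t 2 x * poly (basis i) x)
      - pcoef ul k ?j (D t 2) * cell_integral ?j (leg ?j k) (basis i) - cell_integral ?j (uht t ?j) (basis i))
    (at t within {0..T})"
    by (intro DERIV_diff DERIV_cmult_right integral_time_derivative pcoef_time_derivative uh_integral_derivative t j)
  moreover have "cell_integral ?j (proj ul k ?j (D t 2) - uht t ?j) (basis i) =
      integral {X (?j - 1)..X ?j} (\<lambda>x. D t 2 x * poly (basis i) x)
      - pcoef ul k ?j (D t 2) * cell_integral ?j (leg ?j k) (basis i) - cell_integral ?j (uht t ?j) (basis i)"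
    unfolding poly_integral_diff by (subst 1) (use D_cell_cont[OF t _ j, of 2] in auto)
  ultimately show ?thesis by (simp only: DERIV_cong_on[OF t eq])
qed

lemma coords_eta:
  assumes t: "t \<in> {0..T}" and i: "i \<in> index k"
  shows "coords (eta t) i = mat_app (index k) (grad_matrix ul bd) (coords (xi t)) i"
proof -
  have j: "fst i \<in> {1..N}" using i by auto
  have "coords (eta t) i = form ul bd (fst i) (xi t) (basis i)"
    unfolding coords_def by (rule eta_eq_form[OF t j degree_basis[OF i]])
  then show ?thesis
    using grad_matrix_coords[where v = "xi t", OF degree_xi_eta(1)[OF t] i] by simp
qed

text \<open>The two error equations combined: \<open>eta\<close> is G applied to \<open>xi\<close>,
  and the equation for u_t applies minus the transpose of G to \<open>eta\<close>.\<close>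

lemma coords_y_derivative:
  assumes t: "t \<in> {0..T}" and i: "i \<in> index k"
  shows "((\<lambda>r. coords (yv r) i) has_real_derivative
    - mat_app (index k) (flip (grad_matrix ul bd)) (mat_app (index k) (grad_matrix ul bd) (coords (xi t))) i)
    (at t within {0..T})"
proof -
  have j: "fst i \<in> {1..N}" using i by auto
  have "mat_app (index k) (flip (grad_matrix ul bd)) (mat_app (index k) (grad_matrix ul bd) (coords (xi t))) i =
      mat_app (index k) (flip (grad_matrix ul bd)) (coords (eta t)) i"
    unfolding mat_app_def[of _ "flip _"] by (intro sum.cong refl) (simp add: coords_eta[OF t])
  also have "\<dots> = - form (\<not> ul) bd (fst i) (eta t) (basis i)"
    by (rule flip_grad_matrix_coords[OF degree_xi_eta(2)[OF t] i])
  finally show ?thesis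
    using coords_derivative[OF t i] time_derivative_eq_form[OF t j degree_basis[OF i]] by simp
qed

section \<open>The initial error\<close>

lemma u_interp_eq:
  assumes t: "t \<in> {0..T}" and j: "j \<in> {1..N}"
  shows "u_interp fl k X T u q t j = pu t j - (W2 t j + W1 t j)"
proof -
  interpret interval "X (j - 1)" "X j" by (rule interval_cell[OF j])
  have uD: "u x r = D r 0 x" if "r \<in> {0..T}" "x \<in> {X (j - 1)..X j}" for r x
    using D0[OF that(1) cell_in[OF j that(2)]] by simp
  have qD: "q x t = D t 1 x" if "x \<in> {X (j - 1)..X j}" for x
    using D1[OF t cell_in[OF j that]] by simp
  have uc: "continuous_on {X (j - 1)..X j} (\<lambda>x. u x r)" if "r \<in> {0..T}" for r
    using D_cell_cont[OF that _ j, of 0] uD[OF that] by (simp cong: continuous_on_cong_simp)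
  have qc: "continuous_on {X (j - 1)..X j} (\<lambda>x. q x t)"
    using D_cell_cont[OF t _ j, of 1] qD by (simp cong: continuous_on_cong_simp)
  have pc: "pcoef b k j (\<lambda>x. u x r) = pcoef b k j (D r 0)" if "r \<in> {0..T}" for b r
    by (rule radau_cong(1)[OF uD[OF that] endpt_in])
  have pp: "proj b k j (\<lambda>x. u x t) = proj b k j (D t 0)" for b
    by (rule radau_cong(2)[OF uD[OF t] endpt_in])
  have pq: "pcoef b k j (\<lambda>x. q x t) = pcoef b k j (D t 1)" for b
    by (rule radau_cong(1)[OF qD endpt_in])
  \<comment> \<open>The derivative is taken relative to [0, T], where it is unique also at the two
    end points.\<close>
  have vd: "vector_derivative f (at t within {0..T}) = pcoef b k j (D t 2)"
    if f: "\<And>r. r \<in> {0..T} \<Longrightarrow> f r = pcoef b k j (\<lambda>x. u x r)" for f b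
  proof -
    have "(f has_real_derivative pcoef b k j (D t 2)) (at t within {0..T})"
      by (rule DERIV_cong_on[OF t _ pcoef_time_derivative[OF t j, of b]]) (simp only: f pc)
    then show ?thesis
      using vector_derivative_within_closed_interval[of 0 T t f] T t
      by (simp add: has_real_derivative_iff_has_vector_derivative)
  qed
  have hb: "hbar X j = half j" by (simp add: hbar_def cell_len_def)
  have vb: "vector_derivative (coef_bar k X j u) (at t within {0..T}) = pcoef True k j (D t 2)"
    by (rule vd) (rule coef_bar_eq[where v = u, OF j uc])
  have vt: "vector_derivative (coef_tilde k X j u) (at t within {0..T}) = pcoef False k j (D t 2)"
    by (rule vd) (rule coef_tilde_eq[where v = u, OF j uc])
  show ?thesis
    unfolding pu_def W1_def W2_def cu_def cq_def G1_def G2_def H1_def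
    by (cases fl)
       (simp_all add: P_minus_eq[OF j k1 uc[OF t]] P_plus_eq[OF j k1 uc[OF t]] correction_functions_eq[OF j k1]
         vb vt hb coef_bar_eq[where v = q and t = t, OF j qc] coef_tilde_eq[where v = q and t = t, OF j qc] pp pq
         power2_eq_square mult.assoc add.commute)
qed

lemma xi_0: "j \<in> {1..N} \<Longrightarrow> xi 0 j = 0"
  using init[of j] u_interp_eq[of 0 j] T by (simp add: xi_def algebra_simps)

section \<open>Error estimates\<close>

text \<open>The common size of all increments; the 2 comes from bounding an increment of
  \<open>W2\<close> by its two values separately.\<close>

definition "\<epsilon> = 2 * coord_const k * radau_bound k * (lift_bound k + lift2_bound k) * M * h ^ (k + 2)"

lemma coord_const_nonneg: "coord_const k \<ge> 0"
  using legendre_bound_ge_1[of k] by (simp add: coord_const_def)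

lemma \<epsilon>_ge:
  assumes "A \<le> 2 * radau_bound k * (lift_bound k + lift2_bound k) * M * h ^ (k + 2)"
  shows "coord_const k * A \<le> \<epsilon>"
  using mult_left_mono[OF assms coord_const_nonneg] by (simp add: \<epsilon>_def mult_ac)

lemma coords_xi: "coords (xi t) i = coords (yv t) i - coords (\<lambda>j. W1 t j + W2 t j) i"
proof -
  have "xi t = (\<lambda>j. yv t j - (W1 t j + W2 t j))"
    by (rule ext) (simp add: xi_def yv_def)
  then show ?thesis by (simp only: coords_diff)
qed

text \<open>The increment of \<open>pot\<close> acts as \<kappa>, since the transposed matrix maps
  it to the increment of \<open>W1\<close>; the increment of \<open>W2\<close> is the
  remainder.\<close>

lemma dissipative_error:
  assumes t: "t \<in> {0<..T}"
  shows "dissipative_error (index k) (grad_matrix ul bd) (\<lambda>r. coords (yv r)) (\<lambda>r. coords (\<lambda>j. W1 r j + W2 r j))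
    (\<lambda>r. coords (\<lambda>j. pot r j - pot t j)) (\<lambda>r. coords (\<lambda>j. W2 r j - W2 t j)) t h \<epsilon>"
proof
  define c1 where "c1 = radau_bound k * lift_bound k * M * h ^ (k + 2)"
  define c2 where "c2 = radau_bound k * lift2_bound k * M * h ^ (k + 2)"
  have c0: "c1 \<ge> 0" "c2 \<ge> 0"
    using radau_bound_pos[of k] lift_bound_pos[of k] M0 h_pos by (auto simp: c1_def c2_def)
  have \<epsilon>c: "coord_const k * A \<le> \<epsilon>" if "A \<le> 2 * (c1 + c2)" for A
    using that by (intro \<epsilon>_ge) (simp add: c1_def c2_def algebra_simps)
  have t': "t \<in> {0..T}" using t by auto
  have s': "s \<in> {0..T}" if "s \<in> {0..t}" for s using that t by auto
  show "finite (index k)" by simp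
  show "t > 0" using t by simp
  show "h > 0" by (rule h_pos)
  show "\<epsilon> \<ge> 0" using order_trans[OF _ \<epsilon>c[of 0]] c0 by simp
  show "continuous_on {0..t} (\<lambda>s. coords (yv s) i)" if "i \<in> index k" for i
    by (rule continuous_on_subset[OF DERIV_continuous_on[OF coords_y_derivative[OF _ that]]]) (use t in auto)
  show "((\<lambda>s. coords (yv s) i) has_real_derivative - mat_app (index k) (flip (grad_matrix ul bd))
      (mat_app (index k) (grad_matrix ul bd) (\<lambda>i. coords (yv s) i - coords (\<lambda>j. W1 s j + W2 s j) i)) i) (at s)"
    if s: "s \<in> {0<..<t}" and i: "i \<in> index k" for s i
  proof -
    have xi: "coords (xi s) = (\<lambda>i. coords (yv s) i - coords (\<lambda>j. W1 s j + W2 s j) i)"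
      by (rule ext) (rule coords_xi)
    have sT: "s \<in> {0..T}" using s t by auto
    have int: "at s within {0..T} = at s" using s t by (intro at_within_interior) auto
    show ?thesis using coords_y_derivative[OF sT i] unfolding xi int .
  qed
  show "coords (yv 0) i = coords (\<lambda>j. W1 0 j + W2 0 j) i" if i: "i \<in> index k" for i
  proof -
    have "coords (xi 0) i = 0" using xi_0[of "fst i"] i by (auto simp: coords_def)
    then show ?thesis by (simp add: coords_xi)
  qed
  have W1: "coords (\<lambda>j. W1 s j - W1 t j) i =
      mat_app (index k) (flip (grad_matrix ul bd)) (coords (\<lambda>j. pot s j - pot t j)) i" if i: "i \<in> index k" for s i
  proof -
    have j: "fst i \<in> {1..N}" using i by auto
    have "mat_app (index k) (flip (grad_matrix ul bd)) (coords (\<lambda>j. pot s j - pot t j)) i =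
        - form (\<not> ul) bd (fst i) (\<lambda>j. pot s j - pot t j) (basis i)"
      by (rule flip_grad_matrix_coords[OF _ i]) (intro degree_diff_le degrees)
    then show ?thesis
      unfolding coords_def[of "\<lambda>j. W1 s j - W1 t j"] W1_eq_form[OF j degree_basis[OF i]] by simp
  qed
  show "coords (\<lambda>j. W1 s j + W2 s j) i - coords (\<lambda>j. W1 t j + W2 t j) i =
      mat_app (index k) (flip (grad_matrix ul bd)) (coords (\<lambda>j. pot s j - pot t j)) i + coords (\<lambda>j. W2 s j - W2 t j) i"
    if i: "i \<in> index k" for s i
  proof -
    have "coords (\<lambda>j. W1 s j + W2 s j) i - coords (\<lambda>j. W1 t j + W2 t j) i =
        coords (\<lambda>j. (W1 s j - W1 t j) - (W2 t j - W2 s j)) i"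
      unfolding coords_diff[symmetric] by (simp add: algebra_simps)
    also have "\<dots> = coords (\<lambda>j. W1 s j - W1 t j) i + coords (\<lambda>j. W2 s j - W2 t j) i"
      unfolding coords_diff by simp
    finally show ?thesis using W1[OF i] by simp
  qed
  fix s assume s: "s \<in> {0..t}"
  have st: "\<bar>s - t\<bar> = t - s" "t - s \<ge> 0" using s by auto
  have hk: "h ^ (k + 3) = h * h ^ (k + 2)" by (simp add: power_add power2_eq_square power3_eq_cube)
  have "L2_set (coords (\<lambda>j. pot s j - pot t j)) (index k) \<le> coord_const k * (c2 * (h * (t - s)))"
    by (rule L2_coords_le) (use correction_diff_bounds(2)[OF s'[OF s] t'] st hk in \<open>simp add: c2_def mult_ac\<close>)
  also have "\<dots> = (coord_const k * c2) * (h * (t - s))" by simp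
  also have "\<dots> \<le> \<epsilon> * (h * (t - s))" using c0 h_pos st by (intro mult_right_mono \<epsilon>c) auto
  finally show "L2_set (coords (\<lambda>j. pot s j - pot t j)) (index k) \<le> h * \<epsilon> * (t - s)" by (simp add: mult_ac)
  have "L2_set (mat_app (index k) (flip (grad_matrix ul bd)) (coords (\<lambda>j. pot s j - pot t j))) (index k) =
      L2_set (coords (\<lambda>j. W1 s j - W1 t j)) (index k)"
    by (rule L2_set_cong) (simp_all add: W1)
  also have "\<dots> \<le> coord_const k * (c1 * (t - s))"
    by (rule L2_coords_le) (use correction_diff_bounds(1)[OF s'[OF s] t'] st in \<open>simp add: c1_def\<close>)
  also have "\<dots> = (coord_const k * c1) * (t - s)" by simp
  also have "\<dots> \<le> \<epsilon> * (t - s)" using c0 st by (intro mult_right_mono \<epsilon>c) auto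
  finally show "L2_set (mat_app (index k) (flip (grad_matrix ul bd)) (coords (\<lambda>j. pot s j - pot t j))) (index k) \<le> \<epsilon> * (t - s)" .
  have "L2_set (coords (\<lambda>j. W2 s j - W2 t j)) (index k) \<le> coord_const k * (2 * c2 * h)"
    by (rule L2_coords_le) (use correction_diff_bounds(4)[OF s'[OF s] t'] hk in \<open>simp add: c2_def mult_ac\<close>)
  also have "\<dots> = (coord_const k * (2 * c2)) * h" by simp
  also have "\<dots> \<le> \<epsilon> * h" using c0 h_pos by (intro mult_right_mono \<epsilon>c) auto
  finally show "L2_set (coords (\<lambda>j. W2 s j - W2 t j)) (index k) \<le> \<epsilon> * h" .
  have "L2_set (coords (\<lambda>j. W2 s j - W2 t j)) (index k) \<le> coord_const k * (c2 * (t - s))"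
    by (rule L2_coords_le) (use correction_diff_bounds(3)[OF s'[OF s] t'] st in \<open>simp add: c2_def\<close>)
  also have "\<dots> = (coord_const k * c2) * (t - s)" by simp
  also have "\<dots> \<le> \<epsilon> * (t - s)" using c0 st by (intro mult_right_mono \<epsilon>c) auto
  finally show "L2_set (coords (\<lambda>j. W2 s j - W2 t j)) (index k) \<le> \<epsilon> * (t - s)" .
qed

lemma L2_error_bounds:
  assumes t: "t \<in> {0..T}"
  shows "L2_set (coords (xi t)) (index k) \<le> \<epsilon> * (27 * h powr (1/2) * (1 + t * sqrt h))"
    and "L2_set (coords (eta t)) (index k) \<le> \<epsilon> * (120 * h powr (1/2) * (1 + sqrt (t * h)))"
proof -
  have \<epsilon>0: "\<epsilon> \<ge> 0"
    using order_trans[OF _ \<epsilon>_ge[of 0]] radau_bound_pos[of k] lift_bound_pos[of k] M0 h_pos by simp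
  have eta: "L2_set (coords (eta t)) (index k) = L2_set (mat_app (index k) (grad_matrix ul bd) (coords (xi t))) (index k)"
    by (rule L2_set_cong) (simp_all add: coords_eta[OF t])
  have "L2_set (coords (xi t)) (index k) \<le> \<epsilon> * (27 * h powr (1/2) * (1 + t * sqrt h)) \<and>
      L2_set (coords (eta t)) (index k) \<le> \<epsilon> * (120 * h powr (1/2) * (1 + sqrt (t * h)))"
  proof (cases "t = 0")
    \<comment> \<open>The abstract estimates require a positive time; at time 0 both discrete errors
      vanish by the choice of the initial value.\<close>
    case True
    have "coords (xi t) i = 0" if "i \<in> index k" for i
      using xi_0[of "fst i"] that True by (auto simp: coords_def)
    then have "L2_set (coords (xi t)) (index k) = 0"
      "L2_set (mat_app (index k) (grad_matrix ul bd) (coords (xi t))) (index k) = 0"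
      by (simp_all add: L2_set_def mat_app_def)
    then show ?thesis unfolding eta using \<epsilon>0 by (simp add: True)
  next
    case False
    then have t': "t \<in> {0<..T}" using t by auto
    interpret dissipative_error "index k" "grad_matrix ul bd" "\<lambda>r. coords (yv r)" "\<lambda>r. coords (\<lambda>j. W1 r j + W2 r j)"
      "\<lambda>r. coords (\<lambda>j. pot r j - pot t j)" "\<lambda>r. coords (\<lambda>j. W2 r j - W2 t j)" t h \<epsilon>
      by (rule dissipative_error[OF t'])
    have x: "coords (xi t) = (\<lambda>i. coords (yv t) i - coords (\<lambda>j. W1 t j + W2 t j) i)"
      by (rule ext) (rule coords_xi)
    have "\<epsilon> * (h + 5 * h * t powr (1/2) + 4 * h powr (3/4) * t powr (1/4)) \<le> \<epsilon> * (27 * h powr (1/2) * (1 + t * sqrt h))"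
      using t by (intro mult_left_mono time_growth_u h_pos h_le_2pi \<epsilon>0) auto
    moreover have "\<epsilon> * (h + 15 * h powr (1/2) + 48 * h powr (3/4) * t powr (1/8)) \<le> \<epsilon> * (120 * h powr (1/2) * (1 + sqrt (t * h)))"
      using t by (intro mult_left_mono time_growth_q h_pos h_le_2pi \<epsilon>0) auto
    ultimately show ?thesis
      unfolding eta x using error_bound flux_error_bound by linarith
  qed
  then show "L2_set (coords (xi t)) (index k) \<le> \<epsilon> * (27 * h powr (1/2) * (1 + t * sqrt h))"
    "L2_set (coords (eta t)) (index k) \<le> \<epsilon> * (120 * h powr (1/2) * (1 + sqrt (t * h)))" by auto
qed

end

section \<open>Pointwise error bounds at the Radau points\<close>

text \<open>The shares are those of the projection error, of \<open>W1\<close> or \<open>Z\<close>,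
  of \<open>W2\<close> with h \<le> 7, and of the discrete error. Outside the locale the constants
  retain c and k as their only arguments, which makes the final constant independent of the mesh and
  of T.\<close>

definition error_const :: "real \<Rightarrow> nat \<Rightarrow> real" where
  "error_const c k = 1 + radau_bound k * (1 + lift_bound k + 7 * lift2_bound k
     + 240 * mesh.inverse_const c k * mesh.coord_const k * (lift_bound k + lift2_bound k))"

context ldg_error
begin

lemma inverse_const_nonneg: "inverse_const k \<ge> 0"
  using legendre_bound_ge_1[of k] c_pos by (simp add: inverse_const_def)

lemma error_const_nonneg: "error_const c k \<ge> 0"
  unfolding error_const_def
  using radau_bound_pos[of k] lift_bound_pos[of k] inverse_const_nonneg coord_const_nonneg
  by (intro add_nonneg_nonneg mult_nonneg_nonneg) auto

text \<open>The h^(-1/2) of the inverse inequality meets the h^(1/2) split off before. The 240 is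
  the larger growth constant 120 times the 2 in \<epsilon>.\<close>

lemma abs_poly_le_if_L2_le:
  assumes "degree (v j) \<le> k" "j \<in> {1..N}" "x \<in> {X (j - 1)..X j}"
    and le: "L2_set (coords v) (index k) \<le> \<epsilon> * (A * h powr (1/2) * g)" and A: "A \<le> 120" "g \<ge> 0"
  shows "\<bar>poly (v j) x\<bar> \<le>
    radau_bound k * (240 * inverse_const k * coord_const k * (lift_bound k + lift2_bound k)) * (g * h ^ (k + 2) * M)"
proof -
  have \<epsilon>0: "\<epsilon> \<ge> 0"
    using order_trans[OF _ \<epsilon>_ge[of 0]] radau_bound_pos[of k] lift_bound_pos[of k] M0 h_pos by simp
  have "h powr (-1/2) * h powr (1/2) = 1" using h_pos by (simp add: powr_add[symmetric])
  then have hh: "inverse_const k * h powr (-1/2) * (\<epsilon> * (A * h powr (1/2) * g)) = inverse_const k * \<epsilon> * g * A"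
    by (simp add: mult_ac)
  have "\<bar>poly (v j) x\<bar> \<le> inverse_const k * h powr (-1/2) * L2_set (coords v) (index k)"
    by (rule abs_poly_le_L2_coords[where v = v, OF assms(2,1,3)])
  also have "\<dots> \<le> inverse_const k * h powr (-1/2) * (\<epsilon> * (A * h powr (1/2) * g))"
    using le inverse_const_nonneg by (intro mult_left_mono) auto
  also have "\<dots> = inverse_const k * \<epsilon> * g * A" by (rule hh)
  also have "\<dots> \<le> inverse_const k * \<epsilon> * g * 120"
    using A inverse_const_nonneg \<epsilon>0 by (intro mult_left_mono) auto
  also have "\<dots> = radau_bound k * (240 * inverse_const k * coord_const k * (lift_bound k + lift2_bound k)) * (g * h ^ (k + 2) * M)"
    by (simp add: \<epsilon>_def)
  finally show ?thesis .
qed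

text \<open>Superconvergence uses k + 2 derivatives of the projected function, which for q is order
  k + 3 of u.\<close>

lemma projection_errors:
  assumes t: "t \<in> {0..T}" and j: "j \<in> {1..N}"
  shows "x \<in> radau_set ul k X j \<Longrightarrow> \<bar>u x t - poly (pu t j) x\<bar> \<le> (1 + radau_bound k) * (M * h ^ (k + 2))"
    "x \<in> radau_set (\<not> ul) k X j \<Longrightarrow> \<bar>q x t - poly (pq t j) x\<bar> \<le> (1 + radau_bound k) * (M * h ^ (k + 2))"
proof -
  have *: "\<bar>D t (0 + n) x - poly (proj b k j (D t (0 + n))) x\<bar> \<le> (1 + radau_bound k) * (M * h ^ (k + 2))"
    if n: "n \<le> 1" and x: "x \<in> radau_set b k X j" for b n x
  proof -
    have "\<bar>D t (0 + n) x - poly (proj b k j (D t (0 + n))) x\<bar> \<le>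
        (1 + radau_bound k) * (M * (X j - X (j - 1)) ^ (k + 2))"
    proof (rule interval.radau_superconvergence_taylor[OF interval_cell[OF j] endpt_in, of k "\<lambda>i. D t (i + n)"])
      show "(D t (i + n) has_real_derivative D t (Suc i + n) x) (at x within {X (j - 1)..X j})"
        if "i < k + 2" "x \<in> {X (j - 1)..X j}" for i x
        using D_cell[OF t _ j that(2), of "i + n"] that(1) n by simp
      show "\<bar>D t (k + 2 + n) x\<bar> \<le> M" if "x \<in> {X (j - 1)..X j}" for x
        using n by (intro Db t cell_in[OF j that]) simp
    qed (rule radau_set_subset[OF j x])+
    also have "\<dots> \<le> (1 + radau_bound k) * (M * h ^ (k + 2))"
      using radau_bound_pos[of k] M0 by (intro mult_left_mono power_cell_le[OF j]) auto
    finally show ?thesis .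
  qed
  show "\<bar>u x t - poly (pu t j) x\<bar> \<le> (1 + radau_bound k) * (M * h ^ (k + 2))" if x: "x \<in> radau_set ul k X j"
    using *[OF _ x, of 0] D0[OF t cell_in[OF j radau_set_subset(1)[OF j x]]] by (simp add: pu_def)
  show "\<bar>q x t - poly (pq t j) x\<bar> \<le> (1 + radau_bound k) * (M * h ^ (k + 2))" if x: "x \<in> radau_set (\<not> ul) k X j"
    using *[OF _ x, of 1] D1[OF t cell_in[OF j radau_set_subset(1)[OF j x]]] by (simp add: pq_def)
qed

lemma error_u:
  assumes t: "t \<in> {0..T}" and j: "j \<in> {1..N}" and x: "x \<in> radau_set ul k X j"
  shows "\<bar>u x t - poly (uh t j) x\<bar> \<le> error_const c k * ((1 + t * sqrt h) * h ^ (k + 2) * M)"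
proof -
  define g where "g = 1 + t * sqrt h"
  define m where "m = M * h ^ (k + 2)"
  have g: "g \<ge> 1" using t h_pos by (simp add: g_def)
  have m: "m \<ge> 0" using M0 h_pos by (simp add: m_def)
  have mg: "m \<le> g * m" using mult_right_mono[OF g m] by simp
  note x' = radau_set_subset(1)[OF j x]
  define I where "I = radau_bound k * (240 * inverse_const k * coord_const k * (lift_bound k + lift2_bound k))"
  have 1: "\<bar>u x t - poly (pu t j) x\<bar> \<le> (1 + radau_bound k) * (g * m)"
  proof -
    have "\<bar>u x t - poly (pu t j) x\<bar> \<le> (1 + radau_bound k) * m"
      unfolding m_def by (rule projection_errors(1)[OF t j x])
    also have "\<dots> \<le> (1 + radau_bound k) * (g * m)"
      using mg radau_bound_pos[of k] by (intro mult_left_mono) auto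
    finally show ?thesis .
  qed
  have 2: "\<bar>poly (W1 t j) x\<bar> \<le> radau_bound k * lift_bound k * (g * m)"
  proof -
    have "\<bar>poly (W1 t j) x\<bar> \<le> radau_bound k * lift_bound k * m"
      unfolding m_def mult.assoc[symmetric] by (rule correction_bounds(1)[OF t j x'])
    also have "\<dots> \<le> radau_bound k * lift_bound k * (g * m)"
      using mg radau_bound_pos[of k] lift_bound_pos[of k] by (intro mult_left_mono) auto
    finally show ?thesis .
  qed
  have 3: "\<bar>poly (W2 t j) x\<bar> \<le> radau_bound k * lift2_bound k * 7 * (g * m)"
  proof -
    have "h ^ (k + 3) = h * h ^ (k + 2)" by (simp add: power_add power2_eq_square power3_eq_cube)
    then have "\<bar>poly (W2 t j) x\<bar> \<le> radau_bound k * lift2_bound k * (h * m)"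
      using correction_bounds(3)[OF t j x'] by (simp only: m_def mult_ac)
    also have "\<dots> \<le> radau_bound k * lift2_bound k * (7 * (g * m))"
    proof (intro mult_left_mono mult_mono)
      show "h \<le> 7" using h_le_2pi pi_approx by simp
    qed (use mg m radau_bound_pos[of k] lift_bound_pos[of k] in auto)
    finally show ?thesis by simp
  qed
  have 4: "\<bar>poly (xi t j) x\<bar> \<le> I * (g * m)"
    using abs_poly_le_if_L2_le[where v = "xi t" and A = 27 and g = g, OF degree_xi_eta(1)[OF t j] j x' L2_error_bounds(1)[OF t, folded g_def]] g
    by (simp add: I_def m_def mult_ac)
  have "u x t - poly (uh t j) x = (u x t - poly (pu t j) x) + poly (W1 t j) x + poly (W2 t j) x + poly (xi t j) x"
    by (simp add: xi_def)
  then have "\<bar>u x t - poly (uh t j) x\<bar> \<le>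
      (1 + radau_bound k) * (g * m) + radau_bound k * lift_bound k * (g * m) + radau_bound k * lift2_bound k * 7 * (g * m) + I * (g * m)"
    using 1 2 3 4 by linarith
  also have "\<dots> = error_const c k * (g * m)"
    by (simp add: error_const_def I_def algebra_simps)
  finally show ?thesis by (simp add: g_def m_def mult_ac)
qed

lemma error_q:
  assumes t: "t \<in> {0..T}" and j: "j \<in> {1..N}" and x: "x \<in> radau_set (\<not> ul) k X j"
  shows "\<bar>q x t - poly (qh t j) x\<bar> \<le> error_const c k * ((1 + sqrt (t * h)) * h ^ (k + 2) * M)"
proof -
  define g where "g = 1 + sqrt (t * h)"
  define m where "m = M * h ^ (k + 2)"
  have g: "g \<ge> 1" using t h_pos by (simp add: g_def)
  have m: "m \<ge> 0" using M0 h_pos by (simp add: m_def)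
  have mg: "m \<le> g * m" using mult_right_mono[OF g m] by simp
  note x' = radau_set_subset(1)[OF j x]
  define I where "I = radau_bound k * (240 * inverse_const k * coord_const k * (lift_bound k + lift2_bound k))"
  have 1: "\<bar>q x t - poly (pq t j) x\<bar> \<le> (1 + radau_bound k) * (g * m)"
  proof -
    have "\<bar>q x t - poly (pq t j) x\<bar> \<le> (1 + radau_bound k) * m"
      unfolding m_def by (rule projection_errors(2)[OF t j x])
    also have "\<dots> \<le> (1 + radau_bound k) * (g * m)"
      using mg radau_bound_pos[of k] by (intro mult_left_mono) auto
    finally show ?thesis .
  qed
  have 2: "\<bar>poly (Z t j) x\<bar> \<le> radau_bound k * lift_bound k * (g * m)"
  proof -
    have "\<bar>poly (Z t j) x\<bar> \<le> radau_bound k * lift_bound k * m"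
      unfolding m_def mult.assoc[symmetric] by (rule correction_bounds(2)[OF t j x'])
    also have "\<dots> \<le> radau_bound k * lift_bound k * (g * m)"
      using mg radau_bound_pos[of k] lift_bound_pos[of k] by (intro mult_left_mono) auto
    finally show ?thesis .
  qed
  \<comment> \<open>The error of q has no second correction; a nonnegative term is added so that the
    constant agrees with that of u.\<close>
  have 3: "0 \<le> radau_bound k * lift2_bound k * 7 * (g * m)"
    using radau_bound_pos[of k] lift_bound_pos[of k] g m by simp
  have 4: "\<bar>poly (eta t j) x\<bar> \<le> I * (g * m)"
    using abs_poly_le_if_L2_le[where v = "eta t" and A = 120 and g = g, OF degree_xi_eta(2)[OF t j] j x' L2_error_bounds(2)[OF t, folded g_def]] g
    by (simp add: I_def m_def mult_ac)
  have "q x t - poly (qh t j) x = (q x t - poly (pq t j) x) + poly (Z t j) x + poly (eta t j) x"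
    by (simp add: eta_def)
  then have "\<bar>q x t - poly (qh t j) x\<bar> \<le>
      (1 + radau_bound k) * (g * m) + radau_bound k * lift_bound k * (g * m) + radau_bound k * lift2_bound k * 7 * (g * m) + I * (g * m)"
    using 1 2 3 4 by linarith
  also have "\<dots> = error_const c k * (g * m)"
    by (simp add: error_const_def I_def algebra_simps)
  finally show ?thesis by (simp add: g_def m_def mult_ac)
qed

end

text \<open>Stated for every M strictly above the norm, because bounded representatives of weak
  derivatives are obtained from strict bounds.\<close>

lemma ldg_error_estimate:
  assumes k: "k \<ge> 2" and mesh: "quasi_uniform_mesh c N X" and T: "T > 0"
    and heat: "heat_solution T u0 u q" and norm: "sobolev_norm_T (k + 4) T u < ereal M"
    and bc: "boundary_condition fl bd T u q" and sol: "LDG_solution fl bd k N X T uh qh"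
    and init: "\<forall>j\<in>{1..N}. uh 0 j = u_interp fl k X T u q 0 j" and t: "t \<in> {0..T}"
  shows "max_error N (radau_set (fl = FluxI) k X) u uh t \<le>
      error_const c k * ((1 + t * sqrt (mesh_size N X)) * mesh_size N X ^ (k + 2) * M)"
    and "max_error N (radau_set (fl \<noteq> FluxI) k X) q qh t \<le>
      error_const c k * ((1 + sqrt (t * mesh_size N X)) * mesh_size N X ^ (k + 2) * M)"
    and "error_const c k \<ge> 0"
proof -
  obtain uht where uht: "\<And>t. t \<in> {0..T} \<Longrightarrow> uh t \<in> Vh k N \<and> qh t \<in> Vh k N \<and> uht t \<in> Vh k N \<and>
        (\<forall>j\<in>{1..N}. \<forall>x.
           ((\<lambda>s. poly (uh s j) x) has_real_derivative poly (uht t j) x) (at t within {0..T})) \<and>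
        (\<forall>v\<in>Vh k N. \<forall>w\<in>Vh k N. \<forall>j\<in>{1..N}.
           ip X j (poly (uht t j)) (poly (v j)) =
             - ip X j (poly (qh t j)) (poly (pderiv (v j)))
             + flux_q fl bd N X t (qh t) j * poly (v j) (X j)
             - flux_q fl bd N X t (qh t) (j - 1) * poly (v j) (X (j - 1)) \<and>
           ip X j (poly (qh t j)) (poly (w j)) =
             - ip X j (poly (uh t j)) (poly (pderiv (w j)))
             + flux_u fl bd N X t (uh t) j * poly (w j) (X j)
             - flux_u fl bd N X t (uh t) (j - 1) * poly (w j) (X (j - 1)))"
    using sol unfolding LDG_solution_def by blast
  have scheme: "integral {X (j - 1)..X j} (\<lambda>x. poly (uht t j) x * poly w x) =
        - integral {X (j - 1)..X j} (\<lambda>x. poly (qh t j) x * poly (pderiv w) x)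
        + node_trace (fl \<noteq> FluxI) bd N X t (qh t) j * poly w (X j)
        - node_trace (fl \<noteq> FluxI) bd N X t (qh t) (j - 1) * poly w (X (j - 1)) \<and>
      integral {X (j - 1)..X j} (\<lambda>x. poly (qh t j) x * poly w x) =
        - integral {X (j - 1)..X j} (\<lambda>x. poly (uh t j) x * poly (pderiv w) x)
        + node_trace (fl = FluxI) bd N X t (uh t) j * poly w (X j)
        - node_trace (fl = FluxI) bd N X t (uh t) (j - 1) * poly w (X (j - 1))"
    if "t \<in> {0..T}" "j \<in> {1..N}" "degree w \<le> k" for t j w
  proof -
    \<comment> \<open>A family with the same polynomial on all cells is an admissible test function,
      so the scheme may be tested with a single \<open>w\<close> on cell j.\<close>
    have w: "(\<lambda>_. w) \<in> Vh k N" using that(3) by (simp add: Vh_def)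
    note all = uht[OF that(1), THEN conjunct2, THEN conjunct2, THEN conjunct2, THEN conjunct2]
    show ?thesis
      using bspec[OF bspec[OF bspec[OF all w] w] that(2)]
      unfolding ip_def cell_def flux_u_trace flux_q_trace .
  qed
  have "Suc (k + 3) = k + 4" by simp
  then have n: "k + 3 \<ge> 3" "sobolev_norm_T (Suc (k + 3)) T u < ereal M"
    using norm by (simp, simp only:)
  obtain D where D: "\<And>t x. t \<in> {0..T} \<Longrightarrow> x \<in> \<Omega> \<Longrightarrow> D t 0 x = u x t"
    "\<And>t x. t \<in> {0..T} \<Longrightarrow> x \<in> \<Omega> \<Longrightarrow> D t 1 x = q x t"
    "\<And>t i x. t \<in> {0..T} \<Longrightarrow> i < k + 3 \<Longrightarrow> x \<in> \<Omega> \<Longrightarrow>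
      (D t i has_real_derivative D t (Suc i) x) (at x within \<Omega>)"
    "\<And>t i. t \<in> {0..T} \<Longrightarrow> i \<le> k + 3 \<Longrightarrow> continuous_on \<Omega> (D t i)"
    "\<And>t i x. t \<in> {0..T} \<Longrightarrow> i \<le> k + 3 \<Longrightarrow> x \<in> \<Omega> \<Longrightarrow> \<bar>D t i x\<bar> \<le> M"
    "\<And>s t i x. s \<in> {0..T} \<Longrightarrow> t \<in> {0..T} \<Longrightarrow> i < k + 3 \<Longrightarrow> x \<in> \<Omega> \<Longrightarrow> \<bar>D t i x - D s i x\<bar> \<le> M * \<bar>t - s\<bar>"
    "\<And>t x. t \<in> {0..T} \<Longrightarrow> x \<in> \<Omega> \<Longrightarrow> (u x has_real_derivative D t 2 x) (at t within {0..T})"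
    by (rule heat_solution_regularity[OF heat T n]) (rule that)
  interpret ldg_error N X c k fl bd T M u q uh qh uht D
  proof
    show "quasi_uniform_mesh c N X" "k \<ge> 2" "T > 0" "boundary_condition fl bd T u q" by fact+
    show "degree (uh t j) \<le> k" "degree (qh t j) \<le> k" "degree (uht t j) \<le> k"
      "((\<lambda>s. poly (uh s j) x) has_real_derivative poly (uht t j) x) (at t within {0..T})"
      if "t \<in> {0..T}" "j \<in> {1..N}" for t j x
      using uht[OF that(1)] that(2) by (auto simp: Vh_def)
    show "uh 0 j = u_interp fl k X T u q 0 j" if "j \<in> {1..N}" for j using init that by blast
    show "integral {X (j - 1)..X j} (\<lambda>x. poly (uht t j) x * poly w x) =
        - integral {X (j - 1)..X j} (\<lambda>x. poly (qh t j) x * poly (pderiv w) x)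
        + node_trace (fl \<noteq> FluxI) bd N X t (qh t) j * poly w (X j)
        - node_trace (fl \<noteq> FluxI) bd N X t (qh t) (j - 1) * poly w (X (j - 1))"
      "integral {X (j - 1)..X j} (\<lambda>x. poly (qh t j) x * poly w x) =
        - integral {X (j - 1)..X j} (\<lambda>x. poly (uh t j) x * poly (pderiv w) x)
        + node_trace (fl = FluxI) bd N X t (uh t) j * poly w (X j)
        - node_trace (fl = FluxI) bd N X t (uh t) (j - 1) * poly w (X (j - 1))"
      if "t \<in> {0..T}" "j \<in> {1..N}" "degree w \<le> k" for t j w
      using scheme[OF that] by blast+
  qed (fact D)+
  show "max_error N (radau_set (fl = FluxI) k X) u uh t \<le>
      error_const c k * ((1 + t * sqrt (mesh_size N X)) * mesh_size N X ^ (k + 2) * M)"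
    using error_u[OF t] unfolding h_def by (intro max_error_le k1)
  show "max_error N (radau_set (fl \<noteq> FluxI) k X) q qh t \<le>
      error_const c k * ((1 + sqrt (t * mesh_size N X)) * mesh_size N X ^ (k + 2) * M)"
    using error_q[OF t] unfolding h_def by (intro max_error_le k1)
  show "error_const c k \<ge> 0" by (rule error_const_nonneg)
qed

text \<open>Lets M decrease to the norm in an estimate that is known for all larger values.\<close>

lemma le_mult_limit:
  fixes K M a :: real
  assumes "\<And>M'. M < M' \<Longrightarrow> a \<le> K * M'" "K \<ge> 0"
  shows "a \<le> K * M"
proof (rule field_le_epsilon)
  fix e :: real assume e: "e > 0"
  have "a \<le> K * (M + e / (K + 1))" using e assms(2) by (intro assms(1)) simp
  also have "\<dots> = K * M + K / (K + 1) * e" by (simp add: distrib_left)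
  also have "\<dots> \<le> K * M + 1 * e" using e assms(2) by (intro add_left_mono mult_right_mono) auto
  finally show "a \<le> K * M + e" by simp
qed

theorem theorem4p6:
  fixes k :: nat and c :: real
  assumes "k \<ge> 2"
  shows "\<exists>C. \<forall>N X T u0 u q bd uh qh.
    quasi_uniform_mesh c N X \<and> T > 0 \<and>
    heat_solution T u0 u q \<and> sobolev_norm_T (k + 4) T u < \<infinity> \<longrightarrow>
    (boundary_condition FluxI bd T u q \<and> LDG_solution FluxI bd k N X T uh qh \<and>
     (\<forall>j\<in>{1..N}. uh 0 j = u_interp FluxI k X T u q 0 j) \<longrightarrow>
     (\<forall>t\<in>{0..T}.
        max_error N (right_radau k X) u uh t
          \<le> C * ((1 + t * sqrt (mesh_size N X)) * mesh_size N X ^ (k + 2)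
                 * real_of_ereal (sobolev_norm_T (k + 4) T u)) \<and>
        max_error N (left_radau k X) q qh t
          \<le> C * ((1 + sqrt (t * mesh_size N X)) * mesh_size N X ^ (k + 2)
                 * real_of_ereal (sobolev_norm_T (k + 4) T u)))) \<and>
    (boundary_condition FluxII bd T u q \<and> LDG_solution FluxII bd k N X T uh qh \<and>
     (\<forall>j\<in>{1..N}. uh 0 j = u_interp FluxII k X T u q 0 j) \<longrightarrow>
     (\<forall>t\<in>{0..T}.
        max_error N (left_radau k X) u uh t
          \<le> C * ((1 + t * sqrt (mesh_size N X)) * mesh_size N X ^ (k + 2)
                 * real_of_ereal (sobolev_norm_T (k + 4) T u)) \<and>
        max_error N (right_radau k X) q qh t
          \<le> C * ((1 + sqrt (t * mesh_size N X)) * mesh_size N X ^ (k + 2)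
                 * real_of_ereal (sobolev_norm_T (k + 4) T u))))"
proof (rule exI[of _ "error_const c k"], intro allI impI, elim conjE)
  fix N X T u0 u q bd uh qh
  assume mesh: "quasi_uniform_mesh c N X" and T: "T > 0" and heat: "heat_solution T u0 u q"
    and fin: "sobolev_norm_T (k + 4) T u < \<infinity>"
  define m where "m = real_of_ereal (sobolev_norm_T (k + 4) T u)"
  \<comment> \<open>A finite norm is recovered by \<open>real_of_ereal\<close>; the formal value
    minus infinity lies below every real anyway.\<close>
  have m: "sobolev_norm_T (k + 4) T u < ereal M" if "m < M" for M
    using fin that by (cases "sobolev_norm_T (k + 4) T u") (auto simp: m_def)
  define h where "h = mesh_size N X"
  have h: "h > 0" unfolding h_def using mesh.h_pos[OF mesh.intro[OF mesh]] mesh.h_def[OF mesh.intro[OF mesh]] by simp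
  have main: "max_error N (radau_set (fl = FluxI) k X) u uh t \<le> error_const c k * ((1 + t * sqrt h) * h ^ (k + 2) * m) \<and>
      max_error N (radau_set (fl \<noteq> FluxI) k X) q qh t \<le> error_const c k * ((1 + sqrt (t * h)) * h ^ (k + 2) * m)"
    if "boundary_condition fl bd T u q" "LDG_solution fl bd k N X T uh qh"
      "\<forall>j\<in>{1..N}. uh 0 j = u_interp fl k X T u q 0 j" and t: "t \<in> {0..T}" for fl t
  proof -
    note est = ldg_error_estimate[OF assms mesh T heat m that, folded h_def]
    have C: "error_const c k \<ge> 0" by (rule est(3)[of "m + 1"]) simp
    have "max_error N (radau_set (fl = FluxI) k X) u uh t \<le> error_const c k * ((1 + t * sqrt h) * h ^ (k + 2)) * m"
    proof (rule le_mult_limit)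
      show "max_error N (radau_set (fl = FluxI) k X) u uh t \<le> error_const c k * ((1 + t * sqrt h) * h ^ (k + 2)) * M'"
        if M': "m < M'" for M'
        using est(1)[OF M'] by (simp only: mult.assoc)
      show "error_const c k * ((1 + t * sqrt h) * h ^ (k + 2)) \<ge> 0"
        using C t h by (intro mult_nonneg_nonneg add_nonneg_nonneg) auto
    qed
    moreover have "max_error N (radau_set (fl \<noteq> FluxI) k X) q qh t \<le> error_const c k * ((1 + sqrt (t * h)) * h ^ (k + 2)) * m"
    proof (rule le_mult_limit)
      show "max_error N (radau_set (fl \<noteq> FluxI) k X) q qh t \<le> error_const c k * ((1 + sqrt (t * h)) * h ^ (k + 2)) * M'"
        if M': "m < M'" for M'
        using est(2)[OF M'] by (simp only: mult.assoc)
      show "error_const c k * ((1 + sqrt (t * h)) * h ^ (k + 2)) \<ge> 0"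
        using C t h by (intro mult_nonneg_nonneg add_nonneg_nonneg) auto
    qed
    ultimately show ?thesis by (simp only: mult.assoc)
  qed
  have R: "radau_set True k X = right_radau k X" "radau_set False k X = left_radau k X"
    by (auto simp: radau_set_def)
  show "(boundary_condition FluxI bd T u q \<and> LDG_solution FluxI bd k N X T uh qh \<and>
     (\<forall>j\<in>{1..N}. uh 0 j = u_interp FluxI k X T u q 0 j) \<longrightarrow>
     (\<forall>t\<in>{0..T}.
        max_error N (right_radau k X) u uh t
          \<le> error_const c k * ((1 + t * sqrt (mesh_size N X)) * mesh_size N X ^ (k + 2)
                 * real_of_ereal (sobolev_norm_T (k + 4) T u)) \<and>
        max_error N (left_radau k X) q qh t
          \<le> error_const c k * ((1 + sqrt (t * mesh_size N X)) * mesh_size N X ^ (k + 2)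
                 * real_of_ereal (sobolev_norm_T (k + 4) T u)))) \<and>
    (boundary_condition FluxII bd T u q \<and> LDG_solution FluxII bd k N X T uh qh \<and>
     (\<forall>j\<in>{1..N}. uh 0 j = u_interp FluxII k X T u q 0 j) \<longrightarrow>
     (\<forall>t\<in>{0..T}.
        max_error N (left_radau k X) u uh t
          \<le> error_const c k * ((1 + t * sqrt (mesh_size N X)) * mesh_size N X ^ (k + 2)
                 * real_of_ereal (sobolev_norm_T (k + 4) T u)) \<and>
        max_error N (right_radau k X) q qh t
          \<le> error_const c k * ((1 + sqrt (t * mesh_size N X)) * mesh_size N X ^ (k + 2)
                 * real_of_ereal (sobolev_norm_T (k + 4) T u))))"
    unfolding m_def[symmetric] h_def[symmetric]
    using main[where fl = FluxI] main[where fl = FluxII]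
    by (intro conjI impI ballI; elim conjE) (simp_all only: R flux.distinct simp_thms)
qed

end
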